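(* Let $k$ be an infinite field, $R=k[x_0,\ldots,x_n]$, and let $c,\ell$ be integers with $1\le c\le n$ and $\ell\ge c$. Let $\mathbb{L}=\{L_1,\ldots,L_\ell\}\subseteq R$ be a set of $\ell$ general linear forms, meaning that every subset of $\mathbb{L}$ of size at most $\min\{\ell,n+1\}$ is linearly independent, and let $I_{\mathbb{X}(\ell,c)}$ be the ideal of the star configuration $\mathbb{X}(\ell,c)$ of codimension $c$ in $\mathbb{P}^n$ defined by $\mathbb{L}$. \begin{enumerate} \item If $\ell=c$, then $I_{\mathbb{X}(\ell,c)}$ is always a geometrically vertex decomposable ideal. \item If $\ell=c+1$, then $I_{\mathbb{X}(\ell,c)}$ is a geometrically vertex decomposable ideal if and only if (up to reordering the variables and the linear forms in $\mathbb{L}$) the coefficients of the linear forms in $\mathbb{L}$ form a matrix that has a $(c+1)\times(c+1)$ triangular submatrix $$\left[\begin{array}{ccccccc} 0 & 0 & \cdots & a_{1,c} & * & \cdots & *\\ \vdots & \vdots & \vdots & \vdots & \vdots & \vdots & \vdots\\ 0 & a_{c,1} & \cdots & a_{c,c} & * & \cdots & *\\ a_{c+1,0} & a_{c+1,1} & \cdots & a_{c+1,c} & * & \cdots & * \end{array}\right].$$ Here the rows are indexed by $1,\ldots,c+1$, the columns are indexed by $0,\ldots,n$, and the displayed zeros are the entries in row $i$ and column $j$ with $0\le j\le c$ and $i+j<c+1$. \item If $c+1<\ell\le n+1$, then $I_{\mathbb{X}(\ell,c)}$ is a geometrically vertex decomposable ideal if and only if $I_{\mathbb{X}(\ell,\ell-1)}$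 (the ideal of the star configuration of codimension $\ell-1$ defined by the same set $\mathbb{L}$) is a geometrically vertex decomposable ideal. \item If $\ell>n+1$, then $I_{\mathbb{X}(\ell,c)}$ is never a geometrically vertex decomposable ideal. \end{enumerate}
   Context: **Star configurations.** For a set $\mathbb{L}=\{L_1,\ldots,L_\ell\}$ of linear forms as in the claim and an integer $c$ with $1\le c\le n$, $c\le \ell$, the ideal of the star configuration $\mathbb{X}(\ell,c)\subseteq\mathbb{P}^n$ of codimension $c$ associated to $\mathbb{L}$ is $$I_{\mathbb{X}(\ell,c)}=\bigcap_{\{j_1,\ldots,j_c\}\subseteq[\ell]}(L_{j_1},\ldots,L_{j_c}),$$ the intersection being over all subsets of $[\ell]=\{1,\ldots,\ell\}$ of size $c$; $\mathbb{X}(\ell,c)$ is the variety defined by this ideal. The matrix of coefficients of $\mathbb{L}$ is the $\ell\times(n+1)$ matrix whose rows are indexed by $L_1,\ldots,L_\ell$, whose columns are indexed by $x_0,\ldots,x_n$, and whose entry in row $L_i$ and column $x_j$ is the coefficient of $x_j$ in $L_i$. **Geometrically vertex decomposable ideals.** Let $R$ be a polynomial ring over $k$ in finitely many variables $x_0,\ldots,x_n$, let $y=x_j$ be a variable, and let $S=k[x_0,\ldots,\widehat{x_j},\ldots,x_n]$ be the polynomial ring in the remaining variables. A nonzero $f\in R$ is written $f=\sum_{i=0}^d\alpha_iy^i$ with $\alpha_i\in S$, $\alpha_d\neq0$; its initial $y$-form is $\mathrm{in}_y(f)=\alpha_dy^d$. For an ideal $I$, $\mathrm{in}_y(I)=(\mathrm{in}_y(f):f\in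 I)$. For a monomial order $<$, $\mathrm{in}_<(f)$ denotes the leading term of $f$; the order $<$ is $y$-compatible if $\mathrm{in}_<(\mathrm{in}_y(f))=\mathrm{in}_<(f)$ for all $f\in R$. Given a $y$-compatible order $<$ and a Gröbner basis $\{g_1,\ldots,g_m\}$ of $I$, write $g_i=y^{d_i}q_i+r_i$ with $\mathrm{in}_y(g_i)=y^{d_i}q_i$ and $y$ not dividing any term of $q_i$, and set $$C_{y,I}=(q_1,\ldots,q_m),\qquad N_{y,I}=(q_i: d_i=0).$$ These ideals are generated by elements of $S$, are regarded as ideals of $R$ or of $S$, and do not depend on the choice of Gröbner basis or of $y$-compatible order. If $\mathrm{in}_y(I)=C_{y,I}\cap(N_{y,I}+(y))$, this is called a geometric vertex decomposition of $I$ with respect to $y$. An ideal $I\subset R$ is geometrically vertex decomposable if $I$ is unmixed and either (a) $I=(1)$ or $I$ is generated by a (possibly empty) subset of the variables of $R$; or (b) there is a variable $y=x_j$ such that $\mathrm{in}_y(I)=C_{y,I}\cap(N_{y,I}+(y))$ is a geometric vertex decomposition and the contractions of $C_{y,I}$ and $N_{y,I}$ to $S$ are geometrically vertex decomposable (recursively).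
   Formalization: In part 2 the antidiagonal entries a_{i,c+1-i} of the triangular submatrix are required to be nonzero; with only the displayed zeros the "if" direction fails, e.g. n=2, c=1, L_1=x_1+x_2, L_2=x_1+t x_2 with t not 0 or 1. *)

theory Defs
  imports
    "HOL-Library.Poly_Mapping"
    "HOL-Library.Extended_Nat"
    "HOL-Combinatorics.Permutations"
    "HOL-Algebra.QuotRing"
begin

section \<open>Polynomial rings\<close>

type_synonym monom = "nat \<Rightarrow>\<^sub>0 nat"

type_synonym 'k mpoly = "monom \<Rightarrow>\<^sub>0 'k"

definition monoms :: "nat set \<Rightarrow> monom set" where
  "monoms V = {m. Poly_Mapping.keys m \<subseteq> V}"

text \<open>
  For a finite set \<open>V\<close> of indices, \<open>poly_ring V\<close> is the polynomial ring in the variables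
  \<open>x\<^sub>j\<close>, \<open>j \<in> V\<close>. All these rings live in the one type \<^typ>\<open>'k mpoly\<close>, so that
  \<open>poly_ring (V - {y})\<close> is literally a subring of \<open>poly_ring V\<close>, and the contraction of an
  ideal to it is the intersection with its carrier.
\<close>

definition poly_ring :: "nat set \<Rightarrow> 'k::field mpoly ring" where
  "poly_ring V = \<lparr>carrier = {f. Poly_Mapping.keys f \<subseteq> monoms V}, mult = (*), one = 1, zero = 0, add = (+)\<rparr>"

definition Var :: "nat \<Rightarrow> 'k::field mpoly" where
  "Var j = Poly_Mapping.single (Poly_Mapping.single j 1) 1"

definition Const :: "'k::field \<Rightarrow> 'k mpoly" where
  "Const a = Poly_Mapping.single 0 a"

lemma cring_poly_ring: "cring (poly_ring V)"
proof (rule cringI)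
  have 0: "0 \<in> monoms V" by (simp add: monoms_def)
  have plus: "s + t \<in> monoms V" if "s \<in> monoms V" "t \<in> monoms V" for s t :: monom
    using that Poly_Mapping.keys_add[of s t] by (auto simp: monoms_def)
  have mult: "Poly_Mapping.keys (f * g) \<subseteq> monoms V"
    if "Poly_Mapping.keys f \<subseteq> monoms V" "Poly_Mapping.keys g \<subseteq> monoms V" for f g :: "'a mpoly"
    using that keys_mult[of f g] plus by blast
  show "abelian_group (poly_ring V :: 'a mpoly ring)"
  proof (rule abelian_groupI)
    fix f :: "'a mpoly"
    assume "f \<in> carrier (poly_ring V)"
    then show "\<exists>g\<in>carrier (poly_ring V). g \<oplus>\<^bsub>poly_ring V\<^esub> f = \<zero>\<^bsub>poly_ring V\<^esub>"
      by (intro bexI[of _ "- f"]) (auto simp: poly_ring_def)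
  qed (use Poly_Mapping.keys_add in \<open>fastforce simp: poly_ring_def add_ac\<close>)+
  show "comm_monoid (poly_ring V :: 'a mpoly ring)"
    by (rule comm_monoidI) (use mult 0 in \<open>auto simp: poly_ring_def mult_ac\<close>)
qed (simp add: poly_ring_def distrib_right)

global_interpretation poly_vs: Vector_Spaces.vector_space
  "\<lambda>(a::'k::field) (f::'k mpoly). Const a * f"
  by unfold_locales
    (simp_all add: Const_def algebra_simps mult_single single_add flip: mult.assoc)

section \<open>Unmixed ideals\<close>

definition krull_dim :: "('a, 'b) ring_scheme \<Rightarrow> enat" where
  "krull_dim A = Sup {enat d | d. \<exists>P. (\<forall>i\<le>d. primeideal (P i) A) \<and> (\<forall>i<d. P i \<subset> P (Suc i))}"

text \<open>The associated primes of the module \<open>R/I\<close>: the prime annihilators of the classes \<open>f + I\<close>.\<close>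

definition ass_primes :: "('a, 'b) ring_scheme \<Rightarrow> 'a set \<Rightarrow> 'a set set" where
  "ass_primes R I =
     {P. primeideal P R \<and> (\<exists>f\<in>carrier R. P = {r \<in> carrier R. r \<otimes>\<^bsub>R\<^esub> f \<in> I})}"

definition unmixed :: "('a, 'b) ring_scheme \<Rightarrow> 'a set \<Rightarrow> bool" where
  "unmixed R I \<longleftrightarrow> (\<forall>P\<in>ass_primes R I. krull_dim (R Quot P) = krull_dim (R Quot I))"

section \<open>Initial forms and Groebner bases\<close>

definition ydeg :: "nat \<Rightarrow> 'k::field mpoly \<Rightarrow> nat" where
  "ydeg y f = Max ((\<lambda>m. Poly_Mapping.lookup m y) ` Poly_Mapping.keys f)"

text \<open>\<open>ycoeff y i f\<close> is the coefficient \<open>\<alpha>\<^sub>i\<close> (free of \<open>y\<close>) in \<open>f = \<Sum>\<^sub>i \<alpha>\<^sub>i y\<^sup>i\<close>.\<close>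

definition ycoeff :: "nat \<Rightarrow> nat \<Rightarrow> 'k::field mpoly \<Rightarrow> 'k mpoly" where
  "ycoeff y i f =
     (\<Sum>m \<in> {m \<in> Poly_Mapping.keys f. Poly_Mapping.lookup m y = i}.
        Poly_Mapping.single (m - Poly_Mapping.single y i) (Poly_Mapping.lookup f m))"

definition ylead :: "nat \<Rightarrow> 'k::field mpoly \<Rightarrow> 'k mpoly" where
  "ylead y f = ycoeff y (ydeg y f) f"

text \<open>For \<open>f = 0\<close> the next definition yields \<open>0\<close>, which is harmless as a generator of an ideal.\<close>

definition init_y :: "nat \<Rightarrow> 'k::field mpoly \<Rightarrow> 'k mpoly" where
  "init_y y f = ylead y f * Var y ^ ydeg y f"

definition init_y_ideal :: "nat set \<Rightarrow> nat \<Rightarrow> 'k::field mpoly set \<Rightarrow> 'k mpoly set" where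
  "init_y_ideal V y I = genideal (poly_ring V) (init_y y ` I)"

definition monomial_order :: "nat set \<Rightarrow> monom rel \<Rightarrow> bool" where
  "monomial_order V r \<longleftrightarrow>
     well_order_on (monoms V) r \<and>
     (\<forall>s t u. (s, t) \<in> r \<longrightarrow> u \<in> monoms V \<longrightarrow> (s + u, t + u) \<in> r)"

definition lead_monom :: "monom rel \<Rightarrow> 'k::field mpoly \<Rightarrow> monom" where
  "lead_monom r f = (THE m. m \<in> Poly_Mapping.keys f \<and> (\<forall>t\<in>Poly_Mapping.keys f. (t, m) \<in> r))"

text \<open>Again \<open>lead_term r 0 = 0\<close>, because all coefficients of \<open>0\<close> vanish.\<close>

definition lead_term :: "monom rel \<Rightarrow> 'k::field mpoly \<Rightarrow> 'k mpoly" where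
  "lead_term r f = Poly_Mapping.single (lead_monom r f) (Poly_Mapping.lookup f (lead_monom r f))"

definition y_compatible :: "'k::field itself \<Rightarrow> nat set \<Rightarrow> nat \<Rightarrow> monom rel \<Rightarrow> bool" where
  "y_compatible TYPE('k) V y r \<longleftrightarrow>
     (\<forall>f \<in> carrier (poly_ring V :: 'k mpoly ring). lead_term r (init_y y f) = lead_term r f)"

definition groebner_basis ::
    "nat set \<Rightarrow> monom rel \<Rightarrow> 'k::field mpoly set \<Rightarrow> 'k mpoly set \<Rightarrow> bool" where
  "groebner_basis V r G I \<longleftrightarrow>
     finite G \<and> G \<subseteq> I \<and> 0 \<notin> G \<and>
     genideal (poly_ring V) (lead_term r ` G) = genideal (poly_ring V) (lead_term r ` I)"

section \<open>Geometrically vertex decomposable ideals\<close>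

definition C_ideal :: "nat set \<Rightarrow> nat \<Rightarrow> 'k::field mpoly set \<Rightarrow> 'k mpoly set" where
  "C_ideal V y G = genideal (poly_ring V) (ylead y ` G)"

definition N_ideal :: "nat set \<Rightarrow> nat \<Rightarrow> 'k::field mpoly set \<Rightarrow> 'k mpoly set" where
  "N_ideal V y G = genideal (poly_ring V) (ylead y ` {g \<in> G. ydeg y g = 0})"

text \<open>
  \<open>CN_ideals V y I C N\<close> says that \<open>C\<close> and \<open>N\<close> are the ideals \<open>C\<^sub>y\<^sub>,\<^sub>I\<close> and \<open>N\<^sub>y\<^sub>,\<^sub>I\<close> of
  \<open>poly_ring V\<close>. As these do not depend on the monomial order and on the Groebner basis,
  quantifying both existentially is no loss.
\<close>

definition CN_ideals ::
    "nat set \<Rightarrow> nat \<Rightarrow> 'k::field mpoly set \<Rightarrow> 'k mpoly set \<Rightarrow> 'k mpoly set \<Rightarrow> bool" where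
  "CN_ideals V y I C N \<longleftrightarrow>
     (\<exists>r G. monomial_order V r \<and> y_compatible TYPE('k) V y r \<and> groebner_basis V r G I \<and>
            C = C_ideal V y G \<and> N = N_ideal V y G)"

definition geom_vertex_decomp ::
    "nat set \<Rightarrow> nat \<Rightarrow> 'k::field mpoly set \<Rightarrow> 'k mpoly set \<Rightarrow> 'k mpoly set \<Rightarrow> bool" where
  "geom_vertex_decomp V y I C N \<longleftrightarrow>
     CN_ideals V y I C N \<and>
     init_y_ideal V y I = C \<inter> (N <+>\<^bsub>poly_ring V\<^esub> genideal (poly_ring V) {Var y})"

inductive gvd_ideal :: "nat set \<Rightarrow> 'k::field mpoly set \<Rightarrow> bool" where
  unit:
    "gvd_ideal V I"
    if "ideal I (poly_ring V)" "unmixed (poly_ring V) I"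
       "I = carrier (poly_ring V)"
| variables:
    "gvd_ideal V I"
    if "ideal I (poly_ring V)" "unmixed (poly_ring V) I"
       "W \<subseteq> V" "I = genideal (poly_ring V) (Var ` W)"
| decomposition:
    "gvd_ideal V I"
    if "ideal I (poly_ring V)" "unmixed (poly_ring V) I"
       "y \<in> V" "geom_vertex_decomp V y I C N"
       "gvd_ideal (V - {y}) (C \<inter> carrier (poly_ring (V - {y})))"
       "gvd_ideal (V - {y}) (N \<inter> carrier (poly_ring (V - {y})))"

section \<open>Star configurations\<close>

definition linear_form :: "nat \<Rightarrow> 'k::field mpoly \<Rightarrow> bool" where
  "linear_form n f \<longleftrightarrow> (\<forall>m\<in>Poly_Mapping.keys f. \<exists>j\<le>n. m = Poly_Mapping.single j 1)"

text \<open>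
  The set \<open>{L\<^sub>1, \<dots>, L\<^sub>l}\<close> is given by the enumeration \<open>L\<close> restricted to \<open>{1..l}\<close>; injectivity
  says that it has \<open>l\<close> elements.
\<close>

definition general_linear_forms :: "nat \<Rightarrow> nat \<Rightarrow> (nat \<Rightarrow> 'k::field mpoly) \<Rightarrow> bool" where
  "general_linear_forms n l L \<longleftrightarrow>
     (\<forall>i\<in>{1..l}. linear_form n (L i)) \<and> inj_on L {1..l} \<and>
     (\<forall>S \<subseteq> L ` {1..l}. card S \<le> min l (n + 1) \<longrightarrow> poly_vs.independent S)"

definition star_ideal :: "nat \<Rightarrow> nat \<Rightarrow> nat \<Rightarrow> (nat \<Rightarrow> 'k::field mpoly) \<Rightarrow> 'k mpoly set" where
  "star_ideal n l c L =
     (\<Inter>J \<in> {J. J \<subseteq> {1..l} \<and> card J = c}. genideal (poly_ring {0..n}) (L ` J))"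

definition coeff_matrix :: "(nat \<Rightarrow> 'k::field mpoly) \<Rightarrow> nat \<Rightarrow> nat \<Rightarrow> 'k" where
  "coeff_matrix L i j = Poly_Mapping.lookup (L i) (Poly_Mapping.single j 1)"

text \<open>
  Rows are indexed from \<open>1\<close>, columns from \<open>0\<close>. The entries \<open>A i (c + 1 - i)\<close> are those on the
  antidiagonal bounding the triangle of zeros. They have to be nonzero: otherwise a variable
  occurring in none of the linear forms could serve as the column \<open>0\<close>, so that, e.g.,
  for \<open>c = 1\<close> and \<open>n = 2\<close> any two independent linear forms in \<open>x\<^sub>1\<close> and \<open>x\<^sub>2\<close> would qualify.
\<close>

definition triangular :: "nat \<Rightarrow> (nat \<Rightarrow> nat \<Rightarrow> 'k::field) \<Rightarrow> bool" where
  "triangular c A \<longleftrightarrow>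
     (\<forall>i\<in>{1..c + 1}. (\<forall>j\<in>{0..c}. i + j < c + 1 \<longrightarrow> A i j = 0) \<and> A i (c + 1 - i) \<noteq> 0)"

end

theory Submission
  imports Defs
begin

text \<open>
  Let \<open>Z\<close> be the set of linear forms and \<open>I\<close> the ideal of the star configuration of
  codimension \<open>c\<close>, that is, the intersection of the ideals \<open>(J)\<close> over the \<open>c\<close>-subsets \<open>J\<close> of
  \<open>Z\<close>. Put \<open>d = |Z| - c + 1\<close>. Every product of \<open>d\<close> distinct forms lies in \<open>I\<close>, since it shares a
  factor with each \<open>J\<close>, and no element of \<open>I\<close> has a term of degree below \<open>d\<close>
  (\<open>star_min_degree\<close>). What a variable \<open>y\<close> can do depends only on how many of the forms
  involve it.

  \<^item> If at least two forms involve \<open>y\<close>, take a product of \<open>d\<close> forms containing two of them. Its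
    leading coefficient \<open>q\<close> in \<open>y\<close> has degree at most \<open>d - 2\<close>. In a geometric vertex
    decomposition \<open>y q\<close> would belong to \<open>in\<^sub>y(I)\<close>, which lives in degrees at least \<open>d\<close>; so
    there is no decomposition at \<open>y\<close> (\<open>two_forms_no_decomp\<close>).
  \<^item> If exactly one form \<open>z\<close> involves \<open>y\<close>, then \<open>C\<close> and \<open>N\<close> contract to the star ideals of
    \<open>Z - {z}\<close> of codimension \<open>c\<close> and \<open>c - 1\<close> (\<open>idl_ylead_star\<close>, \<open>star_contraction_single\<close>).
    The decomposition exists because \<open>z C \<subseteq> I\<close> and \<open>z\<close> has degree one in \<open>y\<close>.
  \<^item> If no form involves \<open>y\<close>, then \<open>N\<close> contracts to the same star ideal in one variable less.

  Hence for independent forms and \<open>1 \<le> c < |Z|\<close> the ideal is geometrically vertex decomposable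
  iff the forms can be removed one after the other, each together with a variable that no
  remaining form involves. This property, \<open>triangulable\<close>, does not mention \<open>c\<close>, and it is the
  existence of the triangular submatrix; this gives the cases \<open>l = c + 1\<close> and
  \<open>c + 1 < l \<le> n + 1\<close>. If \<open>l > n + 1\<close>, counting dimensions shows that every variable is involved
  in at least two forms, so no variable can start a decomposition. If \<open>l = c\<close>, then \<open>I = (Z)\<close>
  depends only on the span of \<open>Z\<close>, and Gaussian elimination replaces \<open>Z\<close> by a triangulable
  basis.

  Two tools make this run. First, \<open>C\<close> and \<open>N\<close> are described without Groebner bases:
  \<open>C\<close> is generated by the leading coefficients in \<open>y\<close> of all elements of \<open>I\<close>, and \<open>N\<close> by the
  elements of \<open>I\<close> free of \<open>y\<close> (\<open>CN_ideals_unique\<close>), while Dickson's lemma provides a Groebner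
  basis for every ideal (\<open>CN_ideals_exist\<close>). Second, unmixedness follows from
  symmetry: the associated primes of a star ideal of independent forms are ideals \<open>(J)\<close> with
  \<open>|J| = c\<close>, any two of these are exchanged by a linear automorphism of the ring, and the
  quotient by a finite intersection of ideals whose quotients share one Krull dimension has that
  dimension too.
\<close>

section \<open>Polynomial rings and their ideals\<close>

abbreviation polys :: "nat set \<Rightarrow> 'k::field mpoly set" where
  "polys V \<equiv> carrier (poly_ring V)"

abbreviation idl :: "nat set \<Rightarrow> 'k::field mpoly set \<Rightarrow> 'k mpoly set" where
  "idl V A \<equiv> genideal (poly_ring V) A"

abbreviation lk :: "('a \<Rightarrow>\<^sub>0 'b::zero) \<Rightarrow> 'a \<Rightarrow> 'b" where
  "lk \<equiv> Poly_Mapping.lookup"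

abbreviation mkeys :: "('a \<Rightarrow>\<^sub>0 'b::zero) \<Rightarrow> 'a set" where
  "mkeys \<equiv> Poly_Mapping.keys"

abbreviation sgl :: "'a \<Rightarrow> 'b::zero \<Rightarrow> 'a \<Rightarrow>\<^sub>0 'b" where
  "sgl \<equiv> Poly_Mapping.single"

lemma poly_ring_simps [simp]:
  "mult (poly_ring V) = (*)" "one (poly_ring V) = 1" "zero (poly_ring V) = 0" "add (poly_ring V) = (+)"
  by (auto simp: poly_ring_def)

lemma polys_iff: "f \<in> polys V \<longleftrightarrow> mkeys f \<subseteq> monoms V"
  by (simp add: poly_ring_def)

lemma monoms_zero [simp]: "0 \<in> monoms V"
  by (simp add: monoms_def)

lemma keys_monom_add: "mkeys (s + t) = mkeys s \<union> mkeys (t :: monom)"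
  by (auto simp: in_keys_iff lookup_add)

lemma monoms_add_iff [simp]: "s + t \<in> monoms V \<longleftrightarrow> s \<in> monoms V \<and> t \<in> monoms V"
  by (auto simp: monoms_def keys_monom_add)

lemma monoms_single_iff [simp]: "sgl j i \<in> monoms V \<longleftrightarrow> i = 0 \<or> j \<in> V"
  by (auto simp: monoms_def)

lemma polys_mono: "f \<in> polys V \<Longrightarrow> V \<subseteq> W \<Longrightarrow> f \<in> polys W"
  by (auto simp: polys_iff monoms_def)

lemma polys_zero [simp]: "0 \<in> polys V"
  and polys_one [simp]: "1 \<in> polys V"
  and polys_Const [simp]: "Const a \<in> polys V"
  by (auto simp: polys_iff Const_def)

lemma polys_single: "sgl m a \<in> polys V \<longleftrightarrow> a = 0 \<or> m \<in> monoms V"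
  by (auto simp: polys_iff)

lemma polys_Var [simp]: "j \<in> V \<Longrightarrow> Var j \<in> polys V"
  by (auto simp: Var_def polys_single)

lemma polys_add [intro]: "f \<in> polys V \<Longrightarrow> g \<in> polys V \<Longrightarrow> f + g \<in> polys V"
  using Poly_Mapping.keys_add[of f g] by (auto simp: polys_iff)

lemma polys_mult [intro]: "f \<in> polys V \<Longrightarrow> g \<in> polys V \<Longrightarrow> f * g \<in> polys V"
  using keys_mult[of f g] by (force simp: polys_iff)

lemma polys_uminus [intro]: "f \<in> polys V \<Longrightarrow> - f \<in> polys V"
  by (simp add: polys_iff)

lemma polys_diff [intro]: "f \<in> polys V \<Longrightarrow> g \<in> polys V \<Longrightarrow> f - g \<in> polys V"
  using polys_add[of f V "- g"] by auto

lemma polys_prod [intro]: "(\<And>i. i \<in> A \<Longrightarrow> f i \<in> polys V) \<Longrightarrow> prod f A \<in> polys V"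
  by (induction A rule: infinite_finite_induct) auto

lemma polys_power [intro]: "f \<in> polys V \<Longrightarrow> f ^ i \<in> polys V"
  by (induction i) auto

text \<open>
  The additive inverse is multiplication by the constant \<open>-1\<close>, so closure under it is automatic;
  this reduces ideals of \<open>poly_ring V\<close> to the operations of the ambient type.
\<close>
lemma ideal_poly_ring_iff:
  "ideal I (poly_ring V) \<longleftrightarrow> I \<subseteq> polys V \<and> 0 \<in> I \<and> (\<forall>f\<in>I. \<forall>g\<in>I. f + g \<in> I) \<and>
     (\<forall>g\<in>polys V. \<forall>f\<in>I. g * f \<in> I)" (is "?L \<longleftrightarrow> ?R")
proof
  assume ?L
  then interpret ideal I "poly_ring V" .
  show ?R
    using additive_subgroup.a_subset[OF additive_subgroup_axioms] I_l_closed
      additive_subgroup.zero_closed[OF additive_subgroup_axioms]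
      additive_subgroup.a_closed[OF additive_subgroup_axioms]
    by auto
next
  assume R: ?R
  interpret cring "poly_ring V :: 'a mpoly ring" by (rule cring_poly_ring)
  have neg: "- f \<in> I" if "f \<in> I" for f
  proof -
    have "Const (-1) * f \<in> I" using R that polys_Const by blast
    moreover have "Const (-1) * f = - f"
      by (metis Const_def minus_mult_left mult_1 single_one single_uminus)
    ultimately show ?thesis by simp
  qed
  show ?L
  proof (rule idealI)
    show "ring (poly_ring V :: 'a mpoly ring)" by (rule ring_axioms)
    show "subgroup I (add_monoid (poly_ring V))"
    proof (rule add.subgroupI)
      fix a assume a: "a \<in> I"
      then have "\<ominus>\<^bsub>poly_ring V\<^esub> a = - a"
        using R by (intro minus_equality) auto
      then show "\<ominus>\<^bsub>poly_ring V\<^esub> a \<in> I" using neg a by simp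
    qed (use R in auto)
  qed (use R in auto, metis R mult.commute)
qed

lemma ideal_subset: "ideal I (poly_ring V) \<Longrightarrow> f \<in> I \<Longrightarrow> f \<in> polys V"
  and ideal_zero: "ideal I (poly_ring V) \<Longrightarrow> 0 \<in> I"
  and ideal_add: "ideal I (poly_ring V) \<Longrightarrow> f \<in> I \<Longrightarrow> g \<in> I \<Longrightarrow> f + g \<in> I"
  and ideal_mult: "ideal I (poly_ring V) \<Longrightarrow> h \<in> polys V \<Longrightarrow> f \<in> I \<Longrightarrow> h * f \<in> I"
  by (auto simp: ideal_poly_ring_iff)

lemma Const_0 [simp]: "Const 0 = 0" and Const_1 [simp]: "Const 1 = 1"
  by (auto simp: Const_def)

lemma Const_add: "Const (a + b) = Const a + Const b"
  and Const_mult: "Const (a * b) = Const a * Const b"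
  and Const_uminus: "Const (- a) = - Const a"
  by (simp_all add: Const_def single_add mult_single single_uminus)

lemma Const_eq_0 [simp]: "Const a = 0 \<longleftrightarrow> a = 0"
  by (metis Const_0 Const_def lookup_single_eq)

lemma Const_inverse: "a \<noteq> 0 \<Longrightarrow> Const (inverse a) * (Const a * f) = f"
  by (metis Const_1 Const_mult left_inverse mult.assoc mult_1)

lemma ideal_uminus: "ideal I (poly_ring V) \<Longrightarrow> f \<in> I \<Longrightarrow> - f \<in> I"
  using ideal_mult[of I V "Const (-1)" f] by (simp add: Const_uminus polys_uminus)

lemma ideal_diff: "ideal I (poly_ring V) \<Longrightarrow> f \<in> I \<Longrightarrow> g \<in> I \<Longrightarrow> f - g \<in> I"
  using ideal_add[of I V f "- g"] ideal_uminus by auto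

lemma ideal_sum: "ideal I (poly_ring V) \<Longrightarrow> (\<And>i. i \<in> A \<Longrightarrow> f i \<in> I) \<Longrightarrow> sum f A \<in> I"
  by (induction A rule: infinite_finite_induct) (auto intro: ideal_zero ideal_add)

lemma idealI_poly:
  "I \<subseteq> polys V \<Longrightarrow> 0 \<in> I \<Longrightarrow> (\<And>f g. f \<in> I \<Longrightarrow> g \<in> I \<Longrightarrow> f + g \<in> I) \<Longrightarrow>
   (\<And>h f. h \<in> polys V \<Longrightarrow> f \<in> I \<Longrightarrow> h * f \<in> I) \<Longrightarrow> ideal I (poly_ring V)"
  by (auto simp: ideal_poly_ring_iff)

lemma ideal_polys: "ideal (polys V) (poly_ring V)"
  by (auto intro: idealI_poly)

lemma ring_poly_ring: "ring (poly_ring V)"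
  by (rule cring.axioms(1)[OF cring_poly_ring])

lemma ideal_idl: "A \<subseteq> polys V \<Longrightarrow> ideal (idl V A) (poly_ring V)"
  by (rule ring.genideal_ideal[OF ring_poly_ring])

lemma idl_self: "A \<subseteq> idl V A"
  by (auto simp: genideal_def)

lemma idl_memI: "a \<in> A \<Longrightarrow> a \<in> idl V A"
  using idl_self by blast

lemma idl_minimal: "ideal I (poly_ring V) \<Longrightarrow> A \<subseteq> I \<Longrightarrow> idl V A \<subseteq> I"
  by (auto simp: genideal_def)

lemma idl_mono: "A \<subseteq> B \<Longrightarrow> idl V A \<subseteq> idl V B"
  by (auto simp: genideal_def)

lemma idl_subset_polys: "A \<subseteq> polys V \<Longrightarrow> idl V A \<subseteq> polys V"
  by (simp add: idl_minimal ideal_polys)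

text \<open>
  The elements with property \<open>Q\<close> form an ideal that contains the generators. Most statements
  about generated ideals below are proved by this rule, which avoids writing elements as linear
  combinations of generators.
\<close>
lemma idl_induct [consumes 2, case_names zero gen add mult]:
  assumes "f \<in> idl V A" "A \<subseteq> polys V"
    and "Q 0" "\<And>a. a \<in> A \<Longrightarrow> Q a"
    and "\<And>f g. f \<in> polys V \<Longrightarrow> g \<in> polys V \<Longrightarrow> Q f \<Longrightarrow> Q g \<Longrightarrow> Q (f + g)"
    and "\<And>h f. h \<in> polys V \<Longrightarrow> f \<in> polys V \<Longrightarrow> Q f \<Longrightarrow> Q (h * f)"
  shows "Q f"
proof -
  have "ideal {f \<in> polys V. Q f} (poly_ring V)"
    by (rule idealI_poly) (use assms in auto)
  then have "idl V A \<subseteq> {f \<in> polys V. Q f}"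
    by (rule idl_minimal) (use assms in auto)
  then show ?thesis using assms(1) by auto
qed

lemma mpoly_sum_single: "f = (\<Sum>m\<in>mkeys f. sgl m (lk f m))"
  by (rule poly_mapping_eqI)
    (auto simp: lookup_sum lookup_single when_def in_keys_iff)

lemma mpoly_induct [case_names zero single add]:
  fixes f :: "'k::field mpoly"
  assumes "Q 0" "\<And>m a. m \<in> mkeys f \<Longrightarrow> Q (sgl m a)" "\<And>g h. Q g \<Longrightarrow> Q h \<Longrightarrow> Q (g + h)"
  shows "Q f"
proof -
  have "Q (\<Sum>m\<in>A. sgl m (lk f m))" if "finite A" "A \<subseteq> mkeys f" for A
    using that by (induction A) (use assms in auto)
  then show ?thesis using mpoly_sum_single[of f] by (metis finite_keys order_refl)
qed

lemma Var_power: "Var j ^ d = (sgl (sgl j d) 1 :: 'k::field mpoly)"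
  by (induction d) (simp_all add: Var_def mult_single single_add[symmetric])

abbreviation mdvd :: "monom \<Rightarrow> monom \<Rightarrow> bool" where
  "mdvd u m \<equiv> \<forall>v. lk u v \<le> lk m v"

lemma mdvd_add_diff: "mdvd u m \<Longrightarrow> u + (m - u) = m"
  by (rule poly_mapping_eqI) (simp add: lookup_add lookup_minus)

lemma lookup_single_mult:
  fixes f :: "'k::field mpoly"
  shows "lk (sgl u a * f) m = (if mdvd u m then a * lk f (m - u) else 0)"
proof (induction f rule: mpoly_induct)
  case (single n b)
  have "u + n = m \<longleftrightarrow> mdvd u m \<and> n = m - u"
    using mdvd_add_diff[of u m] by (auto simp: lookup_add)
  then show ?case by (auto simp: mult_single lookup_single when_def)
qed (auto simp: lookup_add algebra_simps)

section \<open>Coefficients with respect to one variable\<close>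

lemma lookup_ycoeff:
  "lk (ycoeff y i f) m = (if lk m y = 0 then lk f (m + sgl y i) else 0)"
proof -
  let ?K = "{n \<in> mkeys f. lk n y = i}"
  have eq: "n - sgl y i = m \<longleftrightarrow> n = m + sgl y i \<and> lk m y = 0" if "lk n y = i" for n
  proof
    assume "n - sgl y i = m"
    then show "n = m + sgl y i \<and> lk m y = 0"
      using that by (auto intro!: poly_mapping_eqI simp: lookup_add lookup_minus lookup_single when_def)
  qed auto
  have "lk (ycoeff y i f) m = (\<Sum>n\<in>?K. if n = m + sgl y i \<and> lk m y = 0 then lk f n else 0)"
    unfolding ycoeff_def lookup_sum
    by (rule sum.cong) (auto simp: lookup_single when_def eq)
  also have "\<dots> = (if lk m y = 0 then lk f (m + sgl y i) else 0)"
    by (cases "lk m y = 0") (auto simp: lookup_add in_keys_iff if_distrib)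
  finally show ?thesis .
qed

lemma ycoeff_zero [simp]: "ycoeff y i 0 = 0"
  by (rule poly_mapping_eqI) (simp add: lookup_ycoeff)

lemma ycoeff_add: "ycoeff y i (f + g) = ycoeff y i f + ycoeff y i g"
  by (rule poly_mapping_eqI) (simp add: lookup_ycoeff lookup_add)

lemma ycoeff_diff: "ycoeff y i (f - g) = ycoeff y i f - ycoeff y i g"
  by (rule poly_mapping_eqI) (simp add: lookup_ycoeff lookup_minus)

lemma keys_ycoeff: "m \<in> mkeys (ycoeff y i f) \<longleftrightarrow> lk m y = 0 \<and> m + sgl y i \<in> mkeys f"
  by (simp add: in_keys_iff lookup_ycoeff)

lemma monoms_remove: "m \<in> monoms (V - {y}) \<longleftrightarrow> m \<in> monoms V \<and> lk m y = 0"
  by (auto simp: monoms_def in_keys_iff)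

lemma ycoeff_polys: "f \<in> polys V \<Longrightarrow> ycoeff y i f \<in> polys (V - {y})"
  unfolding polys_iff subset_iff monoms_remove keys_ycoeff by (metis monoms_add_iff)

lemma ycoeff_polys': "f \<in> polys V \<Longrightarrow> ycoeff y i f \<in> polys V"
  by (meson Diff_subset polys_mono ycoeff_polys)

lemma polys_keys_zero: "f \<in> polys (V - {y}) \<Longrightarrow> m \<in> mkeys f \<Longrightarrow> lk m y = 0"
  by (auto simp: polys_iff monoms_remove)

lemma ycoeff_mult_free:
  assumes "g \<in> polys (V - {y})"
  shows "ycoeff y i (g * f) = g * ycoeff y i f"
proof (induction g rule: mpoly_induct)
  case (single u a)
  have u: "lk u y = 0" using polys_keys_zero[OF assms single] .
  show ?case
  proof (rule poly_mapping_eqI)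
    fix m
    have *: "mdvd u (m + sgl y i) \<longleftrightarrow> mdvd u m" if "lk m y = 0"
      by (intro all_cong1) (auto simp: lookup_add lookup_single when_def u)
    have "m + sgl y i - u = m - u + sgl y i" if "mdvd u m"
      using u that by (auto intro!: poly_mapping_eqI simp: lookup_add lookup_single lookup_minus when_def)
    then show "lk (ycoeff y i (sgl u a * f)) m = lk (sgl u a * ycoeff y i f) m"
      using u * by (auto simp: lookup_ycoeff lookup_single_mult lookup_minus)
  qed
qed (auto simp: algebra_simps ycoeff_add)

lemma ycoeff_free:
  assumes "g \<in> polys (V - {y})"
  shows "ycoeff y i g = (if i = 0 then g else 0)"
proof -
  have "m + sgl y i \<noteq> 0" if "i > 0" for m
    using that by (metis add_is_0 lookup_add lookup_single_eq lookup_zero not_gr_zero)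
  then have "ycoeff y i 1 = (if i = 0 then 1 else 0)"
    by (intro poly_mapping_eqI) (auto simp: lookup_ycoeff lookup_one when_def)
  then show ?thesis using ycoeff_mult_free[OF assms, of i 1] by auto
qed

lemma ycoeff_Var_mult:
  "ycoeff y (Suc i) (Var y * f) = ycoeff y i f" "ycoeff y 0 (Var y * f) = 0"
proof -
  have "lk (ycoeff y (Suc i) (Var y * f)) m = lk (ycoeff y i f) m" for m
  proof -
    have "m + sgl y (Suc i) - sgl y (Suc 0) = m + sgl y i"
      by (rule poly_mapping_eqI) (simp add: lookup_add lookup_minus lookup_single when_def)
    then show ?thesis
      by (auto simp: lookup_ycoeff Var_def lookup_single_mult lookup_add lookup_single when_def)
  qed
  then show "ycoeff y (Suc i) (Var y * f) = ycoeff y i f" by (rule poly_mapping_eqI)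
  show "ycoeff y 0 (Var y * f) = 0"
  proof (rule poly_mapping_eqI)
    fix m
    have "\<not> mdvd (sgl y 1) m" if "lk m y = 0"
      using that by (auto intro!: exI[of _ y])
    then show "lk (ycoeff y 0 (Var y * f)) m = lk 0 m"
      by (auto simp: lookup_ycoeff Var_def lookup_single_mult)
  qed
qed

text \<open>
  A monomial is determined by its exponent at \<open>y\<close> together with the remaining part.
\<close>
lemma ycoeff_eqI: "(\<And>i. ycoeff y i f = ycoeff y i g) \<Longrightarrow> f = g"
proof (rule poly_mapping_eqI)
  fix m :: monom assume *: "\<And>i. ycoeff y i f = ycoeff y i g"
  have m: "m = (m - sgl y (lk m y)) + sgl y (lk m y)"
    by (rule poly_mapping_eqI) (simp add: lookup_add lookup_minus lookup_single when_def)
  show "lk f m = lk g m"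
    using arg_cong[OF *[of "lk m y"], of "\<lambda>h. lk h (m - sgl y (lk m y))"] m
    by (simp add: lookup_ycoeff lookup_minus)
qed

lemma ycoeff_Var_power_mult:
  "ycoeff y i (Var y ^ d * f) = (if d \<le> i then ycoeff y (i - d) f else 0)"
proof (induction d arbitrary: i)
  case (Suc d)
  show ?case by (cases i) (simp_all add: mult.assoc ycoeff_Var_mult Suc)
qed simp

lemma ycoeff_mult_Var_power:
  assumes "g \<in> polys (V - {y})"
  shows "ycoeff y i (g * Var y ^ d) = (if i = d then g else 0)"
  using ycoeff_Var_power_mult[of y i d g] ycoeff_free[OF assms, of "i - d"]
  by (auto simp: mult.commute)

lemma ycoeff_sum: "ycoeff y i (sum f A) = (\<Sum>a\<in>A. ycoeff y i (f a))"
  by (induction A rule: infinite_finite_induct) (auto simp: ycoeff_add)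

lemma ydeg_ge: "ycoeff y i f \<noteq> 0 \<Longrightarrow> i \<le> ydeg y f"
proof -
  assume "ycoeff y i f \<noteq> 0"
  then obtain m where "m \<in> mkeys (ycoeff y i f)"
    by (metis keys_eq_empty ex_in_conv)
  then have "lk m y = 0" "m + sgl y i \<in> mkeys f" by (auto simp: keys_ycoeff)
  then show ?thesis
    unfolding ydeg_def by (intro Max_ge) (auto simp: lookup_add image_iff intro!: bexI[of _ "m + sgl y i"])
qed

lemma ycoeff_above_ydeg: "ydeg y f < i \<Longrightarrow> ycoeff y i f = 0"
  using ydeg_ge by fastforce

lemma lookup_le_ydeg: "m \<in> mkeys f \<Longrightarrow> lk m y \<le> ydeg y f"
  unfolding ydeg_def by (rule Max_ge) auto

lemma ylead_nonzero: "f \<noteq> 0 \<Longrightarrow> ylead y f \<noteq> 0"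
proof -
  assume "f \<noteq> 0"
  then have "ydeg y f \<in> (\<lambda>m. lk m y) ` mkeys f"
    unfolding ydeg_def by (intro Max_in) auto
  then obtain m where m: "m \<in> mkeys f" "lk m y = ydeg y f" by auto
  have "m = (m - sgl y (lk m y)) + sgl y (lk m y)"
    by (rule poly_mapping_eqI) (simp add: lookup_add lookup_minus lookup_single when_def)
  then have "m - sgl y (lk m y) \<in> mkeys (ylead y f)"
    using m by (auto simp: ylead_def keys_ycoeff lookup_minus)
  then show ?thesis by auto
qed

lemma ylead_zero [simp]: "ylead y 0 = 0"
  by (simp add: ylead_def)

lemma init_y_zero [simp]: "init_y y 0 = 0"
  by (simp add: init_y_def)

lemma ydeg_eqI: "ycoeff y d f \<noteq> 0 \<Longrightarrow> (\<And>i. i > d \<Longrightarrow> ycoeff y i f = 0) \<Longrightarrow> ydeg y f = d"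
  by (metis ydeg_ge ycoeff_zero ylead_def ylead_nonzero le_neq_implies_less)

lemma ylead_polys: "f \<in> polys V \<Longrightarrow> ylead y f \<in> polys (V - {y})"
  by (simp add: ylead_def ycoeff_polys)

lemma ylead_polys': "f \<in> polys V \<Longrightarrow> ylead y f \<in> polys V"
  by (simp add: ylead_def ycoeff_polys')

lemma init_y_polys: "f \<in> polys V \<Longrightarrow> y \<in> V \<Longrightarrow> init_y y f \<in> polys V"
  unfolding init_y_def by (intro polys_mult polys_power ylead_polys' polys_Var)

lemma ydeg_free: "g \<in> polys (V - {y}) \<Longrightarrow> g \<noteq> 0 \<Longrightarrow> ydeg y g = 0"
  by (rule ydeg_eqI) (auto simp: ycoeff_free)

lemma ylead_free: "g \<in> polys (V - {y}) \<Longrightarrow> ylead y g = g"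
  by (cases "g = 0") (auto simp: ylead_def ydeg_free ycoeff_free)

lemma init_y_free: "g \<in> polys (V - {y}) \<Longrightarrow> init_y y g = g"
  by (cases "g = 0") (auto simp: init_y_def ydeg_free ylead_free)

lemma ydeg_zero_free:
  assumes "f \<in> polys V" "ydeg y f = 0"
  shows "f \<in> polys (V - {y})" "ylead y f = f"
proof -
  have "f = ycoeff y 0 f"
  proof (rule ycoeff_eqI[of y])
    fix i
    have "ycoeff y i f = 0" if "i > 0" using assms that by (simp add: ycoeff_above_ydeg)
    then show "ycoeff y i f = ycoeff y i (ycoeff y 0 f)"
      by (cases i) (simp_all add: ycoeff_free[OF ycoeff_polys[OF assms(1)]])
  qed
  then show "f \<in> polys (V - {y})" "ylead y f = f"
    using ycoeff_polys[OF assms(1), of y 0] assms by (simp_all add: ylead_def)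
qed

lemma ycoeff_expansion:
  assumes "f \<in> polys V"
  shows "(\<Sum>i\<le>ydeg y f. ycoeff y i f * Var y ^ i) = f"
proof (rule ycoeff_eqI[of y])
  fix j
  have "ycoeff y j (\<Sum>i\<le>ydeg y f. ycoeff y i f * Var y ^ i) = (\<Sum>i\<le>ydeg y f. if j = i then ycoeff y i f else 0)"
    unfolding ycoeff_sum
    by (rule sum.cong) (simp_all add: ycoeff_mult_Var_power[OF ycoeff_polys[OF assms]])
  then show "ycoeff y j (\<Sum>i\<le>ydeg y f. ycoeff y i f * Var y ^ i) = ycoeff y j f"
    using ycoeff_above_ydeg[of y f j] by auto
qed

lemma ycoeff_linear_mult:
  assumes "w \<in> polys (V - {y})"
  shows "ycoeff y (Suc i) ((Const a * Var y + w) * f) = Const a * ycoeff y i f + w * ycoeff y (Suc i) f"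
    and "ycoeff y 0 ((Const a * Var y + w) * f) = w * ycoeff y 0 f"
  using ycoeff_mult_free[OF assms] ycoeff_mult_free[OF polys_Const[of a "{} - {y}"]]
  by (simp_all add: distrib_right ycoeff_add ycoeff_Var_mult mult.assoc)

text \<open>
  The ring is a domain, so the top coefficient \<open>a\<close> of the linear factor does not cancel.
\<close>
lemma ydeg_linear_mult:
  assumes "w \<in> polys (V - {y})" "a \<noteq> 0" "f \<noteq> 0"
  shows "ydeg y ((Const a * Var y + w) * f) = Suc (ydeg y f)"
    and "ylead y ((Const a * Var y + w) * f) = Const a * ylead y f"
proof -
  have 1: "ycoeff y (Suc i) ((Const a * Var y + w) * f) = Const a * ycoeff y i f + w * ycoeff y (Suc i) f" for i
    by (rule ycoeff_linear_mult[OF assms(1)])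
  have 2: "ycoeff y (Suc (ydeg y f)) ((Const a * Var y + w) * f) = Const a * ylead y f"
    unfolding 1 by (simp add: ylead_def ycoeff_above_ydeg)
  have "Const a * ylead y f \<noteq> 0" using ylead_nonzero assms by simp
  then show *: "ydeg y ((Const a * Var y + w) * f) = Suc (ydeg y f)"
  proof (intro ydeg_eqI)
    fix i assume "Suc (ydeg y f) < i"
    then obtain j where "i = Suc j" "ydeg y f < j" by (cases i) auto
    then show "ycoeff y i ((Const a * Var y + w) * f) = 0"
      by (simp add: 1 ycoeff_above_ydeg)
  qed (simp add: 2)
  show "ylead y ((Const a * Var y + w) * f) = Const a * ylead y f"
    by (metis * 2 ylead_def)
qed

text \<open>
  The ring in the variables \<open>V\<close> is free over the ring without \<open>y\<close>, with the powers of \<open>y\<close> as a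
  basis; an ideal extended from the smaller ring is therefore described coefficientwise.
\<close>
lemma idl_extension_iff:
  assumes "A \<subseteq> polys (V - {y})" "y \<in> V"
  shows "f \<in> idl V A \<longleftrightarrow> f \<in> polys V \<and> (\<forall>i. ycoeff y i f \<in> idl (V - {y}) A)"
proof
  have A: "A \<subseteq> polys V" using assms(1) by (meson Diff_subset polys_mono subset_iff)
  have I: "ideal (idl (V - {y}) A) (poly_ring (V - {y}))" by (rule ideal_idl[OF assms(1)])
  assume f: "f \<in> idl V A"
  have "\<forall>i. ycoeff y i f \<in> idl (V - {y}) A"
    using f A
  proof (induction f rule: idl_induct)
    case (gen a)
    then have "a \<in> polys (V - {y})" "a \<in> idl (V - {y}) A"
      using assms(1) idl_self[of A "V - {y}"] by auto
    then show ?case by (simp add: ycoeff_free ideal_zero[OF I])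
  next
    case (mult h f)
    \<comment> \<open>the multipliers preserving the coefficientwise condition; they contain \<open>y\<close> and all that is free of \<open>y\<close>\<close>
    let ?T = "{h \<in> polys V. \<forall>f. (\<forall>i. ycoeff y i f \<in> idl (V - {y}) A) \<longrightarrow> (\<forall>i. ycoeff y i (h * f) \<in> idl (V - {y}) A)}"
    have free: "g \<in> polys (V - {y}) \<Longrightarrow> g \<in> ?T" for g
      using polys_mono[of g "V - {y}" V] by (auto simp: ycoeff_mult_free ideal_mult[OF I])
    have add: "g \<in> ?T \<Longrightarrow> h \<in> ?T \<Longrightarrow> g + h \<in> ?T" for g h
      by (auto simp: distrib_right ycoeff_add ideal_add[OF I])
    have y: "g \<in> ?T \<Longrightarrow> Var y ^ d * g \<in> ?T" for g d
      using assms(2) polys_power[OF polys_Var[OF assms(2)], of d]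
      by (auto simp: polys_mult mult.assoc ycoeff_Var_power_mult ideal_zero[OF I])
    have "(\<Sum>i\<in>B. ycoeff y i h * Var y ^ i) \<in> ?T" if "finite B" for B
      using that
    proof induction
      case empty
      then show ?case by (auto simp: ideal_zero[OF I])
    next
      case (insert i B)
      have "Var y ^ i * ycoeff y i h \<in> ?T"
        by (rule y[OF free[OF ycoeff_polys[OF mult(1)]]])
      then show ?case using add insert by (simp add: mult.commute)
    qed
    from this[of "{..ydeg y h}"] have "h \<in> ?T"
      by (simp only: ycoeff_expansion[OF mult(1)] finite_atMost)
    then show ?case using mult by auto
  qed (auto simp: ideal_zero[OF I] ideal_add[OF I] ycoeff_add)
  then show "f \<in> polys V \<and> (\<forall>i. ycoeff y i f \<in> idl (V - {y}) A)"
    using f idl_subset_polys[OF A] by blast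
next
  have A: "A \<subseteq> polys V" using assms(1) by (meson Diff_subset polys_mono subset_iff)
  have I: "ideal (idl V A) (poly_ring V)" by (rule ideal_idl[OF A])
  assume f: "f \<in> polys V \<and> (\<forall>i. ycoeff y i f \<in> idl (V - {y}) A)"
  have sub: "g \<in> idl V A" if "g \<in> idl (V - {y}) A" for g
    using that assms(1)
  proof (induction g rule: idl_induct)
    case (mult h g)
    then show ?case using ideal_mult[OF I polys_mono[OF mult(1)]] by auto
  qed (use idl_self[of A V] in \<open>auto simp: ideal_zero[OF I] ideal_add[OF I]\<close>)
  have "(\<Sum>i\<le>ydeg y f. Var y ^ i * ycoeff y i f) \<in> idl V A"
    by (rule ideal_sum[OF I], rule ideal_mult[OF I]) (use sub f assms in auto)
  then show "f \<in> idl V A" using ycoeff_expansion[of f V y] f by (simp add: mult.commute)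
qed

lemma idl_contraction:
  assumes "A \<subseteq> polys (V - {y})" "y \<in> V"
  shows "idl V A \<inter> polys (V - {y}) = idl (V - {y}) A"
proof -
  have "f \<in> idl V A \<longleftrightarrow> f \<in> idl (V - {y}) A" if f: "f \<in> polys (V - {y})" for f
    using polys_mono[OF f, of V] ideal_zero[OF ideal_idl[OF assms(1)]]
    by (auto simp: idl_extension_iff[OF assms] ycoeff_free[OF f] split: if_splits)
  then show ?thesis using idl_subset_polys[OF assms(1)] by blast
qed

lemma ideal_contraction:
  assumes "ideal I (poly_ring V)"
  shows "ideal (I \<inter> polys (V - {y})) (poly_ring (V - {y}))"
proof (rule idealI_poly)
  fix h f :: "'a mpoly"
  assume h: "h \<in> polys (V - {y})" and f: "f \<in> I \<inter> polys (V - {y})"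
  then show "h * f \<in> I \<inter> polys (V - {y})"
    using ideal_mult[OF assms polys_mono[OF h]] by auto
qed (auto intro: ideal_zero[OF assms] ideal_add[OF assms])

section \<open>The grading by total degree\<close>

definition tdeg :: "monom \<Rightarrow> nat" where
  "tdeg m = (\<Sum>j\<in>mkeys m. lk m j)"

lemma tdeg_superset: "finite B \<Longrightarrow> mkeys m \<subseteq> B \<Longrightarrow> tdeg m = (\<Sum>j\<in>B. lk m j)"
  unfolding tdeg_def by (rule sum.mono_neutral_left) (auto simp: in_keys_iff)

lemma tdeg_add [simp]: "tdeg (m + n) = tdeg m + tdeg n"
proof -
  let ?B = "mkeys m \<union> mkeys n"
  have "tdeg (m + n) = (\<Sum>j\<in>?B. lk (m + n) j)"
    by (rule tdeg_superset) (auto simp: keys_monom_add)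
  also have "\<dots> = (\<Sum>j\<in>?B. lk m j) + (\<Sum>j\<in>?B. lk n j)"
    by (simp add: lookup_add sum.distrib)
  finally show ?thesis using tdeg_superset[of ?B m] tdeg_superset[of ?B n] by simp
qed

lemma tdeg_single [simp]: "tdeg (sgl j i) = i"
  by (simp add: tdeg_def)

lemma tdeg_zero [simp]: "tdeg 0 = 0"
  by (simp add: tdeg_def)

definition hom_component :: "nat \<Rightarrow> 'k::field mpoly \<Rightarrow> 'k mpoly" where
  "hom_component e f = (\<Sum>m | m \<in> mkeys f \<and> tdeg m = e. sgl m (lk f m))"

lemma lookup_hom_component: "lk (hom_component e f) m = (if tdeg m = e then lk f m else 0)"
proof -
  have "lk (hom_component e f) m = (\<Sum>n | n \<in> mkeys f \<and> tdeg n = e. if n = m then lk f n else 0)"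
    unfolding hom_component_def lookup_sum by (rule sum.cong) (auto simp: lookup_single when_def)
  then show ?thesis by (auto simp: in_keys_iff)
qed

lemma keys_hom_component: "m \<in> mkeys (hom_component e f) \<longleftrightarrow> m \<in> mkeys f \<and> tdeg m = e"
  by (simp add: in_keys_iff lookup_hom_component)

lemma hom_component_zero [simp]: "hom_component e 0 = 0"
  by (rule poly_mapping_eqI) (simp add: lookup_hom_component)

lemma hom_component_add: "hom_component e (f + g) = hom_component e f + hom_component e g"
  by (rule poly_mapping_eqI) (simp add: lookup_hom_component lookup_add)

lemma hom_component_hom_component: "hom_component d (hom_component e f) = (if d = e then hom_component e f else 0)"
  by (rule poly_mapping_eqI) (simp add: lookup_hom_component)

lemma hom_component_polys: "f \<in> polys V \<Longrightarrow> hom_component e f \<in> polys V"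
  by (auto simp: polys_iff keys_hom_component)

definition homogeneous :: "nat \<Rightarrow> 'k::field mpoly \<Rightarrow> bool" where
  "homogeneous d f \<longleftrightarrow> (\<forall>m\<in>mkeys f. tdeg m = d)"

lemma homogeneous_mult: "homogeneous d f \<Longrightarrow> homogeneous e g \<Longrightarrow> homogeneous (d + e) (f * g)"
  using keys_mult[of f g] by (fastforce simp: homogeneous_def)

lemma homogeneous_one: "homogeneous 0 1"
  by (simp add: homogeneous_def)

lemma homogeneous_prod:
  "finite A \<Longrightarrow> (\<And>a. a \<in> A \<Longrightarrow> homogeneous 1 a) \<Longrightarrow> homogeneous (card A) (\<Prod>a\<in>A. a)"
  by (induction A rule: finite_induct) (use homogeneous_mult[of 1] in \<open>auto simp: homogeneous_one\<close>)

lemma hom_component_mult_homogeneous: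
  assumes "homogeneous d a"
  shows "hom_component e (g * (a::'k::field mpoly)) = (if d \<le> e then hom_component (e - d) g * a else 0)"
proof -
  have 1: "hom_component e (sgl u b * sgl v c) = (if tdeg v \<le> e then hom_component (e - tdeg v) (sgl u b) * sgl v c else 0)" for u v and b c :: 'k
  proof -
    have "hom_component i (sgl w x) = (if tdeg w = i then sgl w x else 0)" for i w and x :: 'k
      by (rule poly_mapping_eqI) (auto simp: lookup_hom_component lookup_single when_def)
    then show ?thesis by (auto simp: mult_single)
  qed
  have 2: "hom_component e (sgl u b * a) = (if d \<le> e then hom_component (e - d) (sgl u b) * a else 0)" for u b
    by (induction a rule: mpoly_induct)
      (use assms in \<open>auto simp: 1 distrib_left hom_component_add homogeneous_def\<close>)
  show ?thesis
    by (induction g rule: mpoly_induct) (auto simp: 2 distrib_right hom_component_add)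
qed

section \<open>Dickson's lemma and Groebner bases\<close>

lemma nat_seq_nondecreasing_subseq:
  fixes s :: "nat \<Rightarrow> nat"
  shows "\<exists>r :: nat \<Rightarrow> nat. strict_mono r \<and> (\<forall>i j. i \<le> j \<longrightarrow> s (r i) \<le> s (r j))"
proof -
  obtain f :: "nat \<Rightarrow> nat" where f: "strict_mono f" "monoseq (\<lambda>n. s (f n))"
    using seq_monosub[of s] by blast
  show ?thesis
  proof (cases "\<forall>m n. m \<le> n \<longrightarrow> s (f m) \<le> s (f n)")
    case True
    then show ?thesis using f by blast
  next
    case False
    then have dec: "m \<le> n \<Longrightarrow> s (f n) \<le> s (f m)" for m n
      using f(2) by (auto simp: monoseq_def)
    obtain N where N: "\<And>n. s (f N) \<le> s (f n)"
      using exists_least_iff[of "\<lambda>x. \<exists>n. x = s (f n)"] by (metis not_less)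
    have "s (f (n + N)) = s (f N)" for n
      using dec[of N "n + N"] N[of "n + N"] by simp
    moreover have "strict_mono (\<lambda>n. f (n + N))"
      using f(1) by (simp add: strict_mono_def)
    ultimately show ?thesis by (intro exI[of _ "\<lambda>n. f (n + N)"]) simp
  qed
qed

text \<open>
  Every sequence of numbers has a nondecreasing subsequence; thinning out once for each variable
  makes all exponents nondecreasing simultaneously.
\<close>
lemma dickson_subseq:
  fixes s :: "nat \<Rightarrow> monom"
  assumes "finite V"
  shows "\<exists>r :: nat \<Rightarrow> nat. strict_mono r \<and> (\<forall>v\<in>V. \<forall>i j. i \<le> j \<longrightarrow> lk (s (r i)) v \<le> lk (s (r j)) v)"
  using assms
proof induction
  case empty
  show ?case by (intro exI[of _ id]) (simp add: strict_mono_def)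
next
  case (insert v V)
  then obtain r :: "nat \<Rightarrow> nat" where r: "strict_mono r" "\<forall>v\<in>V. \<forall>i j. i \<le> j \<longrightarrow> lk (s (r i)) v \<le> lk (s (r j)) v"
    by blast
  obtain q :: "nat \<Rightarrow> nat" where q: "strict_mono q" "\<forall>i j. i \<le> j \<longrightarrow> lk (s (r (q i))) v \<le> lk (s (r (q j))) v"
    using nat_seq_nondecreasing_subseq[of "\<lambda>n. lk (s (r n)) v"] by blast
  have "strict_mono (\<lambda>n. r (q n))" using r(1) q(1) by (simp add: strict_mono_def)
  moreover have "i \<le> j \<Longrightarrow> q i \<le> q j" for i j using q(1) by (simp add: strict_mono_less_eq)
  ultimately show ?case using r(2) q(2) by (intro exI[of _ "\<lambda>n. r (q n)"]) auto
qed

lemma dickson: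
  assumes "finite V" "\<And>i. s i \<in> monoms V"
  shows "\<exists>i j :: nat. i < j \<and> mdvd (s i) (s j)"
proof -
  obtain r :: "nat \<Rightarrow> nat" where r: "strict_mono r" "\<forall>v\<in>V. \<forall>i j. i \<le> j \<longrightarrow> lk (s (r i)) v \<le> lk (s (r j)) v"
    using dickson_subseq[OF assms(1)] by blast
  have "lk (s (r 0)) v \<le> lk (s (r 1)) v" for v
  proof (cases "v \<in> V")
    case False
    then have "v \<notin> mkeys (s (r 0))" using assms(2) by (auto simp: monoms_def)
    then show ?thesis by (simp add: in_keys_iff)
  qed (use r in auto)
  moreover have "r 0 < r 1" using r(1) by (simp add: strict_mono_def)
  ultimately show ?thesis by blast
qed

text \<open>
  The minimal elements of \<open>M\<close> under divisibility form an antichain, which is finite by Dickson's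
  lemma, and each element of \<open>M\<close> is divisible by a minimal one because the degree drops.
\<close>
lemma finite_monomial_basis:
  assumes "finite V" "M \<subseteq> monoms V"
  shows "\<exists>F. finite F \<and> F \<subseteq> M \<and> (\<forall>m\<in>M. \<exists>u\<in>F. mdvd u m)"
proof -
  let ?F = "{m \<in> M. \<forall>u\<in>M. mdvd u m \<longrightarrow> u = m}"
  have "finite ?F"
  proof (rule ccontr)
    assume "infinite ?F"
    then obtain s :: "nat \<Rightarrow> monom" where s: "inj s" "range s \<subseteq> ?F"
      using infinite_countable_subset by blast
    obtain i j where "i < j" "mdvd (s i) (s j)"
      using dickson[OF assms(1), of s] s(2) assms(2) by blast
    then show False using s injD[OF s(1), of i j] by blast
  qed
  moreover have "\<exists>u\<in>?F. mdvd u m" if "m \<in> M" for m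
    using that
  proof (induction "tdeg m" arbitrary: m rule: less_induct)
    case less
    show ?case
    proof (cases "m \<in> ?F")
      case False
      then obtain u where u: "u \<in> M" "mdvd u m" "u \<noteq> m" using less by blast
      have "m = u + (m - u)" using mdvd_add_diff[OF u(2)] by simp
      moreover have "m - u \<noteq> 0" using calculation u(3) by (metis add.right_neutral)
      then obtain j where "j \<in> mkeys (m - u)" using keys_eq_empty by blast
      then have "lk (m - u) j > 0" "lk (m - u) j \<le> tdeg (m - u)"
        unfolding tdeg_def by (auto simp: in_keys_iff intro: member_le_sum)
      ultimately have "tdeg u < tdeg m" by (metis less_add_same_cancel1 order_less_le_trans tdeg_add)
      then obtain w where "w \<in> ?F" "mdvd w u" using less u(1) by blast
      then show ?thesis using u(2) by (meson le_trans)
    qed auto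
  qed
  ultimately show ?thesis by (intro exI[of _ ?F]) auto
qed

text \<open>
  Comparing the exponents of \<open>y\<close> first makes the order compatible with initial \<open>y\<close>-forms; the
  order of monomials that breaks the ties is the lexicographic one.
\<close>
definition yorder :: "nat set \<Rightarrow> nat \<Rightarrow> monom rel" where
  "yorder V y = {(s, t). s \<in> monoms V \<and> t \<in> monoms V \<and> (lk s y < lk t y \<or> lk s y = lk t y \<and> s \<le> t)}"

lemma monom_nonneg: "(0 :: monom) \<le> u"
proof -
  have "\<not> u < 0"
    by (simp add: less_poly_mapping.rep_eq less_fun_def)
  then show ?thesis by simp
qed

lemma yorder_linear: "linear_order_on (monoms V) (yorder V y)"
  unfolding linear_order_on_def partial_order_on_def preorder_on_def
  by (auto simp: yorder_def refl_on_def trans_def antisym_def total_on_def)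

text \<open>
  An infinite descending chain would contain, by Dickson's lemma, a monomial dividing a later one,
  but a multiple of a monomial is never smaller.
\<close>
lemma yorder_monomial_order:
  assumes "finite V"
  shows "monomial_order V (yorder V y)"
  unfolding monomial_order_def well_order_on_def
proof (intro conjI allI impI)
  show "linear_order_on (monoms V) (yorder V y)" by (rule yorder_linear)
  show "wf (yorder V y - Id)"
    unfolding wf_iff_no_infinite_down_chain
  proof
    assume "\<exists>f. \<forall>i. (f (Suc i), f i) \<in> yorder V y - Id"
    then obtain f where f: "(f (Suc i), f i) \<in> yorder V y - Id" for i by blast
    have trans: "(s, u) \<in> yorder V y - Id" if "(s, t) \<in> yorder V y - Id" "(t, u) \<in> yorder V y - Id" for s t u
      using that by (auto simp: yorder_def)
    have chain: "(f j, f i) \<in> yorder V y - Id" if "i < j" for i j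
      using that by (induction j rule: less_Suc_induct) (use f trans in blast)+
    obtain i j where ij: "i < j" "mdvd (f i) (f j)"
      using dickson[OF assms, of f] f by (auto simp: yorder_def)
    have "f i \<le> f i + (f j - f i)" using add_left_mono[OF monom_nonneg] by simp
    then have "f i \<le> f j" using mdvd_add_diff[OF ij(2)] by simp
    then show False using chain[OF ij(1)] ij(2) by (auto simp: yorder_def) (meson leD)
  qed
  fix s t u :: monom
  assume "(s, t) \<in> yorder V y" "u \<in> monoms V"
  then show "(s + u, t + u) \<in> yorder V y" by (auto simp: yorder_def lookup_add add_right_mono)
qed

lemma lookup_init_y:
  "lk (init_y y f) m = (if lk m y = ydeg y f then lk f m else 0)"
proof -
  let ?d = "ydeg y f"
  have "mdvd (sgl y ?d) m \<longleftrightarrow> ?d \<le> lk m y" by (auto simp: lookup_single when_def)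
  moreover have "m - sgl y ?d + sgl y ?d = m" if "?d \<le> lk m y"
    using that by (intro poly_mapping_eqI) (auto simp: lookup_add lookup_minus lookup_single when_def)
  moreover have "init_y y f = sgl (sgl y ?d) 1 * ycoeff y ?d f"
    by (simp add: init_y_def ylead_def Var_power mult.commute)
  ultimately show ?thesis
    using lookup_le_ydeg[of m f y]
    by (auto simp: lookup_single_mult lookup_ycoeff lookup_minus in_keys_iff)
qed

context
  fixes V :: "nat set" and r :: "monom rel"
  assumes r: "monomial_order V r"
begin

lemma monomial_order_linear:
  "refl_on (monoms V) r" "trans r" "antisym r" "total_on (monoms V) r" "wf (r - Id)"
  using r unfolding monomial_order_def well_order_on_def linear_order_on_def partial_order_on_def
    preorder_on_def by simp_all

lemma monomial_order_refl: "m \<in> monoms V \<Longrightarrow> (m, m) \<in> r"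
  using monomial_order_linear(1) by (simp add: refl_on_def)

lemma monomial_order_trans: "(s, t) \<in> r \<Longrightarrow> (t, u) \<in> r \<Longrightarrow> (s, u) \<in> r"
  by (rule transD[OF monomial_order_linear(2)])

lemma monomial_order_antisym: "(s, t) \<in> r \<Longrightarrow> (t, s) \<in> r \<Longrightarrow> s = t"
  by (rule antisymD[OF monomial_order_linear(3)])

lemma monomial_order_total: "s \<in> monoms V \<Longrightarrow> t \<in> monoms V \<Longrightarrow> (s, t) \<in> r \<or> (t, s) \<in> r"
  using monomial_order_linear(4) monomial_order_refl by (metis total_on_def)

lemma monomial_order_add: "(s, t) \<in> r \<Longrightarrow> u \<in> monoms V \<Longrightarrow> (s + u, t + u) \<in> r"
  using r unfolding monomial_order_def by blast

lemma lead_monom_eqI: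
  "m \<in> mkeys f \<Longrightarrow> (\<And>t. t \<in> mkeys f \<Longrightarrow> (t, m) \<in> r) \<Longrightarrow> lead_monom r f = m"
  unfolding lead_monom_def by (rule the_equality) (auto intro: monomial_order_antisym)

lemma finite_has_max:
  "finite A \<Longrightarrow> A \<noteq> {} \<Longrightarrow> A \<subseteq> monoms V \<Longrightarrow> \<exists>m\<in>A. \<forall>t\<in>A. (t, m) \<in> r"
proof (induction A rule: finite_ne_induct)
  case (singleton x)
  then show ?case using monomial_order_refl by auto
next
  case (insert x F)
  then obtain m where m: "m \<in> F" "\<forall>t\<in>F. (t, m) \<in> r" by auto
  show ?case
  proof (cases "(x, m) \<in> r")
    case False
    then have "(m, x) \<in> r" using monomial_order_total insert m by blast
    then show ?thesis using m monomial_order_trans monomial_order_refl insert by blast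
  qed (use m in auto)
qed

lemma lead_monom:
  assumes "f \<in> polys V" "f \<noteq> 0"
  shows "lead_monom r f \<in> mkeys f" "\<And>t. t \<in> mkeys f \<Longrightarrow> (t, lead_monom r f) \<in> r"
proof -
  obtain m where "m \<in> mkeys f" "\<forall>t\<in>mkeys f. (t, m) \<in> r"
    using finite_has_max[of "mkeys f"] assms by (auto simp: polys_iff)
  then show "lead_monom r f \<in> mkeys f" "\<And>t. t \<in> mkeys f \<Longrightarrow> (t, lead_monom r f) \<in> r"
    using lead_monom_eqI[of m f] by auto
qed

lemma lead_monom_monoms: "f \<in> polys V \<Longrightarrow> f \<noteq> 0 \<Longrightarrow> lead_monom r f \<in> monoms V"
  using lead_monom by (auto simp: polys_iff)

lemma lead_term_polys: "f \<in> polys V \<Longrightarrow> lead_term r f \<in> polys V"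
  using lead_monom_monoms[of f] by (cases "f = 0") (auto simp: lead_term_def polys_single)

lemma lead_coeff_nonzero: "f \<in> polys V \<Longrightarrow> f \<noteq> 0 \<Longrightarrow> lk f (lead_monom r f) \<noteq> 0"
  using lead_monom(1) by (simp add: in_keys_iff)

text \<open>
  By Dickson's lemma finitely many leading monomials suffice to divide every leading monomial of
  \<open>I\<close>; pick an element of \<open>I\<close> for each of them.
\<close>
lemma exists_groebner_basis:
  assumes "finite V" "ideal I (poly_ring V)"
  shows "\<exists>G. groebner_basis V r G I"
proof -
  have sub: "f \<in> I \<Longrightarrow> f \<in> polys V" for f by (rule ideal_subset[OF assms(2)])
  obtain F where F: "finite F" "F \<subseteq> lead_monom r ` (I - {0})"
    "\<forall>m\<in>lead_monom r ` (I - {0}). \<exists>u\<in>F. mdvd u m"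
    using finite_monomial_basis[OF assms(1), of "lead_monom r ` (I - {0})"] lead_monom_monoms sub by blast
  have "\<forall>u\<in>F. \<exists>h. h \<in> I - {0} \<and> lead_monom r h = u" using F(2) by blast
  from bchoice[OF this] obtain g where
    g: "\<And>u. u \<in> F \<Longrightarrow> g u \<in> I - {0} \<and> lead_monom r (g u) = u" by blast
  let ?J = "idl V (lead_term r ` g ` F)"
  have GI: "g ` F \<subseteq> I" using g by auto
  have J: "ideal ?J (poly_ring V)" using g sub lead_term_polys by (intro ideal_idl) blast
  have "lead_term r f \<in> ?J" if f: "f \<in> I" for f
  proof (cases "f = 0")
    case True
    then show ?thesis using ideal_zero[OF J] by (simp add: lead_term_def)
  next
    case False
    then obtain u where u: "u \<in> F" "mdvd u (lead_monom r f)" using F(3) f by blast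
    let ?m = "lead_monom r f"
    have "lk (g u) u \<noteq> 0" using g[OF u(1)] lead_coeff_nonzero[of "g u"] sub by auto
    then have "lead_term r f = sgl (?m - u) (lk f ?m / lk (g u) u) * lead_term r (g u)"
      using g[OF u(1)] mdvd_add_diff[OF u(2)] by (simp add: lead_term_def mult_single add.commute)
    moreover have "?m - u \<in> monoms V"
      using lead_monom_monoms[OF sub[OF f] False] mdvd_add_diff[OF u(2)] by (metis monoms_add_iff)
    moreover have "lead_term r (g u) \<in> ?J" using u(1) by (intro idl_memI) auto
    ultimately show ?thesis using ideal_mult[OF J] by (simp add: polys_single)
  qed
  then have "idl V (lead_term r ` I) \<subseteq> ?J" by (intro idl_minimal[OF J]) auto
  moreover have "?J \<subseteq> idl V (lead_term r ` I)" using GI by (intro idl_mono) auto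
  ultimately have "groebner_basis V r (g ` F) I"
    unfolding groebner_basis_def using F(1) g by auto
  then show ?thesis ..
qed

lemma monomial_ideal_keys:
  assumes "p \<in> idl V (lead_term r ` G)" "G \<subseteq> polys V" "m \<in> mkeys p"
  shows "\<exists>g\<in>G. mdvd (lead_monom r g) m"
proof -
  have sub: "lead_term r ` G \<subseteq> polys V" using assms(2) lead_term_polys by auto
  have "\<forall>m\<in>mkeys p. \<exists>g\<in>G. mdvd (lead_monom r g) m"
    using assms(1) sub
  proof (induction p rule: idl_induct)
    case (gen a)
    then show ?case by (auto simp: lead_term_def split: if_splits)
  next
    case (add f g)
    then show ?case using Poly_Mapping.keys_add[of f g] by blast
  next
    case (mult h f)
    show ?case
    proof
      fix m assume "m \<in> mkeys (h * f)"
      then obtain a b where ab: "m = a + b" "b \<in> mkeys f" using keys_mult by blast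
      then obtain g where "g \<in> G" "mdvd (lead_monom r g) b" using mult by blast
      then show "\<exists>g\<in>G. mdvd (lead_monom r g) m"
        using ab by (intro bexI[of _ g]) (auto simp: lookup_add trans_le_add2)
    qed
  qed auto
  then show ?thesis using assms(3) by blast
qed

text \<open>
  The division algorithm as an induction principle: subtracting the multiple of a basis element that
  cancels the leading term leads to a smaller leading monomial. The factor \<open>u\<close> is kept in the
  statement because its exponent at \<open>y\<close> is what the applications have to control.
\<close>
lemma groebner_induct [consumes 4, case_names zero step]:
  assumes "f \<in> I" "groebner_basis V r G I" "ideal I (poly_ring V)"
    and "Q 0"
    and "\<And>f g u a. f \<in> I \<Longrightarrow> f \<noteq> 0 \<Longrightarrow> g \<in> G \<Longrightarrow> u \<in> monoms V \<Longrightarrow> u + lead_monom r g = lead_monom r f \<Longrightarrow>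
           Q (f - sgl u a * g) \<Longrightarrow> Q f"
  shows "Q f"
proof -
  have G: "G \<subseteq> I" "0 \<notin> G" and GI: "idl V (lead_term r ` G) = idl V (lead_term r ` I)"
    using assms(2) by (auto simp: groebner_basis_def)
  have sub: "f \<in> I \<Longrightarrow> f \<in> polys V" for f by (rule ideal_subset[OF assms(3)])
  have "\<forall>f\<in>I. f \<noteq> 0 \<longrightarrow> lead_monom r f = m \<longrightarrow> Q f" for m
    using monomial_order_linear(5)
  proof (induction m rule: wf_induct_rule)
    case (less m)
    show ?case
    proof (intro ballI impI)
      fix f assume f: "f \<in> I" "f \<noteq> 0" "lead_monom r f = m"
      have "lead_term r f \<in> idl V (lead_term r ` G)" unfolding GI using f(1) by (intro idl_memI) auto
      moreover have "m \<in> mkeys (lead_term r f)"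
        using lead_coeff_nonzero[OF sub[OF f(1)] f(2)] f(3) by (simp add: lead_term_def)
      ultimately obtain g where g: "g \<in> G" "mdvd (lead_monom r g) m"
        using monomial_ideal_keys G(1) sub by blast
      then have gI: "g \<in> I" "g \<noteq> 0" using G by auto
      \<comment> \<open>the multiple of \<open>g\<close> that cancels the leading term of \<open>f\<close>\<close>
      let ?u = "m - lead_monom r g" and ?a = "lk f m / lk g (lead_monom r g)"
      have um: "?u + lead_monom r g = m" using mdvd_add_diff[OF g(2)] by (simp add: add.commute)
      have u: "?u \<in> monoms V" using lead_monom_monoms[OF sub[OF f(1)] f(2)] f(3) um by (metis monoms_add_iff)
      let ?h = "f - sgl ?u ?a * g"
      have hI: "?h \<in> I" using ideal_diff[OF assms(3) f(1) ideal_mult[OF assms(3) _ gI(1)]] u by (simp add: polys_single)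
      have h0: "lk ?h m = 0"
      proof -
        have "mdvd ?u m" by (simp add: lookup_minus)
        moreover have "m - ?u = lead_monom r g" using um by (metis add_diff_cancel_left')
        ultimately show ?thesis
          using lead_coeff_nonzero[OF sub[OF gI(1)] gI(2)] by (simp add: lookup_minus[of f] lookup_single_mult)
      qed
      have hr: "(t, m) \<in> r" if "t \<in> mkeys ?h" for t
      proof -
        have "t \<in> mkeys f \<or> t \<in> mkeys (sgl ?u ?a * g)" using that keys_diff[of f "sgl ?u ?a * g"] by (auto simp: in_keys_iff lookup_minus[of f])
        then show ?thesis
        proof
          assume "t \<in> mkeys f" then show ?thesis using lead_monom(2)[OF sub[OF f(1)] f(2)] f(3) by auto
        next
          assume "t \<in> mkeys (sgl ?u ?a * g)"
          then obtain b where b: "t = b + ?u" "b \<in> mkeys g"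
            using keys_mult[of "sgl ?u ?a" g] by (auto split: if_splits simp: add.commute)
          then have "(b, lead_monom r g) \<in> r" using lead_monom(2)[OF sub[OF gI(1)] gI(2)] by auto
          then show ?thesis using monomial_order_add[OF _ u] um b by (metis add.commute)
        qed
      qed
      have "Q ?h"
      proof (cases "?h = 0")
        case False
        then have "lead_monom r ?h \<in> mkeys ?h" using lead_monom(1) sub hI by blast
        then have "(lead_monom r ?h, m) \<in> r - Id" using hr h0 by (auto simp: in_keys_iff)
        then show ?thesis using less hI False by blast
      qed (use assms(4) in simp)
      then show "Q f" using assms(5)[OF f(1,2) g(1) u] um f(3) by blast
    qed
  qed
  then show ?thesis using assms(1,4) by (cases "f = 0") auto
qed

lemma y_compatible_lead_monom:
  assumes "y_compatible TYPE('k::field) V y r" "y \<in> V" "(f :: 'k mpoly) \<in> polys V" "f \<noteq> 0"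
  shows "lk (lead_monom r f) y = ydeg y f"
proof -
  have 1: "lead_term r (init_y y f) = lead_term r f" using assms unfolding y_compatible_def by blast
  have n: "init_y y f \<noteq> 0" using ylead_nonzero[OF assms(4), of y]
    by (simp add: init_y_def Var_def) (metis lookup_single_eq lookup_zero one_neq_zero)
  have i: "init_y y f \<in> polys V" by (rule init_y_polys[OF assms(3,2)])
  have "lead_monom r (init_y y f) = lead_monom r f"
    using 1 lead_coeff_nonzero[OF i n] lead_coeff_nonzero[OF assms(3,4)]
    unfolding lead_term_def by (metis keys_single singleton_inject)
  moreover have "lead_monom r (init_y y f) \<in> mkeys (init_y y f)" by (rule lead_monom(1)[OF i n])
  ultimately show ?thesis by (auto simp: in_keys_iff lookup_init_y split: if_splits)
qed

end

lemma yorder_compatible: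
  assumes "finite V" "y \<in> V"
  shows "y_compatible TYPE('k::field) V y (yorder V y)"
  unfolding y_compatible_def
proof
  note mo = yorder_monomial_order[OF assms(1), of y]
  fix f :: "'k mpoly" assume f: "f \<in> polys V"
  show "lead_term (yorder V y) (init_y y f) = lead_term (yorder V y) f"
  proof (cases "f = 0")
    case False
    let ?m = "lead_monom (yorder V y) f"
    note lm = lead_monom[OF mo f False]
    have "ydeg y f \<le> lk ?m y"
    proof -
      have "ydeg y f \<in> (\<lambda>m. lk m y) ` mkeys f"
        unfolding ydeg_def using False by (intro Max_in) auto
      then obtain t where "t \<in> mkeys f" "lk t y = ydeg y f" by auto
      then show ?thesis using lm(2)[of t] by (auto simp: yorder_def)
    qed
    then have "lk ?m y = ydeg y f" using lookup_le_ydeg[OF lm(1), of y] by simp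
    moreover from this have "lead_monom (yorder V y) (init_y y f) = ?m"
      using lm by (intro lead_monom_eqI[OF mo]) (auto simp: in_keys_iff lookup_init_y split: if_splits)
    ultimately show ?thesis by (simp add: lead_term_def lookup_init_y)
  qed simp
qed

lemma CN_ideals_exist:
  assumes "finite V" "y \<in> V" "ideal I (poly_ring V)"
  shows "\<exists>C N. CN_ideals V y I C N"
  unfolding CN_ideals_def
  using yorder_monomial_order[OF assms(1), of y] yorder_compatible[OF assms(1,2)]
    exists_groebner_basis[OF yorder_monomial_order[OF assms(1), of y] assms(1,3)] by blast

section \<open>Geometric vertex decompositions without Groebner bases\<close>

lemma ycoeff_single_mult:
  "ycoeff y i (sgl u a * g) =
     (if lk u y \<le> i then sgl (u - sgl y (lk u y)) a * ycoeff y (i - lk u y) g else 0)"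
proof -
  let ?v = "u - sgl y (lk u y)"
  have u: "u = sgl y (lk u y) + ?v"
    by (rule poly_mapping_eqI) (simp add: lookup_add lookup_minus lookup_single when_def)
  have 1: "sgl u a * g = Var y ^ lk u y * (sgl ?v a * g)"
    by (subst u) (simp add: Var_power mult_single flip: mult.assoc)
  have "sgl ?v a \<in> polys (UNIV - {y})"
    by (auto simp: polys_single monoms_remove lookup_minus) (simp add: monoms_def)
  from ycoeff_mult_free[OF this] show ?thesis
    unfolding 1 ycoeff_Var_power_mult by simp
qed

text \<open>
  Both equations come from the division algorithm. By compatibility of the order with \<open>y\<close>, a
  subtracted multiple \<open>u g\<close> has the same degree in \<open>y\<close> as the element \<open>f\<close> being reduced. Hence
  the coefficient of \<open>f\<close> in its top degree changes by a multiple of the leading coefficient of \<open>g\<close>,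
  and if \<open>f\<close> is free of \<open>y\<close>, so are \<open>u\<close> and \<open>g\<close>.
\<close>
lemma CN_ideals_unique:
  assumes "CN_ideals V y I C N" "ideal I (poly_ring V)" "y \<in> V"
  shows "C = idl V (ylead y ` I)" "N = idl V (I \<inter> polys (V - {y}))"
proof -
  obtain r G where rG: "monomial_order V r" "y_compatible TYPE('a) V y r" "groebner_basis V r G I"
    and C: "C = C_ideal V y G" and N: "N = N_ideal V y G"
    using assms(1) unfolding CN_ideals_def by blast
  have G: "G \<subseteq> I" "0 \<notin> G" using rG(3) by (auto simp: groebner_basis_def)
  have sub: "f \<in> I \<Longrightarrow> f \<in> polys V" for f by (rule ideal_subset[OF assms(2)])
  have IC: "ideal C (poly_ring V)" unfolding C C_ideal_def
    using G sub ylead_polys' by (intro ideal_idl) blast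
  have IN: "ideal N (poly_ring V)" unfolding N N_ideal_def
    using G sub ylead_polys' by (intro ideal_idl) blast
  have deg: "lk u y + ydeg y g = ydeg y f" if "f \<in> I" "f \<noteq> 0" "g \<in> G" "u + lead_monom r g = lead_monom r f" for f g u
    using y_compatible_lead_monom[OF rG(1,2) assms(3)] that G sub
    by (metis lookup_add subset_iff)
  have inC: "\<forall>D. (\<forall>i>D. ycoeff y i f = 0) \<longrightarrow> ycoeff y D f \<in> C" if "f \<in> I" for f
    using rG(1) that rG(3) assms(2)
  proof (induction f rule: groebner_induct)
    case zero
    then show ?case using ideal_zero[OF IC] by simp
  next
    case (step f g u a)
    show ?case
    proof (intro allI impI)
      fix D assume D: "\<forall>i>D. ycoeff y i f = 0"
      have le: "lk u y + ydeg y g \<le> D"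
        using deg[OF step(1,2,3,5)] ylead_nonzero[OF step(2), of y] D unfolding ylead_def
        by (metis not_le_imp_less)
      let ?h = "sgl u a * g"
      have h: "ycoeff y i ?h = (if i = lk u y + ydeg y g then sgl (u - sgl y (lk u y)) a * ylead y g else 0)"
        if "i \<ge> D" for i
        using that le by (auto simp: ycoeff_single_mult ylead_def ycoeff_above_ydeg)
      have "ylead y g \<in> C" unfolding C C_ideal_def using step(3) by (intro idl_memI) auto
      moreover have "u - sgl y (lk u y) \<in> monoms V"
        using step(4) by (auto simp: monoms_def in_keys_iff lookup_minus)
      ultimately have "ycoeff y D ?h \<in> C"
        using ideal_mult[OF IC] ideal_zero[OF IC] h[of D] by (auto simp: polys_single)
      moreover have "ycoeff y i (f - ?h) = 0" if "i > D" for i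
        using h[of i] that D le by (simp add: ycoeff_diff)
      then have "ycoeff y D (f - ?h) \<in> C" using step(6) by blast
      ultimately show "ycoeff y D f \<in> C" using ideal_add[OF IC] by (fastforce simp: ycoeff_diff)
    qed
  qed
  then have "ylead y f \<in> C" if "f \<in> I" for f
    using that ycoeff_above_ydeg[of y f] unfolding ylead_def by blast
  then have "ylead y ` I \<subseteq> C" by blast
  then show "C = idl V (ylead y ` I)"
    using idl_minimal[OF IC] idl_mono[of "ylead y ` G" "ylead y ` I" V] G(1)
    unfolding C C_ideal_def by blast
  have inN: "f \<in> polys (V - {y}) \<longrightarrow> f \<in> N" if "f \<in> I" for f
    using rG(1) that rG(3) assms(2)
  proof (induction f rule: groebner_induct)
    case zero
    then show ?case using ideal_zero[OF IN] by simp
  next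
    case (step f g u a)
    show ?case
    proof
      assume f: "f \<in> polys (V - {y})"
      then have "lk u y = 0" and g: "ydeg y g = 0"
        using deg[OF step(1,2,3,5)] step(2) by (auto simp: ydeg_free)
      then have u: "sgl u a \<in> polys (V - {y})" using step(4) by (auto simp: polys_single monoms_remove)
      note gS = ydeg_zero_free[OF sub[of g] g]
      have "ylead y g \<in> N" unfolding N N_ideal_def using g step(3) by (intro idl_memI) auto
      then have "g \<in> N" using gS(2) step(3) G(1) by auto
      then have "sgl u a * g \<in> N" using ideal_mult[OF IN polys_mono[OF u]] by auto
      moreover have "f - sgl u a * g \<in> N"
        using step(3,6) f u gS(1) G(1) by (simp add: polys_diff polys_mult subset_iff)
      ultimately show "f \<in> N" using ideal_add[OF IN] by fastforce
    qed
  qed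
  have "ylead y g \<in> I \<inter> polys (V - {y})" if "g \<in> G" "ydeg y g = 0" for g
    using ydeg_zero_free[OF sub that(2)] that(1) G(1) by auto
  then have "N \<subseteq> idl V (I \<inter> polys (V - {y}))"
    unfolding N N_ideal_def by (intro idl_mono) auto
  then show "N = idl V (I \<inter> polys (V - {y}))"
    using idl_minimal[OF IN, of "I \<inter> polys (V - {y})"] inN by blast
qed

lemma CN_contractions:
  assumes "CN_ideals V y I C N" "ideal I (poly_ring V)" "y \<in> V"
  shows "C \<inter> polys (V - {y}) = idl (V - {y}) (ylead y ` I)"
    and "N \<inter> polys (V - {y}) = I \<inter> polys (V - {y})"
proof -
  have sub: "f \<in> I \<Longrightarrow> f \<in> polys V" for f by (rule ideal_subset[OF assms(2)])
  show "C \<inter> polys (V - {y}) = idl (V - {y}) (ylead y ` I)"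
    unfolding CN_ideals_unique(1)[OF assms]
    using sub ylead_polys assms(3) by (intro idl_contraction) auto
  have "N \<inter> polys (V - {y}) = idl (V - {y}) (I \<inter> polys (V - {y}))"
    unfolding CN_ideals_unique(2)[OF assms] using assms(3) by (intro idl_contraction) auto
  then show "N \<inter> polys (V - {y}) = I \<inter> polys (V - {y})"
    using idl_minimal[OF ideal_contraction[OF assms(2)] order_refl] idl_self[of "I \<inter> polys (V - {y})" "V - {y}"] by blast
qed

lemma poly_set_addI: "n \<in> N \<Longrightarrow> h \<in> Y \<Longrightarrow> n + h \<in> N <+>\<^bsub>poly_ring V\<^esub> Y"
  by (auto simp: set_add_def')

text \<open>
  For a leading coefficient \<open>q \<in> C\<close>, the product \<open>y q\<close> lies in both \<open>C\<close> and \<open>(y)\<close>, hence in the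
  right-hand side of the decomposition. This necessary condition excludes variables that occur in
  several forms.
\<close>
lemma geom_vertex_decomp_init:
  assumes "geom_vertex_decomp V y I C N" "ideal I (poly_ring V)" "y \<in> V" "f \<in> I"
  shows "Var y * ylead y f \<in> init_y_ideal V y I"
proof -
  have CN: "CN_ideals V y I C N"
    and eq: "init_y_ideal V y I = C \<inter> (N <+>\<^bsub>poly_ring V\<^esub> idl V {Var y})"
    using assms(1) by (auto simp: geom_vertex_decomp_def)
  note C = CN_ideals_unique(1)[OF CN assms(2,3)] and N = CN_ideals_unique(2)[OF CN assms(2,3)]
  have sub: "f \<in> I \<Longrightarrow> f \<in> polys V" for f by (rule ideal_subset[OF assms(2)])
  have IC: "ideal C (poly_ring V)" unfolding C
    using sub ylead_polys' by (intro ideal_idl) blast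
  have IY: "ideal (idl V {Var y}) (poly_ring V)" using assms(3) by (intro ideal_idl) auto
  have "ylead y f \<in> C" unfolding C using assms(4) by (intro idl_memI) auto
  then have "Var y * ylead y f \<in> C" using ideal_mult[OF IC] assms(3) by simp
  moreover have "ylead y f * Var y \<in> idl V {Var y}"
    by (intro ideal_mult[OF IY] ylead_polys' sub assms(4) idl_memI) auto
  moreover have "0 \<in> N" unfolding N by (rule ideal_zero[OF ideal_idl]) (use sub in auto)
  ultimately have "Var y * ylead y f \<in> C \<inter> (N <+>\<^bsub>poly_ring V\<^esub> idl V {Var y})"
    using poly_set_addI[of 0 N "Var y * ylead y f"] by (simp add: mult.commute)
  then show ?thesis unfolding eq .
qed

text \<open>
  An element of \<open>C \<inter> (N + (y))\<close> has the form \<open>n + y h\<close> with \<open>n \<in> N\<close>, and then \<open>h \<in> C\<close> because \<open>C\<close>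
  is extended from the ring without \<open>y\<close>. So the decomposition amounts to \<open>y C \<subseteq> in\<^sub>y(I)\<close>, and
  multiplying leading coefficients by one fixed element of degree one in \<open>y\<close> achieves this.
\<close>
lemma geom_vertex_decompI:
  assumes "finite V" "y \<in> V" "ideal I (poly_ring V)"
    and "a \<noteq> 0" "w \<in> polys (V - {y})"
    and "\<And>f. f \<in> I \<Longrightarrow> (Const a * Var y + w) * ylead y f \<in> I"
  shows "\<exists>C N. geom_vertex_decomp V y I C N"
proof -
  obtain C N where CN: "CN_ideals V y I C N" using CN_ideals_exist[OF assms(1-3)] by blast
  note C = CN_ideals_unique(1)[OF CN assms(3,2)] and N = CN_ideals_unique(2)[OF CN assms(3,2)]
  have sub: "f \<in> I \<Longrightarrow> f \<in> polys V" for f by (rule ideal_subset[OF assms(3)])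
  have Csub: "ylead y ` I \<subseteq> polys (V - {y})" using sub ylead_polys by blast
  have IC: "ideal C (poly_ring V)" unfolding C
    using sub ylead_polys' by (intro ideal_idl) blast
  have IN: "ideal N (poly_ring V)" unfolding N using sub by (intro ideal_idl) blast
  have y: "Var y \<in> polys V" using assms(2) by simp
  have IY: "ideal (idl V {Var y}) (poly_ring V)" using y by (intro ideal_idl) auto
  have Yiff: "g \<in> idl V {Var y} \<longleftrightarrow> (\<exists>h\<in>polys V. g = Var y * h)" for g :: "'a mpoly"
  proof
    assume g: "g \<in> idl V {Var y}"
    have "{Var y} \<subseteq> polys V" using y by auto
    with g show "\<exists>h\<in>polys V. g = Var y * h"
    proof (induction g rule: idl_induct)
      case zero then show ?case by (auto intro!: bexI[of _ 0])
    next
      case (gen a) then show ?case by (auto intro!: bexI[of _ 1])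
    next
      case (add f g)
      then obtain p q where "p \<in> polys V" "f = Var y * p" "q \<in> polys V" "g = Var y * q" by blast
      then show ?case by (intro bexI[of _ "p + q"]) (auto simp: distrib_left)
    next
      case (mult h f)
      then obtain p where "p \<in> polys V" "f = Var y * p" by blast
      then show ?case using mult(1) by (intro bexI[of _ "h * p"]) (auto simp: mult_ac)
    qed
  next
    assume "\<exists>h\<in>polys V. g = Var y * h"
    then show "g \<in> idl V {Var y}"
      using ideal_mult[OF IY, of _ "Var y"] idl_self[of "{Var y}" V] by (auto simp: mult.commute)
  qed
  let ?in = "init_y_ideal V y I" and ?K = "N <+>\<^bsub>poly_ring V\<^esub> idl V {Var y}"
  have IIn: "ideal ?in (poly_ring V)" unfolding init_y_ideal_def
    using sub init_y_polys assms(2) by (intro ideal_idl) blast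
  have IK: "ideal ?K (poly_ring V)"
    by (rule ring.add_ideals[OF ring_poly_ring IN IY])
  have init_in: "init_y y f \<in> ?in" if "f \<in> I" for f unfolding init_y_ideal_def using that by (intro idl_memI) auto
  have NC: "I \<inter> polys (V - {y}) \<subseteq> C"
  proof
    fix g assume g: "g \<in> I \<inter> polys (V - {y})"
    then have "ylead y g \<in> C" unfolding C by (intro idl_memI) auto
    then show "g \<in> C" using g ylead_free[of g V y] by auto
  qed
  have Nin: "N \<subseteq> ?in" unfolding N
    using init_in init_y_free by (intro idl_minimal[OF IIn]) fastforce
  have yC: "Var y * q \<in> ?in" if "q \<in> C" for q
  proof -
    have "q \<in> idl V (ylead y ` I)" "ylead y ` I \<subseteq> polys V"
      using that C sub ylead_polys' by auto
    then show ?thesis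
    proof (induction q rule: idl_induct)
      case (gen q)
      then obtain f where f: "f \<in> I" "q = ylead y f" by auto
      show ?case
      proof (cases "q = 0")
        case False
        have q: "q \<in> polys (V - {y})" using f sub ylead_polys by blast
        let ?h = "(Const a * Var y + w) * q"
        have "ydeg y ?h = 1" "ylead y ?h = Const a * q"
          using ydeg_linear_mult[OF assms(5,4) False] q False by (auto simp: ydeg_free ylead_free)
        then have "init_y y ?h = Const a * (Var y * q)" by (simp add: init_y_def mult_ac)
        moreover have "init_y y ?h \<in> ?in" using init_in assms(6)[OF f(1)] f(2) by simp
        ultimately show ?thesis
          using ideal_mult[OF IIn polys_Const, of _ "inverse a"] Const_inverse[OF assms(4)] by metis
      qed (use ideal_zero[OF IIn] in simp)
    next
      case (mult h f)
      then show ?case using ideal_mult[OF IIn mult(1)] by (metis mult.left_commute)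
    qed (use ideal_zero[OF IIn] ideal_add[OF IIn] in \<open>auto simp: distrib_left\<close>)
  qed
  \<comment> \<open>Membership in \<open>C\<close> is tested on the coefficients, and those of \<open>y q\<close> are those of \<open>q\<close>, shifted.\<close>
  have qC: "q \<in> C" if "Var y * q \<in> C" for q
  proof -
    have iff: "f \<in> C \<longleftrightarrow> f \<in> polys V \<and> (\<forall>i. ycoeff y i f \<in> idl (V - {y}) (ylead y ` I))" for f
      unfolding C by (rule idl_extension_iff[OF Csub assms(2)])
    have "ycoeff y i q \<in> idl (V - {y}) (ylead y ` I)" for i
      using that iff ycoeff_Var_mult(1)[of y i q] by metis
    moreover have "q \<in> polys V"
    proof -
      have "Var y * q \<in> polys V" using that iff by blast
      have "m \<in> monoms V" if "m \<in> mkeys q" for m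
      proof -
        have "m + sgl y 1 - sgl y 1 = m" by simp
        then have "m + sgl y 1 \<in> mkeys (Var y * q)"
          using that by (simp add: in_keys_iff Var_def lookup_single_mult lookup_add)
        then show ?thesis using \<open>Var y * q \<in> polys V\<close> by (metis monoms_add_iff polys_iff subset_iff)
      qed
      then show ?thesis by (auto simp: polys_iff)
    qed
    ultimately show ?thesis using iff by blast
  qed
  have "?in \<subseteq> C \<inter> ?K"
    unfolding init_y_ideal_def
  proof (rule idl_minimal)
    show "ideal (C \<inter> ?K) (poly_ring V)"
      using IC IK by (rule ring.i_intersect[OF ring_poly_ring])
    have "init_y y f \<in> C \<inter> ?K" if f: "f \<in> I" for f
    proof -
      have lC: "ylead y f \<in> C" unfolding C using f by (intro idl_memI) auto
      have "Var y ^ ydeg y f * ylead y f \<in> C"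
        using ideal_mult[OF IC _ lC] y by auto
      then have "init_y y f \<in> C" by (simp add: init_y_def mult.commute)
      moreover have "init_y y f \<in> ?K"
      proof (cases "ydeg y f")
        case 0
        then have "init_y y f \<in> N" unfolding N
          using ydeg_zero_free[OF sub[OF f]] f by (auto simp: init_y_def intro!: idl_memI)
        then show ?thesis using poly_set_addI[OF _ ideal_zero[OF IY]] by fastforce
      next
        case (Suc d)
        then have "init_y y f = Var y * (ylead y f * Var y ^ d)" by (simp add: init_y_def mult_ac)
        moreover have "ylead y f * Var y ^ d \<in> polys V" using ylead_polys'[OF sub[OF f]] y by auto
        ultimately have "init_y y f \<in> idl V {Var y}" using Yiff by blast
        then show ?thesis using poly_set_addI[OF ideal_zero[OF IN]] by fastforce
      qed
      ultimately show ?thesis by blast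
    qed
    then show "init_y y ` I \<subseteq> C \<inter> ?K" by blast
  qed
  moreover have "C \<inter> ?K \<subseteq> ?in"
  proof
    fix p assume p: "p \<in> C \<inter> ?K"
    then obtain n h where nh: "n \<in> N" "h \<in> polys V" "p = n + Var y * h"
      by (auto simp: set_add_def' Yiff)
    have "n \<in> C" using nh(1) NC idl_minimal[OF IC, of "I \<inter> polys (V - {y})"] N by blast
    then have "Var y * h \<in> C" using ideal_diff[OF IC, of p n] p nh(3) by simp
    then have "Var y * h \<in> ?in" using yC qC by blast
    then show "p \<in> ?in" using nh Nin ideal_add[OF IIn] by blast
  qed
  ultimately have "geom_vertex_decomp V y I C N"
    unfolding geom_vertex_decomp_def using CN by blast
  then show ?thesis by blast
qed

section \<open>Unmixedness of intersections of primes\<close>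

text \<open>
  The Krull dimension of \<open>R/I\<close>, read off from the primes of \<open>R\<close> itself; see \<open>krull_dim_Quot\<close>.
\<close>
definition dim_over :: "('a, 'b) ring_scheme \<Rightarrow> 'a set \<Rightarrow> enat" where
  "dim_over R I = Sup {enat d | d. \<exists>P. (\<forall>i\<le>d. primeideal (P i) R \<and> I \<subseteq> P i) \<and> (\<forall>i<d. P i \<subset> P (Suc i))}"

lemma (in cring) coset_image_mem_iff:
  assumes "ideal I R" "ideal J R" "I \<subseteq> J" "r \<in> carrier R"
  shows "I +> r \<in> (+>) I ` J \<longleftrightarrow> r \<in> J"
proof -
  have Un: "\<Union> ((+>) I ` J) = J" using ideal_incl_iff[OF assms(1,2)] assms(3) by simp
  have "(+>) I ` J \<subseteq> carrier (R Quot I)"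
    using assms(2) ideal.axioms(1)[THEN additive_subgroup.a_subset] by (auto simp: FactRing_def A_RCOSETS_def')
  from canonical_proj_vimage_mem_iff[OF assms(1) this assms(4)] show ?thesis unfolding Un by simp
qed

lemma (in cring) primeideal_coset_image_iff:
  assumes "ideal I R" "ideal J R" "I \<subseteq> J"
  shows "primeideal ((+>) I ` J) (R Quot I) \<longleftrightarrow> primeideal J R"
proof -
  interpret q: ring_hom_ring R "R Quot I" "(+>) I" by (rule ideal.rcos_ring_hom_ring[OF assms(1)])
  note mem = coset_image_mem_iff[OF assms]
  have carr: "carrier (R Quot I) = (+>) I ` carrier R"
    unfolding FactRing_def A_RCOSETS_def' image_def by (simp, blast)
  have sub: "J \<subseteq> carrier R" by (rule additive_subgroup.a_subset[OF ideal.axioms(1)[OF assms(2)]])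
  have idl: "ideal ((+>) I ` J) (R Quot I)" by (rule ring_ideal_imp_quot_ideal[OF assms(1,2)])
  have cr: "cring (R Quot I)" by (rule ideal.quotient_is_cring[OF assms(1) cring_axioms])
  have mult: "(I +> r) \<otimes>\<^bsub>R Quot I\<^esub> (I +> s) = I +> (r \<otimes> s)" if "r \<in> carrier R" "s \<in> carrier R" for r s
    using q.hom_mult that by simp
  show ?thesis
  proof
    assume P: "primeideal ((+>) I ` J) (R Quot I)"
    show "primeideal J R"
    proof (rule primeidealI[OF assms(2) cring_axioms])
      show "carrier R \<noteq> J" using primeideal.I_notcarr[OF P] carr by auto
      fix a b assume ab: "a \<in> carrier R" "b \<in> carrier R" "a \<otimes> b \<in> J"
      have "(I +> a) \<otimes>\<^bsub>R Quot I\<^esub> (I +> b) \<in> (+>) I ` J"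
        unfolding mult[OF ab(1,2)] using ab(3) by (rule imageI)
      then have "I +> a \<in> (+>) I ` J \<or> I +> b \<in> (+>) I ` J"
        by (intro primeideal.I_prime[OF P]) (simp_all only: carr imageI ab)
      then show "a \<in> J \<or> b \<in> J" unfolding mem[OF ab(1)] mem[OF ab(2)] .
    qed
  next
    assume P: "primeideal J R"
    show "primeideal ((+>) I ` J) (R Quot I)"
    proof (rule primeidealI[OF idl cr])
      show "carrier (R Quot I) \<noteq> (+>) I ` J"
      proof
        assume eq: "carrier (R Quot I) = (+>) I ` J"
        have "r \<in> J" if "r \<in> carrier R" for r
          unfolding mem[OF that, symmetric] eq[symmetric] carr using that by (rule imageI)
        then show False using primeideal.I_notcarr[OF P] sub by blast
      qed
      fix X Y assume XY: "X \<in> carrier (R Quot I)" "Y \<in> carrier (R Quot I)" "X \<otimes>\<^bsub>R Quot I\<^esub> Y \<in> (+>) I ` J"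
      then obtain a b where ab: "a \<in> carrier R" "b \<in> carrier R" "X = I +> a" "Y = I +> b" using carr by auto
      have "a \<otimes> b \<in> J"
        using XY(3) unfolding ab(3,4) mult[OF ab(1,2)] mem[OF m_closed[OF ab(1,2)]] .
      then have "a \<in> J \<or> b \<in> J" using primeideal.I_prime[OF P] ab by blast
      then show "X \<in> (+>) I ` J \<or> Y \<in> (+>) I ` J" using ab by blast
    qed
  qed
qed

lemma (in cring) krull_dim_Quot:
  assumes "ideal I R"
  shows "krull_dim (R Quot I) = dim_over R I"
proof -
  have le: "(+>) I ` J \<subseteq> (+>) I ` K \<longleftrightarrow> J \<subseteq> K" if "ideal J R" "ideal K R" "I \<subseteq> K" for J K
  proof
    assume sub: "(+>) I ` J \<subseteq> (+>) I ` K"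
    show "J \<subseteq> K"
    proof
      fix r assume r: "r \<in> J"
      then have "r \<in> carrier R" using that(1)[THEN ideal.axioms(1), THEN additive_subgroup.a_subset] by auto
      then show "r \<in> K" using coset_image_mem_iff[OF assms that(2,3)] sub r by blast
    qed
  qed blast
  then have strict: "(+>) I ` J \<subset> (+>) I ` K \<longleftrightarrow> J \<subset> K" if "ideal J R" "I \<subseteq> J" "ideal K R" "I \<subseteq> K" for J K
    using that by (simp add: less_le_not_le)
  have "(\<exists>P. (\<forall>i\<le>d. primeideal (P i) (R Quot I)) \<and> (\<forall>i<d. P i \<subset> P (Suc i))) \<longleftrightarrow>
    (\<exists>P. (\<forall>i\<le>d. primeideal (P i) R \<and> I \<subseteq> P i) \<and> (\<forall>i<d. P i \<subset> P (Suc i)))" (is "?L \<longleftrightarrow> ?R") for d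
  proof
    assume ?L
    then obtain Q where Q: "\<And>i. i \<le> d \<Longrightarrow> primeideal (Q i) (R Quot I)" "\<And>i. i < d \<Longrightarrow> Q i \<subset> Q (Suc i)" by blast
    have "\<exists>J. ideal J R \<and> I \<subseteq> J \<and> Q i = (+>) I ` J" if "i \<le> d" for i
      using quot_ideal_correspondence[OF assms] primeideal.axioms(1)[OF Q(1)[OF that]]
      unfolding bij_betw_def by blast
    then obtain P where P: "\<And>i. i \<le> d \<Longrightarrow> ideal (P i) R \<and> I \<subseteq> P i \<and> Q i = (+>) I ` P i" by metis
    have "primeideal (P i) R \<and> I \<subseteq> P i" if "i \<le> d" for i
      using P[OF that] Q(1)[OF that] primeideal_coset_image_iff[OF assms, of "P i"] by simp
    moreover have "P i \<subset> P (Suc i)" if "i < d" for i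
      using P[of i] P[of "Suc i"] Q(2)[OF that] strict[of "P i" "P (Suc i)"] that by simp
    ultimately show ?R by blast
  next
    assume ?R
    then obtain P where P: "\<And>i. i \<le> d \<Longrightarrow> primeideal (P i) R" "\<And>i. i \<le> d \<Longrightarrow> I \<subseteq> P i" "\<And>i. i < d \<Longrightarrow> P i \<subset> P (Suc i)"
      by blast
    have "primeideal ((+>) I ` P i) (R Quot I)" if "i \<le> d" for i
      unfolding primeideal_coset_image_iff[OF assms primeideal.axioms(1)[OF P(1)[OF that]] P(2)[OF that]]
      by (rule P(1)[OF that])
    moreover have "(+>) I ` P i \<subset> (+>) I ` P (Suc i)" if "i < d" for i
      using strict[of "P i" "P (Suc i)"] primeideal.axioms(1)[OF P(1)[of i]]
        primeideal.axioms(1)[OF P(1)[of "Suc i"]] P(2)[of i] P(2)[of "Suc i"] P(3)[OF that] that by simp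
    ultimately show ?L by (intro exI[of _ "\<lambda>i. (+>) I ` P i"]) blast
  qed
  then show ?thesis unfolding krull_dim_def dim_over_def by simp
qed

text \<open>
  Otherwise the product of elements chosen in each \<open>J\<close> outside \<open>P\<close> would be in the intersection but
  not in the prime \<open>P\<close>. The carrier in the assumption gives the empty intersection its right value.
\<close>
lemma (in cring) prime_contains_Inter:
  assumes "finite F" "\<And>J. J \<in> F \<Longrightarrow> ideal J R" "primeideal P R" "carrier R \<inter> \<Inter>F \<subseteq> P"
  shows "\<exists>J\<in>F. J \<subseteq> P"
proof (rule ccontr)
  assume "\<not> ?thesis"
  then have "\<forall>J\<in>F. \<exists>x. x \<in> J - P" by blast
  moreover have "\<exists>z \<in> carrier R \<inter> \<Inter>F. z \<notin> P" if "finite F" "\<forall>J\<in>F. \<exists>x. x \<in> J - P" "\<forall>J\<in>F. ideal J R" for F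
    using that
  proof (induction F rule: finite_induct)
    case empty
    then show ?case
      using primeideal.I_notcarr[OF assms(3)] additive_subgroup.a_subset[OF ideal.axioms(1)[OF primeideal.axioms(1)[OF assms(3)]]]
      by auto
  next
    case (insert J F)
    then obtain z x where z: "z \<in> carrier R" "z \<in> \<Inter>F" "z \<notin> P" and x: "x \<in> J" "x \<notin> P" by auto
    have xc: "x \<in> carrier R" using insert.prems x(1) by (auto dest!: ideal.axioms(1) additive_subgroup.a_subset)
    have "z \<otimes> x \<notin> P" using primeideal.I_prime[OF assms(3)] z x xc by blast
    moreover have "z \<otimes> x \<in> J" using insert.prems ideal.I_l_closed x(1) z(1) by fastforce
    moreover have "z \<otimes> x \<in> K" if "K \<in> F" for K
      using insert.prems ideal.I_r_closed z(2) xc that by fastforce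
    ultimately show ?case using z(1) xc by (intro bexI[of _ "z \<otimes> x"]) auto
  qed
  ultimately show False using assms by blast
qed

text \<open>
  The smallest prime of a chain over \<open>\<Inter>F\<close> already contains some \<open>J \<in> F\<close>, so each chain over the
  intersection is a chain over one of its members.
\<close>
lemma (in cring) dim_over_Inter:
  assumes "finite F" "F \<noteq> {}" "\<And>J. J \<in> F \<Longrightarrow> ideal J R" "\<And>J. J \<in> F \<Longrightarrow> dim_over R J = k"
  shows "dim_over R (\<Inter>F) = k"
proof (rule antisym)
  show "dim_over R (\<Inter>F) \<le> k"
    unfolding dim_over_def[of R "\<Inter>F"]
  proof (rule Sup_least)
    fix e assume "e \<in> {enat d |d. \<exists>P. (\<forall>i\<le>d. primeideal (P i) R \<and> \<Inter>F \<subseteq> P i) \<and> (\<forall>i<d. P i \<subset> P (Suc i))}"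
    then obtain d P where e: "e = enat d" and
      P: "\<And>i. i \<le> d \<Longrightarrow> primeideal (P i) R" "\<And>i. i \<le> d \<Longrightarrow> \<Inter>F \<subseteq> P i" "\<And>i. i < d \<Longrightarrow> P i \<subset> P (Suc i)" by blast
    obtain J where J: "J \<in> F" "J \<subseteq> P 0"
      using prime_contains_Inter[OF assms(1,3) P(1)[of 0]] P(2)[of 0] by blast
    have "J \<subseteq> P i" if "i \<le> d" for i
      using that
    proof (induction i)
      case (Suc i)
      then show ?case using P(3)[of i] by (meson Suc_leD Suc_le_lessD psubsetE subset_trans)
    qed (rule J(2))
    then have "enat d \<le> dim_over R J"
      unfolding dim_over_def by (intro Sup_upper) (use P in blast)
    then show "e \<le> k" using e assms(4)[OF J(1)] by simp
  qed
  obtain J where J: "J \<in> F" using assms(2) by blast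
  have "dim_over R J \<le> dim_over R (\<Inter>F)"
    unfolding dim_over_def by (rule Sup_subset_mono) (use J in blast)
  then show "k \<le> dim_over R (\<Inter>F)" using assms(4)[OF J] by simp
qed

text \<open>
  An associated prime \<open>{r. r f \<in> \<Inter>F}\<close> is the intersection of those members of \<open>F\<close> that miss \<open>f\<close>;
  being prime, it is one of them.
\<close>
lemma (in cring) unmixed_Inter_primes:
  assumes "finite F" "F \<noteq> {}" "\<And>P. P \<in> F \<Longrightarrow> primeideal P R" "\<And>P. P \<in> F \<Longrightarrow> dim_over R P = k"
  shows "unmixed R (\<Inter>F)"
  unfolding unmixed_def
proof
  have Fi: "\<And>P. P \<in> F \<Longrightarrow> ideal P R" using assms(3) primeideal.axioms(1) by blast
  have sub: "\<And>P. P \<in> F \<Longrightarrow> P \<subseteq> carrier R" using Fi by (auto dest!: ideal.axioms(1) additive_subgroup.a_subset)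
  have I: "ideal (\<Inter>F) R" by (rule i_Intersect[OF Fi assms(2)])
  fix P assume "P \<in> ass_primes R (\<Inter>F)"
  then obtain f where P: "primeideal P R" and f: "f \<in> carrier R" "P = {r \<in> carrier R. r \<otimes> f \<in> \<Inter>F}"
    unfolding ass_primes_def by blast
  \<comment> \<open>A prime not containing \<open>f\<close> contains \<open>r f\<close> iff it contains \<open>r\<close>.\<close>
  let ?G = "{J \<in> F. f \<notin> J}"
  have "carrier R \<inter> \<Inter>?G \<subseteq> P"
  proof
    fix r assume r: "r \<in> carrier R \<inter> \<Inter>?G"
    have "r \<otimes> f \<in> J" if J: "J \<in> F" for J
    proof (cases "f \<in> J")
      case True then show ?thesis using ideal.I_l_closed[OF Fi[OF J]] r by blast
    next
      case False then show ?thesis using ideal.I_r_closed[OF Fi[OF J]] r J f by blast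
    qed
    then show "r \<in> P" using r f by blast
  qed
  then obtain J where J: "J \<in> ?G" "J \<subseteq> P"
    using prime_contains_Inter[of ?G P] assms(1) Fi P by auto
  have "P \<subseteq> J"
  proof
    fix r assume "r \<in> P"
    then have "r \<in> carrier R" "r \<otimes> f \<in> J" using f J by auto
    then show "r \<in> J" using primeideal.I_prime[OF assms(3)] J f by blast
  qed
  then have "P = J" using J by blast
  then show "krull_dim (R Quot P) = krull_dim (R Quot \<Inter>F)"
    using J assms(4) Fi krull_dim_Quot I dim_over_Inter[OF assms(1,2) Fi assms(4)] by auto
qed

text \<open>
  The zero module has no associated primes, because a prime ideal is proper.
\<close>
lemma (in cring) unmixed_carrier: "unmixed R (carrier R)"
proof -
  have "\<not> primeideal P R" if "f \<in> carrier R" "P = {r \<in> carrier R. r \<otimes> f \<in> carrier R}" for P f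
    using that primeideal.I_notcarr[of P R] by auto
  then show ?thesis unfolding unmixed_def ass_primes_def by blast
qed

section \<open>Evaluation homomorphisms\<close>

definition mon_ev :: "(nat \<Rightarrow> 'k::field mpoly) \<Rightarrow> monom \<Rightarrow> 'k mpoly" where
  "mon_ev \<sigma> m = (\<Prod>j\<in>mkeys m. \<sigma> j ^ lk m j)"

definition ev :: "(nat \<Rightarrow> 'k::field mpoly) \<Rightarrow> 'k mpoly \<Rightarrow> 'k mpoly" where
  "ev \<sigma> f = (\<Sum>m\<in>mkeys f. Const (lk f m) * mon_ev \<sigma> m)"

lemma mon_ev_superset: "finite B \<Longrightarrow> mkeys m \<subseteq> B \<Longrightarrow> mon_ev \<sigma> m = (\<Prod>j\<in>B. \<sigma> j ^ lk m j)"
  unfolding mon_ev_def by (rule prod.mono_neutral_left) (auto simp: in_keys_iff)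

lemma mon_ev_add: "mon_ev \<sigma> (m + n) = mon_ev \<sigma> m * mon_ev \<sigma> n"
proof -
  let ?B = "mkeys m \<union> mkeys n"
  have "mon_ev \<sigma> (m + n) = (\<Prod>j\<in>?B. \<sigma> j ^ lk (m + n) j)"
    by (rule mon_ev_superset) (auto simp: keys_monom_add)
  also have "\<dots> = (\<Prod>j\<in>?B. \<sigma> j ^ lk m j) * (\<Prod>j\<in>?B. \<sigma> j ^ lk n j)"
    by (simp add: lookup_add power_add prod.distrib)
  finally show ?thesis using mon_ev_superset[of ?B m \<sigma>] mon_ev_superset[of ?B n \<sigma>] by simp
qed

lemma ev_superset: "finite B \<Longrightarrow> mkeys f \<subseteq> B \<Longrightarrow> ev \<sigma> f = (\<Sum>m\<in>B. Const (lk f m) * mon_ev \<sigma> m)"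
  unfolding ev_def by (rule sum.mono_neutral_left) (auto simp: in_keys_iff)

lemma ev_add: "ev \<sigma> (f + g) = ev \<sigma> f + ev \<sigma> g"
proof -
  let ?B = "mkeys f \<union> mkeys g"
  have "ev \<sigma> (f + g) = (\<Sum>m\<in>?B. Const (lk (f + g) m) * mon_ev \<sigma> m)"
    by (rule ev_superset) (use Poly_Mapping.keys_add[of f g] in auto)
  also have "\<dots> = (\<Sum>m\<in>?B. Const (lk f m) * mon_ev \<sigma> m) + (\<Sum>m\<in>?B. Const (lk g m) * mon_ev \<sigma> m)"
    by (simp add: lookup_add Const_add distrib_right sum.distrib)
  finally show ?thesis using ev_superset[of ?B f \<sigma>] ev_superset[of ?B g \<sigma>] by simp
qed

lemma ev_zero [simp]: "ev \<sigma> 0 = 0"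
  by (simp add: ev_def)

lemma ev_single: "ev \<sigma> (sgl m a) = Const a * mon_ev \<sigma> m"
  by (cases "a = 0") (simp_all add: ev_def)

lemma ev_mult: "ev \<sigma> (f * g) = ev \<sigma> f * ev \<sigma> g"
proof (induction f rule: mpoly_induct)
  case (single m a)
  show ?case
  proof (induction g rule: mpoly_induct)
    case (single n b)
    show ?case unfolding ev_single mult_single mon_ev_add Const_mult by (simp only: mult_ac)
  qed (simp_all add: distrib_left ev_add)
qed (simp_all add: ev_add distrib_right)

lemma ev_Const [simp]: "ev \<sigma> (Const a) = Const a"
  by (simp add: Const_def ev_single) (simp add: mon_ev_def Const_def)

lemma ev_Var [simp]: "ev \<sigma> (Var j) = \<sigma> j"
  by (simp add: Var_def ev_single) (simp add: mon_ev_def)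

lemma polys_induct [consumes 1, case_names Const Var add mult]:
  assumes f: "f \<in> polys V"
    and Q: "\<And>a. Q (Const a)" "\<And>j. j \<in> V \<Longrightarrow> Q (Var j)"
    "\<And>f g. Q f \<Longrightarrow> Q g \<Longrightarrow> Q (f + g)" "\<And>f g. Q f \<Longrightarrow> Q g \<Longrightarrow> Q (f * g)"
  shows "Q f"
proof (induction f rule: mpoly_induct)
  case zero
  then show ?case using Q(1)[of 0] by simp
next
  case (single m a)
  then have m: "mkeys m \<subseteq> V" using f by (auto simp: polys_iff monoms_def)
  have pow: "Q (Var j ^ d)" if "j \<in> V" for j d
    by (induction d) (use Q(1)[of 1] Q(2)[OF that] Q(4) in auto)
  have "Q (sgl (\<Sum>j\<in>B. sgl j (lk m j)) a)" if "finite B" "B \<subseteq> V" for B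
    using that
  proof (induction B)
    case empty
    then show ?case using Q(1)[of a] by (simp add: Const_def)
  next
    case (insert j B)
    then have "sgl (\<Sum>j\<in>insert j B. sgl j (lk m j)) a = Var j ^ lk m j * sgl (\<Sum>j\<in>B. sgl j (lk m j)) a"
      by (simp add: Var_power mult_single)
    then show ?case using insert Q(4) pow by simp
  qed
  from this[of "mkeys m"] show ?case using m mpoly_sum_single[of m] by simp
qed (use Q in auto)

lemma ev_polys: "f \<in> polys V \<Longrightarrow> (\<And>j. j \<in> V \<Longrightarrow> \<sigma> j \<in> polys W) \<Longrightarrow> ev \<sigma> f \<in> polys W"
  by (induction f rule: polys_induct) (auto simp: ev_add ev_mult)

lemma ev_id: "f \<in> polys V \<Longrightarrow> (\<And>j. j \<in> V \<Longrightarrow> \<sigma> j = Var j) \<Longrightarrow> ev \<sigma> f = f"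
  by (induction f rule: polys_induct) (auto simp: ev_add ev_mult)

lemma ev_ev: "f \<in> polys V \<Longrightarrow> ev \<sigma> (ev \<tau> f) = ev (\<lambda>j. ev \<sigma> (\<tau> j)) f"
  by (induction f rule: polys_induct) (auto simp: ev_add ev_mult)

lemma ev_idl:
  assumes "f \<in> idl V A" "A \<subseteq> polys V" "\<And>j. j \<in> V \<Longrightarrow> \<sigma> j \<in> polys W"
    and "ideal I (poly_ring W)" "\<And>a. a \<in> A \<Longrightarrow> ev \<sigma> a \<in> I"
  shows "ev \<sigma> f \<in> I"
  using assms(1,2)
proof (induction f rule: idl_induct)
  case (mult h f)
  have "ev \<sigma> h \<in> polys W" using ev_polys[OF mult(1)] assms(3) by blast
  then show ?case using mult ideal_mult[OF assms(4)] by (simp add: ev_mult)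
qed (use assms(5) ideal_zero[OF assms(4)] ideal_add[OF assms(4)] in \<open>auto simp: ev_add\<close>)

section \<open>Ideals generated by linear forms\<close>

abbreviation lin :: "nat set \<Rightarrow> 'k::field mpoly set" where
  "lin V \<equiv> poly_vs.span (Var ` V)"

abbreviation lcoeff :: "'k::field mpoly \<Rightarrow> nat \<Rightarrow> 'k" where
  "lcoeff z y \<equiv> lk z (sgl y 1)"

lemma ideal_subspace: "ideal I (poly_ring V) \<Longrightarrow> poly_vs.subspace I"
  by (auto simp: poly_vs.subspace_def ideal_zero ideal_add ideal_mult)

lemma lin_polys: "lin V \<subseteq> polys V"
  by (rule poly_vs.span_minimal[OF _ ideal_subspace[OF ideal_polys]]) auto

lemma lookup_Const_mult: "lk (Const a * f) m = a * lk f m"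
  by (simp add: Const_def lookup_single_mult)

lemma lin_keys:
  fixes z :: "'k::field mpoly"
  assumes "z \<in> lin V" "m \<in> mkeys z"
  shows "\<exists>j\<in>V. m = sgl j 1"
proof -
  have "lin V \<subseteq> {z :: 'k mpoly. \<forall>m\<in>mkeys z. \<exists>j\<in>V. m = sgl j 1}"
  proof (rule poly_vs.span_minimal)
    show "Var ` V \<subseteq> {z :: 'k mpoly. \<forall>m\<in>mkeys z. \<exists>j\<in>V. m = sgl j 1}" by (auto simp: Var_def)
    have "m \<in> mkeys f \<or> m \<in> mkeys g" if "m \<in> mkeys (f + g)" for f g :: "'k mpoly" and m
      using that by (auto simp: in_keys_iff lookup_add)
    moreover have "m \<in> mkeys f" if "m \<in> mkeys (Const a * f)" for f :: "'k mpoly" and m a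
      using that by (auto simp: in_keys_iff lookup_Const_mult)
    ultimately show "poly_vs.subspace {z :: 'k mpoly. \<forall>m\<in>mkeys z. \<exists>j\<in>V. m = sgl j 1}"
      unfolding poly_vs.subspace_def by (auto, blast+)
  qed
  then show ?thesis using assms by blast
qed

lemma lin_homogeneous: "z \<in> lin V \<Longrightarrow> homogeneous 1 z"
  using lin_keys unfolding homogeneous_def by (metis tdeg_single)

lemma lin_exists_coeff: "z \<in> lin V \<Longrightarrow> z \<noteq> 0 \<Longrightarrow> \<exists>y\<in>V. lcoeff z y \<noteq> 0"
  using lin_keys[of z V] keys_eq_empty[of z] by (metis all_not_in_conv in_keys_iff)

lemma Var_inject [simp]: "Var i = (Var j :: 'k::field mpoly) \<longleftrightarrow> i = j"
proof
  assume "Var i = (Var j :: 'k mpoly)"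
  then have "mkeys (Var i :: 'k mpoly) = mkeys (Var j :: 'k mpoly)" by simp
  then have "mkeys (sgl i (1::nat)) = mkeys (sgl j (1::nat))" by (simp add: Var_def)
  then show "i = j" by simp
qed simp

lemma Var_nonzero [simp]: "Var j \<noteq> (0 :: 'k::field mpoly)"
proof
  assume "Var j = (0 :: 'k mpoly)"
  then have "lcoeff (Var j :: 'k mpoly) j = 0" by simp
  then show False by (simp add: Var_def)
qed

lemma Var_polys_iff: "(Var j :: 'k::field mpoly) \<in> polys V \<longleftrightarrow> j \<in> V"
  by (simp add: Var_def polys_single)

lemma polys_lcoeff_zero: "w \<in> polys (V - {y}) \<Longrightarrow> lcoeff w y = 0"
  using polys_keys_zero[of w V y "sgl y 1"] by (auto simp: in_keys_iff)

text \<open>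
  Writing \<open>z = a y + w\<close> with \<open>w\<close> free of \<open>y\<close> is how linear forms enter computations of leading
  coefficients in \<open>y\<close>.
\<close>
lemma lin_split:
  assumes "z \<in> lin V" "y \<in> V"
  shows "\<exists>w\<in>lin (V - {y}). z = Const (lcoeff z y) * Var y + w"
proof -
  have "Var ` V = insert (Var y) (Var ` (V - {y}))" using assms(2) by auto
  from assms(1)[unfolded this poly_vs.span_insert]
  obtain k where k: "z - Const k * Var y \<in> lin (V - {y})" by blast
  have "lcoeff (z - Const k * Var y) y = 0" using k lin_polys polys_lcoeff_zero by blast
  then have "lcoeff z y = k" by (simp add: lookup_minus lookup_Const_mult Var_def)
  then show ?thesis using k by (intro bexI[OF _ k]) simp
qed

lemma lin_mono: "V \<subseteq> W \<Longrightarrow> lin V \<subseteq> lin W"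
  by (rule poly_vs.span_mono) auto

lemma lin_remove_iff:
  assumes "z \<in> lin V"
  shows "z \<in> lin (V - {y}) \<longleftrightarrow> lcoeff z y = 0"
proof
  assume "z \<in> lin (V - {y})"
  then have "z \<in> polys (V - {y})" using lin_polys by blast
  then show "lcoeff z y = 0" by (rule polys_lcoeff_zero)
next
  assume 0: "lcoeff z y = 0"
  show "z \<in> lin (V - {y})"
  proof (cases "y \<in> V")
    case True
    then obtain w where "w \<in> lin (V - {y})" "z = Const (lcoeff z y) * Var y + w"
      using lin_split[OF assms] by blast
    then show ?thesis using 0 by simp
  qed (use assms in simp)
qed

lemma linear_form_lin:
  assumes "linear_form n f"
  shows "f \<in> lin {0..n}"
proof -
  have "sgl m (lk f m) \<in> lin {0..n}" if "m \<in> mkeys f" for m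
  proof -
    have "\<exists>j\<le>n. m = sgl j 1"
      by (rule bspec[OF assms[unfolded linear_form_def] that])
    then obtain j where j: "j \<le> n" "m = sgl j 1" by (elim exE conjE)
    have "Const (lk f m) * Var j \<in> lin {0..n}"
      by (rule poly_vs.span_scale, rule poly_vs.span_base) (use j in auto)
    then show ?thesis using j by (simp add: Const_def Var_def mult_single)
  qed
  then have "(\<Sum>m\<in>mkeys f. sgl m (lk f m)) \<in> lin {0..n}" by (intro poly_vs.span_sum) auto
  then show ?thesis using mpoly_sum_single[of f] by simp
qed

lemma independent_Var: "poly_vs.independent (Var ` V :: 'k::field mpoly set)"
  unfolding poly_vs.dependent_def
proof safe
  fix j assume j: "j \<in> V" "(Var j :: 'k mpoly) \<in> poly_vs.span (Var ` V - {Var j})"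
  have "Var ` V - {Var j :: 'k mpoly} \<subseteq> Var ` (V - {j})" by auto
  then have "(Var j :: 'k mpoly) \<in> polys (V - {j})"
    using j(2) poly_vs.span_mono lin_polys by blast
  then show False by (simp add: Var_polys_iff)
qed

lemma card_Var [simp]: "card (Var ` V :: 'k::field mpoly set) = card V"
  by (rule card_image) (auto simp: inj_on_def)

lemma independent_lin_card:
  assumes "finite V" "A \<subseteq> lin V" "poly_vs.independent (A :: 'k::field mpoly set)"
  shows "finite A \<and> card A \<le> card V"
  using poly_vs.independent_span_bound[OF _ assms(3,2)] assms(1) by simp

lemma idl_span:
  assumes "A \<subseteq> polys V" "B \<subseteq> polys V" "poly_vs.span A = poly_vs.span B"
  shows "idl V A = idl V B"
proof -
  have "idl V A \<subseteq> idl V B" if "B \<subseteq> polys V" "A \<subseteq> poly_vs.span B" for A B :: "'a mpoly set"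
    using poly_vs.span_minimal[OF idl_self ideal_subspace[OF ideal_idl[OF that(1)]]] that
    by (intro idl_minimal[OF ideal_idl[OF that(1)]]) blast
  then show ?thesis using assms poly_vs.span_superset by (metis subset_antisym)
qed

definition poly_aut :: "nat set \<Rightarrow> (nat \<Rightarrow> 'k::field mpoly) \<Rightarrow> (nat \<Rightarrow> 'k mpoly) \<Rightarrow> bool" where
  "poly_aut V \<sigma> \<tau> \<longleftrightarrow> (\<forall>j\<in>V. \<sigma> j \<in> polys V \<and> \<tau> j \<in> polys V) \<and>
     (\<forall>f\<in>polys V. ev \<sigma> (ev \<tau> f) = f \<and> ev \<tau> (ev \<sigma> f) = f)"

lemma poly_aut_sym: "poly_aut V \<sigma> \<tau> \<Longrightarrow> poly_aut V \<tau> \<sigma>"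
  by (auto simp: poly_aut_def)

lemma poly_autD:
  assumes "poly_aut V \<sigma> \<tau>"
  shows "f \<in> polys V \<Longrightarrow> ev \<sigma> f \<in> polys V" "f \<in> polys V \<Longrightarrow> ev \<tau> f \<in> polys V"
    "f \<in> polys V \<Longrightarrow> ev \<sigma> (ev \<tau> f) = f" "f \<in> polys V \<Longrightarrow> ev \<tau> (ev \<sigma> f) = f"
  using assms ev_polys unfolding poly_aut_def by blast+

lemma poly_aut_inj: "poly_aut V \<sigma> \<tau> \<Longrightarrow> inj_on (ev \<sigma>) (polys V)"
  by (metis inj_on_inverseI poly_autD(4))

text \<open>
  Extend \<open>A\<close> to a basis of the space of linear forms and map this basis bijectively to the
  variables, taking \<open>A\<close> to those indexed by \<open>P\<close>. The linear map and its inverse, applied to the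
  variables, define mutually inverse substitutions.
\<close>
lemma exists_aut_to_Var:
  fixes A :: "'k::field mpoly set"
  assumes "finite V" "A \<subseteq> lin V" "poly_vs.independent A" "P \<subseteq> V" "card P = card A"
  shows "\<exists>\<sigma> \<tau>. poly_aut V \<sigma> \<tau> \<and> ev \<sigma> ` A = Var ` P"
proof -
  interpret vector_space_pair "\<lambda>(a::'k) (f::'k mpoly). Const a * f" "\<lambda>(a::'k) (f::'k mpoly). Const a * f"
    by unfold_locales
  obtain B where B: "A \<subseteq> B" "B \<subseteq> lin V" "poly_vs.independent B" "lin V \<subseteq> poly_vs.span B"
    using poly_vs.maximal_independent_subset_extend[OF assms(2,3)] by blast
  have fin: "finite B" "card B \<le> card V" using independent_lin_card[OF assms(1) B(2,3)] by auto
  have "Var ` V \<subseteq> poly_vs.span B" using B(4) poly_vs.span_superset by blast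
  then have "card V \<le> card B"
    using poly_vs.independent_span_bound[OF fin(1) independent_Var[of V]] by simp
  then have card: "card B = card V" using fin by simp
  have finA: "finite A" using fin(1) B(1) finite_subset by blast
  have finP: "finite P" using assms(1,4) finite_subset by blast
  obtain p1 where p1: "bij_betw p1 A (Var ` P :: 'k mpoly set)"
    using finite_same_card_bij[OF finA, of "Var ` P"] assms(5) finP by auto
  have "card (B - A) = card (V - P)"
    using card assms(4,5) B(1) finA finP by (simp add: card_Diff_subset)
  then obtain p2 where p2: "bij_betw p2 (B - A) (Var ` (V - P) :: 'k mpoly set)"
    using finite_same_card_bij[of "B - A" "Var ` (V - P)"] assms(1) fin by auto
  \<comment> \<open>a bijection from the basis \<open>B\<close> to the variables that takes \<open>A\<close> to those indexed by \<open>P\<close>\<close>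
  define p where "p x = (if x \<in> A then p1 x else p2 x)" for x
  have pA: "bij_betw p A (Var ` P)"
    using p1 by (rule bij_betw_cong[THEN iffD1, rotated]) (simp add: p_def)
  have pB: "bij_betw p (B - A) (Var ` (V - P))"
    using p2 by (rule bij_betw_cong[THEN iffD1, rotated]) (simp add: p_def)
  have disj: "Var ` P \<inter> Var ` (V - P) = ({} :: 'k mpoly set)" by auto
  have "A \<union> (B - A) = B" "Var ` P \<union> Var ` (V - P) = (Var ` V :: 'k mpoly set)"
    using B(1) assms(4) by auto
  then have p: "bij_betw p B (Var ` V)" using bij_betw_combine[OF pA pB disj] by simp
  define q where "q = inv_into B p"
  obtain g where g: "Vector_Spaces.linear (\<lambda>(a::'k) (f::'k mpoly). Const a * f) (\<lambda>a f. Const a * f) g"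
      "\<forall>x\<in>B. g x = p x"
    using linear_independent_extend[OF B(3)] by blast
  obtain h where h: "Vector_Spaces.linear (\<lambda>(a::'k) (f::'k mpoly). Const a * f) (\<lambda>a f. Const a * f) h"
      "\<forall>x\<in>Var ` V. h x = q x"
    using linear_independent_extend[OF independent_Var] by blast
  interpret g: Vector_Spaces.linear "\<lambda>(a::'k) (f::'k mpoly). Const a * f" "\<lambda>a f. Const a * f" g by (rule g(1))
  interpret h: Vector_Spaces.linear "\<lambda>(a::'k) (f::'k mpoly). Const a * f" "\<lambda>a f. Const a * f" h by (rule h(1))
  have qB: "q x \<in> B" "p (q x) = x" if "x \<in> Var ` V" for x
    using that p unfolding q_def bij_betw_def by (auto simp: inv_into_into f_inv_into_f)
  have gh: "g (h (Var j)) = Var j" if "j \<in> V" for j using qB[of "Var j"] g(2) h(2) that by simp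
  have hgB: "h (g b) = b" if "b \<in> B" for b
  proof -
    have "p b \<in> Var ` V" using p that by (auto simp: bij_betw_def)
    then have "h (g b) = q (p b)" using bspec[OF h(2)] bspec[OF g(2) that] by metis
    then show ?thesis using p that unfolding q_def bij_betw_def by (simp add: inv_into_f_f)
  qed
  have hg: "h (g x) = x" if "x \<in> poly_vs.span B" for x
    using that by (induction x rule: poly_vs.span_induct_alt)
      (auto simp: g.zero h.zero g.add h.add g.scale h.scale hgB)
  define \<sigma> where "\<sigma> j = g (Var j)" for j
  define \<tau> where "\<tau> j = h (Var j)" for j
  have evg: "ev \<sigma> x = g x" if "x \<in> lin V" for x
    using that by (induction x rule: poly_vs.span_induct_alt)
      (auto simp: g.zero g.add g.scale ev_add ev_mult \<sigma>_def)
  have evh: "ev \<tau> x = h x" if "x \<in> lin V" for x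
    using that by (induction x rule: poly_vs.span_induct_alt)
      (auto simp: h.zero h.add h.scale ev_add ev_mult \<tau>_def)
  have spanB: "poly_vs.span B \<subseteq> lin V" using B(2) poly_vs.span_minimal poly_vs.subspace_span by blast
  have g_lin: "g x \<in> lin V" if "x \<in> poly_vs.span B" for x
    using that
  proof (induction x rule: poly_vs.span_induct_alt)
    case (step a x y)
    have "g x \<in> Var ` V" using step(1) g(2) p by (auto simp: bij_betw_def)
    then have "Const a * g x \<in> lin V" by (intro poly_vs.span_scale poly_vs.span_base)
    then show ?case using step(2) poly_vs.span_add by (simp add: g.add g.scale)
  qed (simp add: g.zero poly_vs.span_zero)
  have V_B: "Var j \<in> poly_vs.span B" if "j \<in> V" for j
    using that B(4) poly_vs.span_base[of "Var j" "Var ` V"] by blast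
  have \<sigma>_lin: "\<sigma> j \<in> lin V" if "j \<in> V" for j using g_lin V_B that by (simp add: \<sigma>_def)
  have \<tau>_lin: "\<tau> j \<in> lin V" if "j \<in> V" for j using h(2) qB(1)[of "Var j"] B(2) that by (auto simp: \<tau>_def)
  have "ev \<sigma> (ev \<tau> f) = f" if "f \<in> polys V" for f
    unfolding ev_ev[OF that] by (rule ev_id[OF that]) (use evg \<tau>_lin gh in \<open>simp add: \<tau>_def\<close>)
  moreover have "ev \<tau> (ev \<sigma> f) = f" if "f \<in> polys V" for f
    unfolding ev_ev[OF that] by (rule ev_id[OF that]) (use evh \<sigma>_lin hg V_B in \<open>simp add: \<sigma>_def\<close>)
  ultimately have "poly_aut V \<sigma> \<tau>" unfolding poly_aut_def using \<sigma>_lin \<tau>_lin lin_polys by blast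
  moreover have "ev \<sigma> ` A = Var ` P"
  proof -
    have "ev \<sigma> x = p x" if "x \<in> A" for x
    proof -
      have "x \<in> B" "x \<in> lin V" using that B(1) assms(2) by blast+
      then show ?thesis using evg g(2) by simp
    qed
    then have "ev \<sigma> ` A = p ` A" by (intro image_cong) auto
    then show ?thesis using pA by (simp add: bij_betw_def)
  qed
  ultimately show ?thesis by blast
qed

lemma poly_aut_image_idl:
  assumes "poly_aut V \<sigma> \<tau>" "A \<subseteq> polys V"
  shows "ev \<sigma> ` idl V A = idl V (ev \<sigma> ` A)"
proof -
  have A': "ev \<sigma> ` A \<subseteq> polys V" using assms poly_autD(1) by blast
  have s: "\<sigma> j \<in> polys V" "\<tau> j \<in> polys V" if "j \<in> V" for j using assms(1) that by (auto simp: poly_aut_def)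
  have 1: "ev \<sigma> f \<in> idl V (ev \<sigma> ` A)" if "f \<in> idl V A" for f
    by (rule ev_idl[OF that assms(2) s(1) ideal_idl[OF A']]) (auto intro: idl_memI)
  have 2: "ev \<tau> f \<in> idl V A" if "f \<in> idl V (ev \<sigma> ` A)" for f
    using that A' s(2) ideal_idl[OF assms(2)]
  proof (rule ev_idl)
    fix a assume "a \<in> ev \<sigma> ` A"
    then obtain b where b: "b \<in> A" "a = ev \<sigma> b" by auto
    then have "ev \<tau> a = b" using poly_autD(4)[OF assms(1)] assms(2) by auto
    then show "ev \<tau> a \<in> idl V A" using b by (simp add: idl_memI)
  qed auto
  show ?thesis
  proof
    show "idl V (ev \<sigma> ` A) \<subseteq> ev \<sigma> ` idl V A"
    proof
      fix f assume f: "f \<in> idl V (ev \<sigma> ` A)"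
      then have "f = ev \<sigma> (ev \<tau> f)" using poly_autD(3)[OF assms(1)] idl_subset_polys[OF A'] by auto
      then show "f \<in> ev \<sigma> ` idl V A" using 2[OF f] by blast
    qed
  qed (use 1 in blast)
qed

definition kill :: "nat set \<Rightarrow> nat \<Rightarrow> 'k::field mpoly" where
  "kill P j = (if j \<in> P then 0 else Var j)"

text \<open>
  Each \<open>f\<close> is congruent to \<open>ev (kill P) f\<close> modulo the variables indexed by \<open>P\<close>, so the ideal they
  generate is the kernel of this substitution.
\<close>
lemma idl_Var_iff:
  assumes "P \<subseteq> V"
  shows "f \<in> idl V (Var ` P) \<longleftrightarrow> f \<in> polys V \<and> ev (kill P) f = 0"
proof -
  have sub: "Var ` P \<subseteq> (polys V :: 'a mpoly set)" using assms by auto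
  note I = ideal_idl[OF sub]
  have k: "kill P j \<in> (polys V :: 'a mpoly set)" if "j \<in> V" for j using that by (simp add: kill_def)
  have *: "f - ev (kill P) f \<in> idl V (Var ` P) \<and> f \<in> polys V" if "f \<in> polys V" for f :: "'a mpoly"
    using that
  proof (induction f rule: polys_induct)
    case (Const a)
    then show ?case using ideal_zero[OF I] by simp
  next
    case (Var j)
    then show ?case using ideal_zero[OF I] by (auto simp: kill_def intro: idl_memI)
  next
    case (add f g)
    have "f + g - ev (kill P) (f + g) = (f - ev (kill P) f) + (g - ev (kill P) g)" by (simp add: ev_add)
    moreover have "(f - ev (kill P) f) + (g - ev (kill P) g) \<in> idl V (Var ` P)"
      using add by (intro ideal_add[OF I]) auto
    ultimately show ?case using add by (metis polys_add)
  next
    case (mult f g)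
    \<comment> \<open>the usual telescoping of a difference of products\<close>
    have "f * g - ev (kill P) (f * g) = f * (g - ev (kill P) g) + ev (kill P) g * (f - ev (kill P) f)"
      by (simp add: ev_mult algebra_simps)
    moreover have "ev (kill P) g \<in> polys V" using mult k by (intro ev_polys[of g V]) auto
    ultimately show ?case using mult ideal_add[OF I] ideal_mult[OF I] by auto
  qed
  show ?thesis
  proof
    assume f: "f \<in> idl V (Var ` P)"
    have "ideal {0} (poly_ring V)" by (rule idealI_poly) auto
    then have "ev (kill P) f \<in> {0}"
      using f sub k by (intro ev_idl[OF f sub]) (auto simp: kill_def)
    then show "f \<in> polys V \<and> ev (kill P) f = 0" using f idl_subset_polys[OF sub] by auto
  next
    assume "f \<in> polys V \<and> ev (kill P) f = 0"
    then show "f \<in> idl V (Var ` P)" using *[of f] by simp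
  qed
qed

text \<open>
  Up to a linear change of coordinates independent linear forms are variables, and variables
  generate the kernel of a substitution. Primality follows at once, as the ring is a domain.
\<close>
lemma exists_kernel_hom:
  fixes A :: "'k::field mpoly set"
  assumes "finite V" "A \<subseteq> lin V" "poly_vs.independent A"
  shows "\<exists>\<rho>. \<forall>f. f \<in> idl V A \<longleftrightarrow> f \<in> polys V \<and> ev \<rho> f = 0"
proof -
  have A: "A \<subseteq> polys V" using assms(2) lin_polys by blast
  obtain P where P: "P \<subseteq> V" "card P = card A"
    using independent_lin_card[OF assms] by (meson obtain_subset_with_card_n)
  obtain \<sigma> \<tau> where st: "poly_aut V \<sigma> \<tau>" "ev \<sigma> ` A = Var ` P"
    using exists_aut_to_Var[OF assms P] by blast
  note img = poly_aut_image_idl[OF st(1) A, unfolded st(2)]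
  have "f \<in> idl V A \<longleftrightarrow> f \<in> polys V \<and> ev (\<lambda>j. ev (kill P) (\<sigma> j)) f = 0" for f
  proof (cases "f \<in> polys V")
    case True
    have "f \<in> idl V A \<longleftrightarrow> ev \<sigma> f \<in> idl V (Var ` P)"
      unfolding img[symmetric] using True inj_on_image_mem_iff[OF poly_aut_inj[OF st(1)] True] idl_subset_polys[OF A]
      by auto
    also have "\<dots> \<longleftrightarrow> ev (kill P) (ev \<sigma> f) = 0"
      using idl_Var_iff[OF P(1)] poly_autD(1)[OF st(1) True] by blast
    finally show ?thesis using True by (simp add: ev_ev[OF True])
  qed (use idl_subset_polys[OF A] in auto)
  then show ?thesis by blast
qed

lemma primeideal_idl_lin:
  fixes A :: "'k::field mpoly set"
  assumes "finite V" "A \<subseteq> lin V" "poly_vs.independent A"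
  shows "primeideal (idl V A) (poly_ring V)"
proof -
  have A: "A \<subseteq> polys V" using assms(2) lin_polys by blast
  obtain \<rho> where \<rho>: "\<And>f. f \<in> idl V A \<longleftrightarrow> f \<in> polys V \<and> ev \<rho> f = 0"
    using exists_kernel_hom[OF assms] by blast
  show ?thesis
  proof (rule primeidealI[OF ideal_idl[OF A] cring_poly_ring])
    have "ev \<rho> 1 = 1" using ev_Const[of \<rho> 1] by simp
    then have "1 \<notin> idl V A" using \<rho> by simp
    then show "polys V \<noteq> idl V A" using polys_one by blast
  qed (auto simp: \<rho> ev_mult)
qed

lemma lin_notin_idl:
  fixes A :: "'k::field mpoly set"
  assumes "finite V" "insert b A \<subseteq> lin V" "poly_vs.independent (insert b A)" "b \<notin> A"
  shows "b \<notin> idl V A"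
proof -
  have bA: "insert b A \<subseteq> polys V" using assms(2) lin_polys by blast
  obtain P where P: "P \<subseteq> V" "card P = card (insert b A)"
    using independent_lin_card[OF assms(1-3)] by (meson obtain_subset_with_card_n)
  obtain \<sigma> \<tau> where st: "poly_aut V \<sigma> \<tau>" "ev \<sigma> ` insert b A = Var ` P"
    using exists_aut_to_Var[OF assms(1-3) P] by blast
  obtain q where q: "q \<in> P" "ev \<sigma> b = Var q" using st(2) by blast
  have "ev \<sigma> b \<notin> ev \<sigma> ` A"
    using inj_on_image_mem_iff[OF poly_aut_inj[OF st(1)], of b A] bA assms(4) by auto
  moreover have "insert (Var q) (ev \<sigma> ` A) = Var ` P" using st(2) q(2) by simp
  ultimately have "ev \<sigma> ` A = Var ` P - {Var q}" using q(2) by (metis Diff_insert_absorb)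
  moreover have "Var ` P - {Var q :: 'k mpoly} = Var ` (P - {q})" by auto
  ultimately have img: "ev \<sigma> ` A = Var ` (P - {q})" by simp
  have "(Var q :: 'k mpoly) \<notin> idl V (Var ` (P - {q}))"
    using idl_Var_iff[of "P - {q}" V "Var q :: 'k mpoly"] P(1) by (simp add: kill_def) blast
  moreover have "ev \<sigma> ` idl V A = idl V (Var ` (P - {q}))"
    using poly_aut_image_idl[OF st(1), of A] bA img by simp
  ultimately show ?thesis using q(2) by (metis imageI)
qed

lemma primeideal_aut_image:
  assumes "poly_aut V \<sigma> \<tau>" "primeideal P (poly_ring V)"
  shows "primeideal (ev \<sigma> ` P) (poly_ring V)"
proof -
  note d = poly_autD[OF assms(1)]
  have P: "ideal P (poly_ring V)" by (rule primeideal.axioms(1)[OF assms(2)])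
  have sub: "f \<in> P \<Longrightarrow> f \<in> polys V" for f by (rule ideal_subset[OF P])
  have mem: "f \<in> ev \<sigma> ` P \<longleftrightarrow> ev \<tau> f \<in> P" if "f \<in> polys V" for f
    using that d sub by (metis imageE imageI)
  have idl: "ideal (ev \<sigma> ` P) (poly_ring V)"
  proof (rule idealI_poly)
    show "ev \<sigma> ` P \<subseteq> polys V" using sub d(1) by auto
    show "0 \<in> ev \<sigma> ` P" using mem[of 0] ideal_zero[OF P] by simp
  next
    fix f g assume "f \<in> ev \<sigma> ` P" "g \<in> ev \<sigma> ` P"
    then show "f + g \<in> ev \<sigma> ` P" using ideal_add[OF P] by (auto simp: ev_add[symmetric])
  next
    fix h f :: "'a mpoly" assume hf: "h \<in> polys V" "f \<in> ev \<sigma> ` P"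
    then have "f \<in> polys V" using sub d(1) by auto
    then show "h * f \<in> ev \<sigma> ` P"
      using hf mem[of f] mem[of "h * f"] ideal_mult[OF P d(2)] by (auto simp: ev_mult)
  qed
  show ?thesis
  proof (rule primeidealI[OF idl cring_poly_ring])
    obtain f where f: "f \<in> polys V" "f \<notin> P"
      using primeideal.I_notcarr[OF assms(2)] sub by blast
    then have "ev \<sigma> f \<notin> ev \<sigma> ` P" using mem[OF d(1)[OF f(1)]] d(4) by simp
    then show "polys V \<noteq> ev \<sigma> ` P" using d(1)[OF f(1)] by blast
    fix f g :: "'a mpoly" assume fg: "f \<in> polys V" "g \<in> polys V" "f \<otimes>\<^bsub>poly_ring V\<^esub> g \<in> ev \<sigma> ` P"
    then have "ev \<tau> f * ev \<tau> g \<in> P" using mem[of "f * g"] by (auto simp: ev_mult)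
    then have "ev \<tau> f \<in> P \<or> ev \<tau> g \<in> P"
      using primeideal.I_prime[OF assms(2)] d(2) fg by (metis poly_ring_simps(1))
    then show "f \<in> ev \<sigma> ` P \<or> g \<in> ev \<sigma> ` P" using mem fg by blast
  qed
qed

lemma dim_over_aut_le:
  assumes "poly_aut V \<sigma> \<tau>"
  shows "dim_over (poly_ring V) I \<le> dim_over (poly_ring V) (ev \<sigma> ` I)"
proof -
  let ?R = "poly_ring V"
  have "\<exists>Q. (\<forall>i\<le>d. primeideal (Q i) ?R \<and> ev \<sigma> ` I \<subseteq> Q i) \<and> (\<forall>i<d. Q i \<subset> Q (Suc i))"
    if P: "\<And>i. i \<le> d \<Longrightarrow> primeideal (P i) ?R" "\<And>i. i \<le> d \<Longrightarrow> I \<subseteq> P i" "\<And>i. i < d \<Longrightarrow> P i \<subset> P (Suc i)" for d :: nat and P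
  proof (intro exI[of _ "\<lambda>i. ev \<sigma> ` P i"] conjI allI impI)
    fix i assume i: "i < d"
    have "P (Suc i) \<subseteq> polys V" "P i \<subseteq> polys V"
      using primeideal.axioms(1)[OF P(1)[of i]] primeideal.axioms(1)[OF P(1)[of "Suc i"]] ideal_subset i by auto
    then show "ev \<sigma> ` P i \<subset> ev \<sigma> ` P (Suc i)"
      using P(3)[OF i] inj_on_image_eq_iff[OF poly_aut_inj[OF assms], of "P i" "P (Suc i)"] by blast
  qed (use P primeideal_aut_image[OF assms] in auto)
  \<comment> \<open>Thus the image of a chain over \<open>I\<close> is a chain over the image of \<open>I\<close>.\<close>
  note push = this
  show ?thesis
    unfolding dim_over_def[of ?R I]
  proof (rule Sup_least)
    fix e assume "e \<in> {enat d |d. \<exists>P. (\<forall>i\<le>d. primeideal (P i) ?R \<and> I \<subseteq> P i) \<and> (\<forall>i<d. P i \<subset> P (Suc i))}"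
    then obtain d P where e: "e = enat d" and
      P: "\<And>i. i \<le> d \<Longrightarrow> primeideal (P i) ?R" "\<And>i. i \<le> d \<Longrightarrow> I \<subseteq> P i" "\<And>i. i < d \<Longrightarrow> P i \<subset> P (Suc i)" by blast
    show "e \<le> dim_over ?R (ev \<sigma> ` I)"
      unfolding dim_over_def e
      by (rule Sup_upper, rule CollectI, rule exI[of _ d], rule conjI[OF refl]) (rule push[of d P, OF P])
  qed
qed

text \<open>
  The right-hand side depends on \<open>A\<close> only through its size, so ideals generated by equally many
  independent linear forms have quotients of the same dimension.
\<close>
lemma dim_over_idl_lin:
  fixes A :: "'k::field mpoly set"
  assumes "finite V" "A \<subseteq> lin V" "poly_vs.independent A" "P \<subseteq> V" "card P = card A"
  shows "dim_over (poly_ring V) (idl V A) = dim_over (poly_ring V) (idl V (Var ` P :: 'k mpoly set))"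
proof -
  have A: "A \<subseteq> polys V" using assms(2) lin_polys by blast
  obtain \<sigma> \<tau> where st: "poly_aut V \<sigma> \<tau>" "ev \<sigma> ` A = Var ` P"
    using exists_aut_to_Var[OF assms] by blast
  note img = poly_aut_image_idl[OF st(1) A, unfolded st(2)]
  have "ev \<tau> ` ev \<sigma> ` idl V A = idl V A"
    unfolding image_image using poly_autD(4)[OF st(1)] idl_subset_polys[OF A] by (auto simp: subset_iff image_iff)
  then show ?thesis
    using dim_over_aut_le[OF st(1), of "idl V A"] dim_over_aut_le[OF poly_aut_sym[OF st(1)], of "ev \<sigma> ` idl V A"]
    unfolding img by simp
qed

section \<open>Star configurations\<close>

text \<open>
  The ring is intersected explicitly: if \<open>c\<close> exceeds the number of forms, there are no subsets
  \<open>J\<close> and the ideal has to be the whole ring, whereas the empty intersection would be the universe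
  of the type. This case does occur among the ideals \<open>C\<close> of the recursion.
\<close>
definition star :: "nat set \<Rightarrow> 'k::field mpoly set \<Rightarrow> nat \<Rightarrow> 'k mpoly set" where
  "star V Z c = polys V \<inter> (\<Inter>J \<in> {J. J \<subseteq> Z \<and> card J = c}. idl V J)"

lemma star_iff: "f \<in> star V Z c \<longleftrightarrow> f \<in> polys V \<and> (\<forall>J. J \<subseteq> Z \<longrightarrow> card J = c \<longrightarrow> f \<in> idl V J)"
  by (auto simp: star_def)

lemma ideal_star:
  assumes "Z \<subseteq> lin V"
  shows "ideal (star V Z c) (poly_ring V)"
proof -
  have I: "ideal (idl V J) (poly_ring V)" if "J \<subseteq> Z" for J
    using that assms lin_polys by (intro ideal_idl) blast
  show ?thesis
    by (rule idealI_poly)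
      (auto simp: star_iff intro: ideal_zero[OF I] ideal_add[OF I] ideal_mult[OF I])
qed

lemma unmixed_star:
  fixes Z :: "'k::field mpoly set"
  assumes "finite V" "Z \<subseteq> lin V" "poly_vs.independent Z"
  shows "unmixed (poly_ring V) (star V Z c)"
proof (cases "c \<le> card Z")
  case False
  have "finite Z" using independent_lin_card[OF assms] by simp
  then have none: "{J. J \<subseteq> Z \<and> card J = c} = {}" using False by (auto dest: card_mono)
  show ?thesis using cring.unmixed_carrier[OF cring_poly_ring, of V] unfolding star_def none by simp
next
  case True
  have Z: "finite Z" "card Z \<le> card V" using independent_lin_card[OF assms] by auto
  let ?F = "idl V ` {J. J \<subseteq> Z \<and> card J = c}"
  obtain J0 where J0: "J0 \<subseteq> Z" "card J0 = c" using True by (meson obtain_subset_with_card_n)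
  obtain P where P: "P \<subseteq> V" "card P = c" using True Z(2) by (meson le_trans obtain_subset_with_card_n)
  have J: "J \<subseteq> lin V" "poly_vs.independent J" if "J \<subseteq> Z" for J
    using that assms poly_vs.independent_mono by auto
  have "unmixed (poly_ring V) (\<Inter>?F)"
  proof (rule cring.unmixed_Inter_primes[OF cring_poly_ring])
    show "finite ?F" using Z(1) by auto
    show "?F \<noteq> {}" using J0 by auto
    show "primeideal Q (poly_ring V)" if "Q \<in> ?F" for Q
      using that primeideal_idl_lin[OF assms(1)] J by auto
    show "dim_over (poly_ring V) Q = dim_over (poly_ring V) (idl V (Var ` P :: 'k mpoly set))" if "Q \<in> ?F" for Q
    proof -
      obtain A where A: "A \<subseteq> Z" "card A = c" "Q = idl V A" using \<open>Q \<in> ?F\<close> by blast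
      show ?thesis unfolding A(3)
        by (rule dim_over_idl_lin[OF assms(1) J(1)[OF A(1)] J(2)[OF A(1)] P(1)]) (simp add: A(2) P(2))
    qed
  qed
  moreover have "idl V J0 \<subseteq> polys V" using J(1)[OF J0(1)] lin_polys by (intro idl_subset_polys) blast
  then have "star V Z c = \<Inter>?F" unfolding star_def using J0 by blast
  ultimately show ?thesis by simp
qed

lemma hom_component_idl:
  assumes "A \<subseteq> lin V" "f \<in> idl V A"
  shows "hom_component e f \<in> idl V A"
proof -
  have A: "A \<subseteq> polys V" using assms(1) lin_polys by blast
  note I = ideal_idl[OF A]
  have "\<forall>e. hom_component e f \<in> idl V A"
    using assms(2) A
  proof (induction f rule: idl_induct)
    case zero
    then show ?case using ideal_zero[OF I] by simp
  next
    case (gen a)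
    have "homogeneous 1 a" using gen assms(1) lin_homogeneous by blast
    then have "hom_component e a = (if 1 \<le> e then hom_component (e - 1) 1 * a else 0)" for e
      using hom_component_mult_homogeneous[of 1 a e 1] by simp
    then show ?case using ideal_mult[OF I hom_component_polys[OF polys_one] idl_memI[OF gen]] ideal_zero[OF I] by auto
  next
    case (add f g)
    then show ?case using ideal_add[OF I] by (simp add: hom_component_add)
  next
    case (mult h f)
    have "hom_component e (h * f) \<in> idl V A" for e
    proof (induction h rule: mpoly_induct)
      case zero
      then show ?case using ideal_zero[OF I] by simp
    next
      case (single m a)
      have s: "sgl m a \<in> polys V" using single mult(1) by (auto simp: polys_iff)
      have "homogeneous (tdeg m) (sgl m a)" by (simp add: homogeneous_def)
      from hom_component_mult_homogeneous[OF this, of e f]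
      have "hom_component e (sgl m a * f) = (if tdeg m \<le> e then sgl m a * hom_component (e - tdeg m) f else 0)"
        by (simp add: mult.commute)
      then show ?case using ideal_mult[OF I s] mult(3) ideal_zero[OF I] by simp
    next
      case (add g h)
      then show ?case using ideal_add[OF I] by (simp add: distrib_right hom_component_add)
    qed
    then show ?case by blast
  qed
  then show ?thesis by blast
qed

lemma hom_component_star: "Z \<subseteq> lin V \<Longrightarrow> f \<in> star V Z c \<Longrightarrow> hom_component e f \<in> star V Z c"
  by (auto simp: star_iff intro!: hom_component_polys hom_component_idl)

lemma idl_insertD:
  assumes "A \<subseteq> polys V" "b \<in> polys V" "f \<in> idl V (insert b A)"
  shows "\<exists>a\<in>idl V A. \<exists>g\<in>polys V. f = a + g * b"
proof -
  note I = ideal_idl[OF assms(1)]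
  have "insert b A \<subseteq> polys V" using assms by auto
  with assms(3) show ?thesis
  proof (induction f rule: idl_induct)
    case zero
    then show ?case using ideal_zero[OF I] by (intro bexI[of _ 0]) auto
  next
    case (gen a)
    then show ?case
    proof
      assume "a = b"
      then show ?case using ideal_zero[OF I] by (intro bexI[of _ 0] bexI[of _ 1]) auto
    next
      assume "a \<in> A"
      then show ?case by (intro bexI[of _ a] bexI[of _ 0]) (auto intro: idl_memI)
    qed
  next
    case (add f g)
    then obtain p q p' q' where "p \<in> idl V A" "q \<in> polys V" "f = p + q * b" "p' \<in> idl V A" "q' \<in> polys V" "g = p' + q' * b"
      by blast
    then show ?case
      by (intro bexI[of _ "p + p'"] bexI[of _ "q + q'"]) (auto simp: algebra_simps ideal_add[OF I])
  next
    case (mult h f)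
    then obtain p q where "p \<in> idl V A" "q \<in> polys V" "f = p + q * b" by blast
    then show ?case using mult(1)
      by (intro bexI[of _ "h * p"] bexI[of _ "h * q"]) (auto simp: algebra_simps ideal_mult[OF I])
  qed
qed

lemma prod_in_primeideal:
  assumes "primeideal P (poly_ring V)" "finite B" "B \<subseteq> polys V" "\<Prod>B \<in> P"
  shows "\<exists>b\<in>B. b \<in> P"
  using assms(2-)
proof (induction B rule: finite_induct)
  case empty
  then have "g \<in> P" if "g \<in> polys V" for g
    using ideal_mult[OF primeideal.axioms(1)[OF assms(1)] that, of 1] by simp
  then show ?case
    using primeideal.I_notcarr[OF assms(1)] ideal_subset[OF primeideal.axioms(1)[OF assms(1)]] by blast
next
  case (insert b B)
  have "\<Prod>B \<in> polys V" using insert.prems by (intro polys_prod) auto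
  then have "b \<in> P \<or> \<Prod>B \<in> P"
    using primeideal.I_prime[OF assms(1), of b "\<Prod>B"] insert by auto
  then show ?case using insert by auto
qed

text \<open>
  Modulo the prime ideal \<open>(A)\<close> the forms of \<open>B\<close> are pairwise non-associated primes, so an element
  divisible by each of them is divisible by their product. The induction removes one form \<open>b\<close> at a
  time: if \<open>f = a + g \<Prod>B\<close>, then \<open>g\<close> must lie in the prime ideal \<open>(A, b)\<close>, which contains none of
  the other forms.
\<close>
lemma mem_all_idl_insert:
  assumes "finite V" "finite B" "A \<subseteq> lin V" "B \<subseteq> lin V" "A \<inter> B = {}"
    and "\<And>S. S \<subseteq> A \<union> B \<Longrightarrow> card S \<le> card A + 2 \<Longrightarrow> poly_vs.independent S"
    and "finite A" "f \<in> polys V" "\<And>b. b \<in> B \<Longrightarrow> f \<in> idl V (insert b A)"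
  shows "\<exists>a\<in>idl V A. \<exists>g\<in>polys V. f = a + g * \<Prod>B"
  using assms(2,4-6,9)
proof (induction B rule: finite_induct)
  case empty
  have "0 \<in> idl V A" using assms(3) lin_polys by (intro ideal_zero[OF ideal_idl]) blast
  then show ?case using assms(8) by (intro bexI[of _ 0] bexI[of _ f]) auto
next
  case (insert b B)
  have A: "A \<subseteq> polys V" and bp: "b \<in> polys V" and B: "B \<subseteq> polys V"
    using assms(3) insert.prems(1) lin_polys by blast+
  note I = ideal_idl[OF A]
  have "\<exists>a\<in>idl V A. \<exists>g\<in>polys V. f = a + g * \<Prod>B"
    using insert.prems by (intro insert.IH) auto
  then obtain a g where ag: "a \<in> idl V A" "g \<in> polys V" "f = a + g * \<Prod>B" by blast
  have bA: "insert b A \<subseteq> lin V" using insert.prems assms(3) by auto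
  have "card (insert b A) \<le> card A + 2" using card_insert_le_m1[of "card A + 2" A b] by simp
  then have ind: "poly_vs.independent (insert b A)" by (intro insert.prems(3)) auto
  note pr = primeideal_idl_lin[OF assms(1) bA ind]
  have "b' \<notin> idl V (insert b A)" if b': "b' \<in> B" for b'
  proof (rule lin_notin_idl[OF assms(1)])
    have "card (insert b' (insert b A)) \<le> card A + 2"
      using assms(7) by (simp add: card_insert_if)
    then show "poly_vs.independent (insert b' (insert b A))"
      by (intro insert.prems(3)) (use b' in auto)
  qed (use insert b' bA in auto)
  then have np: "\<Prod>B \<notin> idl V (insert b A)" using prod_in_primeideal[OF pr insert.hyps(1) B] by blast
  have "a \<in> idl V (insert b A)" using ag(1) idl_mono[of A "insert b A" V] by blast
  then have "f - a \<in> idl V (insert b A)" using ideal_diff[OF primeideal.axioms(1)[OF pr]] insert.prems(4) by blast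
  then have "g * \<Prod>B \<in> idl V (insert b A)" using ag(3) by simp
  moreover have "\<Prod>B \<in> polys V" using B by (intro polys_prod) auto
  ultimately have "g \<in> idl V (insert b A)"
    using primeideal.I_prime[OF pr ag(2), of "\<Prod>B"] np by auto
  then obtain a' h where ah: "a' \<in> idl V A" "h \<in> polys V" "g = a' + h * b"
    using idl_insertD[OF A bp] by blast
  have "f = (a + \<Prod>B * a') + h * \<Prod>(insert b B)"
    using ag(3) ah(3) insert.hyps by (simp add: algebra_simps)
  moreover have "a + \<Prod>B * a' \<in> idl V A"
    using ag(1) ah(1) \<open>\<Prod>B \<in> polys V\<close> ideal_add[OF I] ideal_mult[OF I] by blast
  ultimately show ?case using ah(2) by blast
qed

lemma idl_empty: "idl V {} = {0}"
proof -
  have "ideal {0} (poly_ring V)" by (rule idealI_poly) auto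
  then have "idl V {} \<subseteq> {0}" by (rule idl_minimal) simp
  moreover have "0 \<in> idl V {}" by (rule ideal_zero[OF ideal_idl]) simp
  ultimately show ?thesis by auto
qed

lemma star_zero: "star V Z 0 = {0}" if "finite Z"
proof -
  have "{J. J \<subseteq> Z \<and> card J = 0} = {{}}" using that finite_subset by fastforce
  then show ?thesis by (simp add: star_def idl_empty)
qed

text \<open>
  By induction on \<open>c\<close>. The ideal is homogeneous, so consider a homogeneous element \<open>f\<close> of too small
  a degree. For each \<open>A \<subseteq> Z\<close> of size \<open>c - 1\<close>, \<open>f\<close> lies in \<open>(A, b)\<close> for all
  \<open>b \<in> Z - A\<close>, hence in \<open>(A) + (\<Prod>(Z - A))\<close>, and for degree reasons in \<open>(A)\<close>. So \<open>f\<close> already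
  belongs to the star ideal of the next smaller codimension, and finally to the zero ideal.
\<close>
lemma star_min_degree:
  assumes "finite V" "finite Z" "Z \<subseteq> lin V"
    and "\<And>S. S \<subseteq> Z \<Longrightarrow> card S \<le> c + 1 \<Longrightarrow> poly_vs.independent S"
    and "f \<in> star V Z c" "m \<in> mkeys f"
  shows "card Z < tdeg m + c"
  using assms(4-)
proof (induction c arbitrary: f)
  case 0
  then show ?case using star_zero[OF assms(2)] by auto
next
  case (Suc c)
  show ?case
  proof (rule ccontr)
    let ?e = "tdeg m"
    assume "\<not> card Z < ?e + Suc c"
    then have le: "?e + Suc c \<le> card Z" by simp
    let ?f = "hom_component ?e f"
    have fs: "?f \<in> star V Z (Suc c)" by (rule hom_component_star[OF assms(3) Suc.prems(2)])
    have "?f \<in> idl V A" if A: "A \<subseteq> Z" "card A = c" for A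
    proof -
      have finA: "finite A" using A(1) assms(2) finite_subset by blast
      have "\<exists>a\<in>idl V A. \<exists>g\<in>polys V. ?f = a + g * \<Prod>(Z - A)"
      proof (rule mem_all_idl_insert[OF assms(1)])
        show "poly_vs.independent S" if "S \<subseteq> A \<union> (Z - A)" "card S \<le> card A + 2" for S
          using Suc.prems(1)[of S] that A by auto
        show "?f \<in> idl V (insert b A)" if "b \<in> Z - A" for b
          using fs that A finA by (auto simp: star_iff)
        show "?f \<in> polys V" using fs by (simp add: star_iff)
      qed (use A assms finA in auto)
      then obtain a g where ag: "a \<in> idl V A" "g \<in> polys V" "?f = a + g * \<Prod>(Z - A)" by blast
      have cB: "card (Z - A) = card Z - c" using A finA by (simp add: card_Diff_subset)
      have "homogeneous (card (Z - A)) (\<Prod>(Z - A))"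
        using assms(2,3) lin_homogeneous by (intro homogeneous_prod) auto
      moreover have "\<not> card (Z - A) \<le> ?e" using le cB by linarith
      ultimately have "hom_component ?e (g * \<Prod>(Z - A)) = 0"
        using hom_component_mult_homogeneous[of "card (Z - A)" "\<Prod>(Z - A)" ?e g] by simp
      then have "?f = hom_component ?e a" using arg_cong[OF ag(3), of "hom_component ?e"] by (simp add: hom_component_add hom_component_hom_component)
      then show ?thesis using hom_component_idl[of A V a ?e] ag(1) A(1) assms(3) by auto
    qed
    then have "?f \<in> star V Z c" using fs by (auto simp: star_iff)
    moreover have "m \<in> mkeys ?f" using Suc.prems(3) by (simp add: keys_hom_component)
    ultimately have "card Z < ?e + c" using Suc.IH[of ?f] Suc.prems(1) by auto
    then show False using le by simp
  qed
qed

text \<open>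
  By the pigeonhole principle \<open>K\<close> meets every \<open>c\<close>-subset of \<open>Z\<close>.
\<close>
lemma prod_in_star:
  assumes "finite Z" "Z \<subseteq> lin V" "K \<subseteq> Z" "card Z < card K + c"
  shows "\<Prod>K \<in> star V Z c"
  unfolding star_iff
proof (intro conjI allI impI)
  have Kp: "K \<subseteq> polys V" using assms lin_polys by blast
  show "\<Prod>K \<in> polys V" using Kp by (intro polys_prod) auto
  have finK: "finite K" using assms finite_subset by blast
  fix J assume J: "J \<subseteq> Z" "card J = c"
  have "J \<inter> K \<noteq> {}"
  proof
    assume "J \<inter> K = {}"
    then have "card (J \<union> K) = c + card K"
      using J assms finK finite_subset by (metis card_Un_disjoint)
    moreover have "card (J \<union> K) \<le> card Z" using J assms by (intro card_mono) auto
    ultimately show False using assms(4) by simp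
  qed
  then obtain b where b: "b \<in> J" "b \<in> K" by blast
  have "\<Prod>K = \<Prod>(K - {b}) * b" using prod.remove[OF finK b(2), of "\<lambda>x. x"] by (simp add: mult.commute)
  moreover have "\<Prod>(K - {b}) \<in> polys V" using Kp by (intro polys_prod) auto
  moreover have "ideal (idl V J) (poly_ring V)" using J(1) assms(2) lin_polys by (intro ideal_idl) blast
  ultimately show "\<Prod>K \<in> idl V J" using ideal_mult idl_memI[OF b(1)] by metis
qed

lemma init_y_ideal_min_degree:
  assumes "ideal I (poly_ring V)" "y \<in> V" "\<And>f m. f \<in> I \<Longrightarrow> m \<in> mkeys f \<Longrightarrow> d \<le> tdeg m"
    and "p \<in> init_y_ideal V y I" "m \<in> mkeys p"
  shows "d \<le> tdeg m"
proof -
  have "init_y y ` I \<subseteq> polys V" using ideal_subset[OF assms(1)] init_y_polys assms(2) by blast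
  with assms(4)[unfolded init_y_ideal_def] have "\<forall>m\<in>mkeys p. d \<le> tdeg m"
  proof (induction p rule: idl_induct)
    case (gen a)
    then obtain f where f: "f \<in> I" "a = init_y y f" by blast
    have "mkeys (init_y y f) \<subseteq> mkeys f" by (auto simp: in_keys_iff lookup_init_y split: if_splits)
    then show ?case using assms(3) f by blast
  next
    case (add f g)
    then show ?case using Poly_Mapping.keys_add[of f g] by blast
  next
    case (mult h f)
    show ?case
    proof
      fix m assume "m \<in> mkeys (h * f)"
      then obtain a b where "m = a + b" "b \<in> mkeys f" using keys_mult by blast
      then show "d \<le> tdeg m" using mult by (simp add: trans_le_add2)
    qed
  qed auto
  then show ?thesis using assms(5) by blast
qed

section \<open>Decomposing a star configuration at a variable\<close>

text \<open>
  With \<open>d = |Z| - c + 1\<close>, the product of \<open>d\<close> forms including \<open>z1\<close> and \<open>z2\<close> is homogeneous of degree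
  \<open>d\<close> and has degree at least two in \<open>y\<close>; its leading coefficient is therefore too small in degree
  for \<open>y\<close> times it to lie in \<open>in\<^sub>y(I)\<close>. From \<open>c < |Z|\<close> one gets
  \<open>d \<ge> 2\<close>, room for both forms, and from \<open>1 \<le> c\<close> that \<open>Z\<close> has \<open>d\<close> elements to choose.
\<close>
lemma two_forms_no_decomp:
  assumes "finite V" "y \<in> V" "finite Z" "Z \<subseteq> lin V"
    and "\<And>S. S \<subseteq> Z \<Longrightarrow> card S \<le> c + 1 \<Longrightarrow> poly_vs.independent S"
    and "1 \<le> c" "c < card Z"
    and "z1 \<in> Z" "z2 \<in> Z" "z1 \<noteq> z2" "lcoeff z1 y \<noteq> 0" "lcoeff z2 y \<noteq> 0"
  shows "\<not> geom_vertex_decomp V y (star V Z c) C N"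
proof
  assume gvd: "geom_vertex_decomp V y (star V Z c) C N"
  let ?d = "card Z - c + 1" and ?I = "star V Z c"
  have I: "ideal ?I (poly_ring V)" by (rule ideal_star[OF assms(4)])
  have "card (Z - {z1, z2}) = card Z - 2" using assms by (simp add: card_Diff_subset)
  then have "?d - 2 \<le> card (Z - {z1, z2})" using assms(6) by linarith
  then obtain K where K: "K \<subseteq> Z - {z1, z2}" "card K = ?d - 2" by (meson obtain_subset_with_card_n)
  have finK: "finite K" using K(1) assms(3) finite_subset by blast
  let ?K = "insert z1 (insert z2 K)"
  \<comment> \<open>Together with the two chosen forms there are exactly \<open>d\<close> factors, so the product lies in the ideal.\<close>
  have cK: "card ?K = ?d"
  proof -
    have "z1 \<notin> insert z2 K" "z2 \<notin> K" using K(1) assms(10) by auto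
    then have "card ?K = card K + 2" using finK by simp
    then show ?thesis using K(2) assms(7) by linarith
  qed
  have nz: "b \<noteq> 0" if "b \<in> Z" for b
    using assms(5)[of "{b}"] that poly_vs.dependent_zero by fastforce
  let ?h = "\<Prod>K"
  have h: "?h \<noteq> 0" using nz K(1) finK by (auto simp: prod_zero_iff)
  let ?f = "\<Prod>?K"
  have "z1 \<notin> insert z2 K" "z2 \<notin> K" using K(1) assms(10) by auto
  then have f_eq: "?f = z1 * (z2 * ?h)" using finK by simp
  have fI: "?f \<in> ?I" using cK K(1) assms by (intro prod_in_star) auto
  have fh: "homogeneous ?d ?f"
    unfolding cK[symmetric] using K(1) finK assms(4,8,9) lin_homogeneous by (intro homogeneous_prod) blast+
  obtain w1 where w1: "w1 \<in> lin (V - {y})" "z1 = Const (lcoeff z1 y) * Var y + w1"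
    using lin_split[of z1 V y] assms by blast
  obtain w2 where w2: "w2 \<in> lin (V - {y})" "z2 = Const (lcoeff z2 y) * Var y + w2"
    using lin_split[of z2 V y] assms by blast
  have w: "w1 \<in> polys (V - {y})" "w2 \<in> polys (V - {y})" using w1 w2 lin_polys by blast+
  have "ydeg y (z2 * ?h) = Suc (ydeg y ?h)"
    using ydeg_linear_mult(1)[OF w(2) assms(12) h] w2(2) by simp
  moreover have "z2 * ?h \<noteq> 0" using nz[OF assms(9)] h by simp
  then have "ydeg y ?f = Suc (ydeg y (z2 * ?h))"
    using ydeg_linear_mult(1)[OF w(1) assms(11)] w1(2) f_eq by metis
  ultimately have deg: "ydeg y ?f \<ge> 2" by simp
  have "?f \<noteq> 0" using nz[OF assms(8)] \<open>z2 * ?h \<noteq> 0\<close> f_eq by simp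
  then have "mkeys (ylead y ?f) \<noteq> {}" using ylead_nonzero[of ?f y] by simp
  then obtain m where m: "m \<in> mkeys (ylead y ?f)" by blast
  have m1: "m + sgl y (ydeg y ?f) \<in> mkeys ?f" using m by (simp add: ylead_def keys_ycoeff)
  have "tdeg m + ydeg y ?f = ?d" using fh m1 unfolding homogeneous_def by fastforce
  moreover have "?d \<le> tdeg m + 1"
  proof -
    have "m + sgl y 1 - sgl y 1 = m" by simp
    then have "m + sgl y 1 \<in> mkeys (Var y * ylead y ?f)"
      using m by (simp add: in_keys_iff Var_def lookup_single_mult lookup_add)
    from init_y_ideal_min_degree[OF I assms(2) _ geom_vertex_decomp_init[OF gvd I assms(2) fI] this, of ?d]
    have "(\<And>f m. f \<in> ?I \<Longrightarrow> m \<in> mkeys f \<Longrightarrow> ?d \<le> tdeg m) \<Longrightarrow> ?d \<le> tdeg (m + sgl y 1)" by blast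
    moreover have "?d \<le> tdeg m" if "f \<in> ?I" "m \<in> mkeys f" for f m
    proof -
      have "card Z < tdeg m + c" by (rule star_min_degree[OF assms(1,3,4) _ that]) (rule assms(5))
      then show ?thesis using assms(7) by linarith
    qed
    ultimately show ?thesis by simp
  qed
  ultimately show False using deg by linarith
qed

lemma idl_contraction_remove:
  assumes "A \<subseteq> lin (V - {y})" "y \<in> V" "f \<in> polys (V - {y})"
  shows "f \<in> idl V A \<longleftrightarrow> f \<in> idl (V - {y}) A"
proof -
  have "A \<subseteq> polys (V - {y})" using assms(1) lin_polys by blast
  from idl_contraction[OF this assms(2)] show ?thesis using assms(3) by blast
qed

text \<open>
  Solving \<open>z = 0\<close> for \<open>y\<close> gives a substitution that kills \<open>z\<close> and fixes everything free of \<open>y\<close>.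
\<close>
lemma idl_contraction_eliminate:
  assumes "A \<subseteq> lin (V - {y})" "z \<in> lin V" "y \<in> V" "lcoeff z y \<noteq> 0" "f \<in> polys (V - {y})"
    and "f \<in> idl V (insert z A)"
  shows "f \<in> idl (V - {y}) A"
proof -
  obtain w where w: "w \<in> lin (V - {y})" "z = Const (lcoeff z y) * Var y + w"
    using lin_split assms(2,3) by blast
  \<comment> \<open>\<open>z = a y + w\<close> vanishes at \<open>y = - w / a\<close>.\<close>
  define \<sigma> where "\<sigma> j = (if j = y then Const (- inverse (lcoeff z y)) * w else Var j)" for j
  have wp: "w \<in> polys (V - {y})" and A: "A \<subseteq> polys (V - {y})" using w(1) assms(1) lin_polys by blast+
  have id: "ev \<sigma> g = g" if "g \<in> polys (V - {y})" for g
    by (rule ev_id[OF that]) (auto simp: \<sigma>_def)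
  have zp: "insert z A \<subseteq> polys V" using assms(2) lin_polys A polys_mono[of _ "V - {y}" V] by blast
  note I = ideal_idl[OF A]
  have "ev \<sigma> f \<in> idl (V - {y}) A"
  proof (rule ev_idl[OF assms(6) zp _ I])
    show "\<sigma> j \<in> polys (V - {y})" if "j \<in> V" for j
      using that wp unfolding \<sigma>_def by (cases "j = y") (simp_all only: if_True if_False polys_mult polys_Const polys_Var Diff_iff singleton_iff simp_thms)
    fix a assume "a \<in> insert z A"
    then show "ev \<sigma> a \<in> idl (V - {y}) A"
    proof
      assume a: "a = z"
      have "ev \<sigma> z = Const (lcoeff z y) * (Const (- inverse (lcoeff z y)) * w) + w"
        by (subst w(2)) (simp add: ev_add ev_mult id[OF wp] \<sigma>_def)
      also have "\<dots> = Const (lcoeff z y * - inverse (lcoeff z y)) * w + w"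
        by (simp only: Const_mult mult.assoc)
      also have "\<dots> = 0" using assms(4) by (simp add: Const_uminus)
      finally show ?thesis using ideal_zero[OF I] a by simp
    next
      assume a: "a \<in> A"
      then have "ev \<sigma> a = a" using A by (intro id) blast
      then show ?thesis using idl_memI[OF a] by simp
    qed
  qed
  then show ?thesis using id[OF assms(5)] by simp
qed

lemma star_contraction_unused:
  assumes "Z \<subseteq> lin (V - {y})" "y \<in> V"
  shows "star V Z c \<inter> polys (V - {y}) = star (V - {y}) Z c"
proof -
  have "f \<in> idl V J \<longleftrightarrow> f \<in> idl (V - {y}) J" if "J \<subseteq> Z" "f \<in> polys (V - {y})" for f J
    using idl_contraction_remove[of J V y f] that assms by blast
  then show ?thesis using polys_mono[of _ "V - {y}" V] by (auto simp: star_iff)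
qed

text \<open>
  The situation of a variable \<open>y\<close> that occurs in \<open>z\<close> and in none of the other forms \<open>Z\<close>.
\<close>
context
  fixes V :: "nat set" and y :: nat and z :: "'k::field mpoly" and Z :: "'k mpoly set"
  assumes y: "y \<in> V" and z: "z \<in> lin V" "lcoeff z y \<noteq> 0" and Z: "Z \<subseteq> lin (V - {y})" "finite Z"
begin

lemma z_notin: "z \<notin> Z"
  using Z(1) z(2) lin_polys polys_lcoeff_zero by blast

lemma insert_lin: "insert z Z \<subseteq> lin V"
  using z(1) Z(1) lin_mono[of "V - {y}" V] by blast

text \<open>
  For \<open>J\<close> containing \<open>z\<close>, the contraction of \<open>(J)\<close> is \<open>(J - {z})\<close>, and every \<open>c\<close>-subset of \<open>Z\<close>
  arises in this way. The sets \<open>J\<close> without \<open>z\<close> impose weaker conditions, since they contain such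
  subsets.
\<close>
lemma star_contraction_single:
  "star V (insert z Z) (Suc c) \<inter> polys (V - {y}) = star (V - {y}) Z c"
proof (rule subset_antisym; rule subsetI)
  fix f assume f: "f \<in> star V (insert z Z) (Suc c) \<inter> polys (V - {y})"
  have "f \<in> idl (V - {y}) J" if J: "J \<subseteq> Z" "card J = c" for J
  proof -
    have "finite J" "z \<notin> J" using J(1) Z(2) z_notin finite_subset by blast+
    then have "card (insert z J) = Suc c" using J(2) by simp
    then have "f \<in> idl V (insert z J)" using f J(1) star_iff[of f V "insert z Z" "Suc c"] by blast
    then show ?thesis using idl_contraction_eliminate[of J V y z f] J(1) Z(1) z y f by blast
  qed
  then show "f \<in> star (V - {y}) Z c" using f by (auto simp: star_iff)
next
  fix f assume f: "f \<in> star (V - {y}) Z c"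
  then have fp: "f \<in> polys (V - {y})" by (simp add: star_iff)
  have "f \<in> idl V J" if J: "J \<subseteq> insert z Z" "card J = Suc c" for J
  proof -
    have "c \<le> card (J - {z})" using J(2) by (cases "z \<in> J") (auto simp: card_Diff_singleton_if)
    then obtain J' where J': "J' \<subseteq> J - {z}" "card J' = c" by (meson obtain_subset_with_card_n)
    then have "J' \<subseteq> Z" using J(1) by auto
    then have "f \<in> idl (V - {y}) J'" using f J'(2) by (simp add: star_iff)
    then have "f \<in> idl V J'" using idl_contraction_remove[of J' V y f] \<open>J' \<subseteq> Z\<close> Z(1) y fp by blast
    then show ?thesis using idl_mono[of J' J V] J'(1) by blast
  qed
  then show "f \<in> star V (insert z Z) (Suc c) \<inter> polys (V - {y})"
    using fp polys_mono[of f "V - {y}" V] by (auto simp: star_iff)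
qed

text \<open>
  The ideals \<open>(J)\<close> with \<open>J \<subseteq> Z\<close> are extended from the ring without \<open>y\<close>, so they contain all
  coefficients of their elements.
\<close>
lemma ylead_in_star:
  assumes "f \<in> star V (insert z Z) c"
  shows "ylead y f \<in> star (V - {y}) Z c"
proof -
  have "ylead y f \<in> idl (V - {y}) J" if "J \<subseteq> Z" "card J = c" for J
  proof -
    have "f \<in> idl V J" using assms that by (auto simp: star_iff)
    moreover have "J \<subseteq> polys (V - {y})" using that Z(1) lin_polys by blast
    ultimately show ?thesis using idl_extension_iff[of J V y f] y unfolding ylead_def by blast
  qed
  then show ?thesis using assms ylead_polys[of f V y] by (simp add: star_iff)
qed

text \<open>
  The factor \<open>z\<close> takes care of the sets \<open>J\<close> containing \<open>z\<close>, and \<open>g\<close> of the others.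
\<close>
lemma mult_in_star:
  assumes "g \<in> star (V - {y}) Z c"
  shows "z * g \<in> star V (insert z Z) c"
proof -
  have gp: "g \<in> polys (V - {y})" using assms by (simp add: star_iff)
  have gV: "g \<in> polys V" using gp polys_mono[of g "V - {y}" V] by blast
  have zV: "z \<in> polys V" using z(1) lin_polys by blast
  have "z * g \<in> idl V J" if J: "J \<subseteq> insert z Z" "card J = c" for J
  proof -
    have I: "ideal (idl V J) (poly_ring V)"
      using J(1) insert_lin lin_polys by (intro ideal_idl) blast
    show ?thesis
    proof (cases "z \<in> J")
      case True
      then show ?thesis using ideal_mult[OF I gV idl_memI[OF True]] by (simp add: mult.commute)
    next
      case False
      then have "J \<subseteq> Z" using J(1) by auto
      then have "g \<in> idl (V - {y}) J" using assms J(2) by (simp add: star_iff)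
      then have "g \<in> idl V J" using idl_contraction_remove[of J V y g] \<open>J \<subseteq> Z\<close> Z(1) y gp by blast
      then show ?thesis using ideal_mult[OF I zV] by blast
    qed
  qed
  then show ?thesis using gV zV by (auto simp: star_iff)
qed

text \<open>
  One inclusion is \<open>ylead_in_star\<close>. Conversely, \<open>g\<close> is, up to a scalar, the leading coefficient
  of \<open>z g\<close>.
\<close>
lemma idl_ylead_star:
  "idl (V - {y}) (ylead y ` star V (insert z Z) c) = star (V - {y}) Z c"
proof
  show "idl (V - {y}) (ylead y ` star V (insert z Z) c) \<subseteq> star (V - {y}) Z c"
    using ylead_in_star by (intro idl_minimal[OF ideal_star[OF Z(1)]]) blast
  let ?C = "idl (V - {y}) (ylead y ` star V (insert z Z) c)"
  have C: "ideal ?C (poly_ring (V - {y}))"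
    using ylead_polys by (intro ideal_idl) (auto simp: star_iff)
  obtain w where w: "w \<in> lin (V - {y})" "z = Const (lcoeff z y) * Var y + w"
    using lin_split z(1) y by blast
  have wp: "w \<in> polys (V - {y})" using w(1) lin_polys by blast
  show "star (V - {y}) Z c \<subseteq> ?C"
  proof
    fix g assume g: "g \<in> star (V - {y}) Z c"
    show "g \<in> ?C"
    proof (cases "g = 0")
      case False
      have "ylead y (z * g) = Const (lcoeff z y) * g"
        using ydeg_linear_mult(2)[OF wp z(2) False] w(2) ylead_free[of g V y] g by (simp add: star_iff)
      moreover have "ylead y (z * g) \<in> ?C" using mult_in_star[OF g] by (intro idl_memI) blast
      ultimately have "Const (inverse (lcoeff z y)) * (Const (lcoeff z y) * g) \<in> ?C"
        using ideal_mult[OF C polys_Const] by metis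
      then show ?thesis by (simp only: Const_inverse[OF z(2)])
    qed (use ideal_zero[OF C] in simp)
  qed
qed

end

section \<open>Triangulable sets of linear forms\<close>

text \<open>
  The forms can be removed one at a time, each together with a variable that occurs in it but in
  none of the remaining forms: up to the order of rows and columns, the coefficient matrix is in
  echelon form already.
\<close>
inductive triangulable :: "'k::field mpoly set \<Rightarrow> bool" where
  empty: "triangulable {}"
| insert: "lcoeff z y \<noteq> 0 \<Longrightarrow> \<forall>z'\<in>Z. lcoeff z' y = 0 \<Longrightarrow> triangulable Z \<Longrightarrow> triangulable (insert z Z)"

lemma triangulable_finite: "triangulable Z \<Longrightarrow> finite Z"
  by (induction rule: triangulable.induct) auto

lemma lcoeff_zero_subspace: "poly_vs.subspace {f. lcoeff f y = 0}"
  by (auto simp: poly_vs.subspace_def lookup_add lookup_Const_mult)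

lemma triangulable_independent: "triangulable Z \<Longrightarrow> poly_vs.independent Z"
proof (induction rule: triangulable.induct)
  case empty
  show ?case by (rule poly_vs.independent_empty)
next
  case (insert z y Z)
  have "poly_vs.span Z \<subseteq> {f. lcoeff f y = 0}"
    using insert(2) by (intro poly_vs.span_minimal[OF _ lcoeff_zero_subspace]) auto
  then have "z \<notin> poly_vs.span Z" using insert(1) by blast
  then show ?case using insert(4) by (rule poly_vs.independent_insertI)
qed

lemma lin_coeff_index: "z \<in> lin V \<Longrightarrow> lcoeff z y \<noteq> 0 \<Longrightarrow> y \<in> V"
proof -
  assume z: "z \<in> lin V" "lcoeff z y \<noteq> 0"
  then obtain j where "j \<in> V" "sgl y (1::nat) = sgl j 1"
    using lin_keys[of z V "sgl y 1"] by (auto simp: in_keys_iff)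
  then have "y = j" by (metis keys_single singleton_inject zero_neq_one)
  then show "y \<in> V" using \<open>j \<in> V\<close> by simp
qed

text \<open>
  Decompose at the variable \<open>y\<close> belonging to the form \<open>z\<close> that was inserted last. All \<open>c\<close> are needed
  at once, because \<open>N\<close> lowers the codimension and \<open>C\<close> does not; the induction ends at \<open>c = 0\<close>, where
  the ideal is zero, or with no forms left, where it is the whole ring.
\<close>
lemma triangulable_imp_gvd:
  assumes "triangulable Z" "finite V" "Z \<subseteq> lin V"
  shows "gvd_ideal V (star V Z c)"
  using assms
proof (induction arbitrary: V c rule: triangulable.induct)
  case empty
  note I = ideal_star[OF empty(2)] and U = unmixed_star[OF empty poly_vs.independent_empty]
  show ?case
  proof (cases c)
    case 0
    have "star V {} 0 = idl V (Var ` {} :: 'a mpoly set)" by (simp add: star_zero idl_empty)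
    then show ?thesis using gvd_ideal.variables[OF I U, of "{}"] 0 by auto
  next
    case (Suc c')
    then have none: "{J :: 'a mpoly set. J \<subseteq> {} \<and> card J = c} = {}" by auto
    have "star V ({} :: 'a mpoly set) c = polys V" unfolding star_def none by simp
    then show ?thesis by (rule gvd_ideal.unit[OF I U])
  qed
next
  case (insert z y Z)
  have tri: "triangulable (insert z Z)" by (rule triangulable.insert[OF insert(1-3)])
  have fin: "finite Z" using triangulable_finite[OF tri] by simp
  note I = ideal_star[OF insert(6)]
    and U = unmixed_star[OF insert(5,6) triangulable_independent[OF tri]]
  show ?case
  proof (cases c)
    case 0
    have "star V (insert z Z) 0 = idl V (Var ` {} :: 'a mpoly set)" using fin by (simp add: star_zero idl_empty)
    then show ?thesis using gvd_ideal.variables[OF I U, of "{}"] 0 by auto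
  next
    case (Suc c')
    let ?S = "V - {y}"
    have zl: "z \<in> lin V" using insert(6) by simp
    have y: "y \<in> V" by (rule lin_coeff_index[OF zl insert(1)])
    have Zl: "Z \<subseteq> lin ?S" using insert(2,6) lin_remove_iff[of _ V y] by auto
    note ctx = y zl insert(1) Zl fin
    obtain w where w: "w \<in> lin ?S" "z = Const (lcoeff z y) * Var y + w" using lin_split[OF zl y] by blast
    have wp: "w \<in> polys ?S" using w(1) lin_polys by blast
    have "\<exists>C N. geom_vertex_decomp V y (star V (insert z Z) c) C N"
    proof (rule geom_vertex_decompI[OF insert(5) y I insert(1) wp])
      fix f assume "f \<in> star V (insert z Z) c"
      then have "z * ylead y f \<in> star V (insert z Z) c"
        by (intro mult_in_star[OF ctx] ylead_in_star[OF ctx])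
      then show "(Const (lcoeff z y) * Var y + w) * ylead y f \<in> star V (insert z Z) c"
        using w(2) by simp
    qed
    then obtain C N where CN: "geom_vertex_decomp V y (star V (insert z Z) c) C N" by blast
    then have "CN_ideals V y (star V (insert z Z) c) C N" by (simp add: geom_vertex_decomp_def)
    note con = CN_contractions[OF this I y]
    have "C \<inter> polys ?S = star ?S Z c" unfolding con by (rule idl_ylead_star[OF ctx])
    moreover have "N \<inter> polys ?S = star ?S Z c'"
      unfolding con Suc by (rule star_contraction_single[OF ctx])
    moreover have "finite ?S" using insert(5) by simp
    ultimately show ?thesis
      using insert.IH[OF _ Zl] by (intro gvd_ideal.decomposition[OF I U y CN]) simp_all
  qed
qed

context
  fixes V :: "nat set" and Z :: "'k::field mpoly set" and c :: nat
  assumes fin: "finite V" "finite Z" and lin: "Z \<subseteq> lin V"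
    and gen: "\<And>S. S \<subseteq> Z \<Longrightarrow> card S \<le> c + 1 \<Longrightarrow> poly_vs.independent S"
    and c: "1 \<le> c" "c < card Z"
begin

text \<open>
  The constant \<open>1\<close> has degree below the minimal degree \<open>|Z| - c + 1\<close>.
\<close>
lemma star_not_unit: "star V Z c \<noteq> polys V"
proof
  assume "star V Z c = polys V"
  then have "1 \<in> star V Z c" by simp
  from star_min_degree[OF fin lin gen this, of 0] c show False by simp
qed

text \<open>
  A variable has degree one, below the minimal degree \<open>|Z| - c + 1 \<ge> 2\<close>; and the ideal is not zero,
  as it contains the product of all forms.
\<close>
lemma star_not_variables: "star V Z c \<noteq> idl V (Var ` W)"
proof
  assume eq: "star V Z c = idl V (Var ` W)"
  show False
  proof (cases "W = {}")
    case True
    have "\<Prod>Z \<in> star V Z c" using c by (intro prod_in_star fin lin) auto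
    then have "\<Prod>Z = 0" using eq True by (simp add: idl_empty)
    then have "0 \<in> Z" using fin(2) by (simp add: prod_zero_iff)
    then show False using gen[of "{0}"] poly_vs.dependent_zero[of "{0 :: 'k mpoly}"] by simp
  next
    case False
    then obtain w where "w \<in> W" by blast
    then have "Var w \<in> star V Z c" unfolding eq by (intro idl_memI) simp
    from star_min_degree[OF fin lin gen this, of "sgl w 1"] c show False by (simp add: Var_def)
  qed
qed

end

text \<open>
  The base cases are excluded by degree, and in the recursive case \<open>y\<close> occurs in at most one form.
  If it occurs in none, \<open>N\<close> is the same star ideal in fewer variables. If it occurs in \<open>z\<close>, one of \<open>C\<close> and \<open>N\<close> shows that \<open>Z - {z}\<close> is triangulable: \<open>C\<close> as long as
  \<open>c\<close> stays below the number of remaining forms, and \<open>N\<close>, of codimension \<open>c - 1\<close>, when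
  \<open>c = |Z| - 1\<close>, unless \<open>c = 1\<close>. In the last case a single form remains.
\<close>
lemma gvd_imp_triangulable:
  assumes "gvd_ideal V I" "finite V" "Z \<subseteq> lin V" "poly_vs.independent Z"
    and "1 \<le> c" "c < card Z" "I = star V Z c"
  shows "triangulable (Z :: 'k::field mpoly set)"
  using assms
proof (induction arbitrary: Z c rule: gvd_ideal.induct)
  case (unit I V)
  have "finite Z" using independent_lin_card[OF unit(4-6)] by simp
  then show ?case using star_not_unit[of V Z c] unit poly_vs.independent_mono by metis
next
  case (variables I V W)
  have "finite Z" using independent_lin_card[OF variables(5-7)] by simp
  then show ?case using star_not_variables[of V Z c W] variables poly_vs.independent_mono by metis
next
  case (decomposition I V y C N)
  let ?S = "V - {y}"
  note finV = decomposition(9) and Zl = decomposition(10) and ind = decomposition(11)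
    and c = decomposition(12,13) and I_eq = decomposition(14)
  have finZ: "finite Z" using independent_lin_card[OF finV Zl ind] by simp
  have CN: "CN_ideals V y I C N" using decomposition(4) by (simp add: geom_vertex_decomp_def)
  note con = CN_contractions[OF CN decomposition(1,3)]
  have finS: "finite ?S" using finV by simp
  show ?case
  proof (cases "\<exists>z\<in>Z. lcoeff z y \<noteq> 0")
    case False
    then have ZS: "Z \<subseteq> lin ?S" using Zl lin_remove_iff[of _ V y] by blast
    have "N \<inter> polys ?S = star ?S Z c"
      unfolding con I_eq by (rule star_contraction_unused[OF ZS decomposition(3)])
    then show ?thesis using decomposition(8)[OF finS ZS ind c] by simp
  next
    case True
    then obtain z where z: "z \<in> Z" "lcoeff z y \<noteq> 0" by blast
    let ?Z = "Z - {z}"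
    have others: "\<forall>z'\<in>?Z. lcoeff z' y = 0"
    proof (rule ccontr)
      assume "\<not> ?thesis"
      then obtain z' where "z' \<in> Z" "z \<noteq> z'" "lcoeff z' y \<noteq> 0" by blast
      then have "\<not> geom_vertex_decomp V y (star V Z c) C N"
        using z by (intro two_forms_no_decomp[OF finV decomposition(3) finZ Zl poly_vs.independent_mono[OF ind] c z(1) _ _ z(2)]) auto
      then show False using decomposition(4) I_eq by simp
    qed
    have ZS: "?Z \<subseteq> lin ?S" using others Zl lin_remove_iff[of _ V y] by blast
    have zl: "z \<in> lin V" using z(1) Zl by blast
    have fZ: "finite ?Z" using finZ by simp
    note ctx = decomposition(3) zl z(2) ZS fZ
    have Z_eq: "insert z ?Z = Z" using z(1) by blast
    have card: "card Z = Suc (card ?Z)" using card_Suc_Diff1[OF finZ z(1)] by simp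
    have ind': "poly_vs.independent ?Z" using ind poly_vs.independent_mono by blast
    have "triangulable ?Z"
    proof (cases "c < card ?Z")
      case True
      have "C \<inter> polys ?S = star ?S ?Z c"
        unfolding con I_eq using idl_ylead_star[OF ctx, of c] unfolding Z_eq .
      then show ?thesis using decomposition(7)[OF finS ZS ind' c(1) True] by simp
    next
      case False
      then have cZ: "card ?Z = c" using card c(2) by simp
      show ?thesis
      proof (cases "c = 1")
        case True
        then obtain z0 where z0: "?Z = {z0}" using cZ card_1_singletonE by metis
        then have "z0 \<in> lin V" "z0 \<noteq> 0"
          using ZS lin_mono[of ?S V] ind' poly_vs.dependent_zero[of ?Z] by auto
        then obtain x where "lcoeff z0 x \<noteq> 0" using lin_exists_coeff by blast
        then show ?thesis unfolding z0 by (intro triangulable.intros) auto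
      next
        case False
        then obtain c' where c': "c = Suc c'" "1 \<le> c'" using c(1) by (cases c) auto
        have "N \<inter> polys ?S = star ?S ?Z c'"
          unfolding con I_eq c'(1) using star_contraction_single[OF ctx, of c'] unfolding Z_eq .
        then show ?thesis using decomposition(8)[OF finS ZS ind' c'(2)] cZ c'(1) by simp
      qed
    qed
    then show ?thesis using triangulable.insert[OF z(2) others] Z_eq by simp
  qed
qed

text \<open>
  Gaussian elimination: if \<open>U\<close> contains a form \<open>z\<close> involving \<open>y\<close>, then \<open>U\<close> is spanned by \<open>z\<close> and its
  subspace of forms free of \<open>y\<close>.
\<close>
lemma triangulable_basis:
  fixes U :: "'k::field mpoly set"
  assumes "finite V" "poly_vs.subspace U" "U \<subseteq> lin V"
  shows "\<exists>Z. triangulable Z \<and> poly_vs.span Z = U"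
  using assms
proof (induction V arbitrary: U rule: finite_induct)
  case empty
  then have "U = {0}" using poly_vs.subspace_0[OF empty(1)] by (auto simp: poly_vs.span_empty)
  then show ?case using triangulable.empty poly_vs.span_empty by metis
next
  case (insert y V)
  let ?U = "U \<inter> lin V"
  have "poly_vs.subspace ?U" using insert.prems(1) poly_vs.subspace_span by (rule poly_vs.subspace_inter)
  then obtain Z where Z: "triangulable Z" "poly_vs.span Z = ?U" using insert.IH by blast
  have rem: "u \<in> lin V \<longleftrightarrow> lcoeff u y = 0" if "u \<in> U" for u
  proof -
    have "insert y V - {y} = V" using insert.hyps(2) by auto
    then show ?thesis using lin_remove_iff[of u "insert y V" y] that insert.prems(2) by auto
  qed
  show ?case
  proof (cases "\<exists>z\<in>U. lcoeff z y \<noteq> 0")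
    case False
    then have "?U = U" using rem by blast
    then show ?thesis using Z by metis
  next
    case True
    then obtain z where z: "z \<in> U" "lcoeff z y \<noteq> 0" by blast
    have "\<forall>z'\<in>Z. lcoeff z' y = 0" using Z(2) rem poly_vs.span_superset[of Z] by blast
    then have "triangulable (insert z Z)" by (rule triangulable.insert[OF z(2) _ Z(1)])
    moreover have "poly_vs.span (insert z Z) = U"
    proof
      have "Z \<subseteq> U" using Z(2) poly_vs.span_superset[of Z] by blast
      then show "poly_vs.span (insert z Z) \<subseteq> U" using z(1) insert.prems(1) by (intro poly_vs.span_minimal) auto
      show "U \<subseteq> poly_vs.span (insert z Z)"
      proof
        fix u assume u: "u \<in> U"
        let ?k = "lcoeff u y / lcoeff z y"
        have "u - Const ?k * z \<in> U"
          using insert.prems(1) u z(1) by (intro poly_vs.subspace_diff poly_vs.subspace_scale)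
        moreover have "lcoeff (u - Const ?k * z) y = 0" using z(2) by (simp add: lookup_minus lookup_Const_mult)
        ultimately have "u - Const ?k * z \<in> poly_vs.span Z" using rem Z(2) by blast
        then show "u \<in> poly_vs.span (insert z Z)" unfolding poly_vs.span_insert by blast
      qed
    qed
    ultimately show ?thesis by blast
  qed
qed

lemma star_full: "finite Z \<Longrightarrow> Z \<subseteq> lin V \<Longrightarrow> star V Z (card Z) = idl V Z"
proof -
  assume fin: "finite Z" and l: "Z \<subseteq> lin V"
  have "{J. J \<subseteq> Z \<and> card J = card Z} = {Z}" using fin card_subset_eq by blast
  moreover have "idl V Z \<subseteq> polys V" using l lin_polys by (intro idl_subset_polys) blast
  ultimately show ?thesis by (auto simp: star_def)
qed

section \<open>The four cases\<close>

text \<open>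
  The generators may be replaced by any other spanning set, in particular by a triangulable one.
\<close>
lemma gvd_idl_lin:
  fixes Z :: "'k::field mpoly set"
  assumes "finite V" "Z \<subseteq> lin V"
  shows "gvd_ideal V (idl V Z)"
proof -
  obtain Z' where Z': "triangulable Z'" "poly_vs.span Z' = poly_vs.span Z"
    using triangulable_basis[OF assms(1) poly_vs.subspace_span, of Z] poly_vs.span_minimal[OF assms(2) poly_vs.subspace_span]
    by blast
  have l: "Z' \<subseteq> lin V"
    using Z'(2) poly_vs.span_superset[of Z'] poly_vs.span_minimal[OF assms(2) poly_vs.subspace_span] by blast
  have "idl V Z = idl V Z'" using assms(2) l Z'(2) lin_polys by (intro idl_span) blast+
  also have "\<dots> = star V Z' (card Z')" using star_full[OF triangulable_finite[OF Z'(1)] l] by simp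
  finally show ?thesis using triangulable_imp_gvd[OF Z'(1) assms(1) l] by simp
qed

text \<open>
  If at most one form involved \<open>y\<close>, then at least \<open>n + 1\<close> of the others would be independent forms in
  the \<open>n\<close> remaining variables.
\<close>
lemma gvd_too_many_forms:
  fixes Z :: "'k::field mpoly set"
  assumes "finite Z" "Z \<subseteq> lin {0..n}" "n + 1 < card Z" "1 \<le> c" "c \<le> n"
    and gen: "\<And>S. S \<subseteq> Z \<Longrightarrow> card S \<le> n + 1 \<Longrightarrow> poly_vs.independent S"
  shows "\<not> gvd_ideal {0..n} (star {0..n} Z c)"
proof
  have gen': "S \<subseteq> Z \<Longrightarrow> card S \<le> c + 1 \<Longrightarrow> poly_vs.independent S" for S
    using gen assms(5) by simp
  have cZ: "c < card Z" using assms by simp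
  have two: "\<exists>z1\<in>Z. \<exists>z2\<in>Z. z1 \<noteq> z2 \<and> lcoeff z1 y \<noteq> 0 \<and> lcoeff z2 y \<noteq> 0" if y: "y \<in> {0..n}" for y
  proof (rule ccontr)
    assume "\<not> ?thesis"
    then obtain z where z: "\<And>z'. z' \<in> Z - {z} \<Longrightarrow> lcoeff z' y = 0" by blast
    have "n + 1 \<le> card (Z - {z})" using assms(1,3) card_Diff_singleton_if[of Z z] by (simp split: if_splits)
    then obtain T where T: "T \<subseteq> Z - {z}" "card T = n + 1" by (meson obtain_subset_with_card_n)
    have "T \<subseteq> lin ({0..n} - {y})" using T(1) z assms(2) lin_remove_iff[of _ "{0..n}" y] by blast
    moreover have "poly_vs.independent T" using gen[of T] T by auto
    ultimately have "card T \<le> card ({0..n} - {y})" using independent_lin_card[of "{0..n} - {y}" T] by simp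
    then show False using T(2) y by simp
  qed
  assume "gvd_ideal {0..n} (star {0..n} Z c)"
  then show False
  proof (cases rule: gvd_ideal.cases)
    case unit
    then show False using star_not_unit[OF _ assms(1,2) gen' assms(4) cZ] by simp
  next
    case (variables W)
    then show False using star_not_variables[OF _ assms(1,2) gen' assms(4) cZ] by simp
  next
    case (decomposition y C N)
    then show False
      using two[of y] two_forms_no_decomp[OF _ _ assms(1,2) gen' assms(4) cZ] by fastforce
  qed
qed

lemma star_ideal_eq:
  assumes "inj_on L {1..l}" "\<And>i. i \<in> {1..l} \<Longrightarrow> linear_form n (L i)" "c \<le> l"
  shows "star_ideal n l c L = star {0..n} (L ` {1..l}) c"
proof -
  have lin: "L ` {1..l} \<subseteq> lin {0..n}" using assms(2) linear_form_lin by blast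
  have eq: "{J. J \<subseteq> L ` {1..l} \<and> card J = c} = (`) L ` {J. J \<subseteq> {1..l} \<and> card J = c}"
  proof (rule subset_antisym; rule subsetI)
    fix J assume "J \<in> {J. J \<subseteq> L ` {1..l} \<and> card J = c}"
    then obtain K where K: "K \<subseteq> {1..l}" "J = L ` K" "card J = c" by (auto simp: subset_image_iff)
    then have "card K = c" using card_image[OF inj_on_subset[OF assms(1) K(1)]] by simp
    then show "J \<in> (`) L ` {J. J \<subseteq> {1..l} \<and> card J = c}" using K by blast
  next
    fix J assume "J \<in> (`) L ` {J. J \<subseteq> {1..l} \<and> card J = c}"
    then obtain K where K: "K \<subseteq> {1..l}" "J = L ` K" "card K = c" by blast
    then show "J \<in> {J. J \<subseteq> L ` {1..l} \<and> card J = c}"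
      using card_image[OF inj_on_subset[OF assms(1) K(1)]] by auto
  qed
  have "star {0..n} (L ` {1..l}) c = polys {0..n} \<inter> star_ideal n l c L"
    unfolding star_def star_ideal_def eq by simp
  moreover obtain K where K: "K \<subseteq> {1..l}" "card K = c"
    using assms(3) obtain_subset_with_card_n[of c "{1..l}"] by auto
  have "idl {0..n} (L ` K) \<subseteq> polys {0..n}" using K(1) lin lin_polys by (intro idl_subset_polys) blast
  then have "star_ideal n l c L \<subseteq> polys {0..n}" unfolding star_ideal_def using K by blast
  ultimately show ?thesis by blast
qed

text \<open>
  A bijection between the complements fills in the missing values.
\<close>
lemma extend_to_permutation:
  assumes "finite B" "A \<subseteq> B" "inj_on f A" "f ` A \<subseteq> B"
  shows "\<exists>p. p permutes B \<and> (\<forall>a\<in>A. p a = f a)"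
proof -
  have fA: "finite A" using assms finite_subset by blast
  have "card (B - A) = card (B - f ` A)"
    using assms fA by (simp add: card_Diff_subset card_image)
  then obtain g where g: "bij_betw g (B - A) (B - f ` A)"
    using finite_same_card_bij[of "B - A" "B - f ` A"] assms(1) by auto
  define p where "p x = (if x \<in> A then f x else if x \<in> B then g x else x)" for x
  have 1: "bij_betw p A (f ` A)"
    using assms(3) by (auto simp: bij_betw_def p_def inj_on_def)
  have 2: "bij_betw p (B - A) (B - f ` A)"
    using g by (rule bij_betw_cong[THEN iffD1, rotated]) (simp add: p_def)
  have "bij_betw p (A \<union> (B - A)) (f ` A \<union> (B - f ` A))" by (rule bij_betw_combine[OF 1 2]) auto
  moreover have "A \<union> (B - A) = B" "f ` A \<union> (B - f ` A) = B" using assms by auto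
  ultimately have "p permutes B" using assms(2) by (intro bij_imp_permutes) (auto simp: p_def)
  then show ?thesis by (intro exI[of _ p]) (simp add: p_def)
qed

text \<open>
  In the triangular matrix the column \<open>c - m\<close> vanishes in the first \<open>m\<close> rows and has a nonzero
  entry in row \<open>m + 1\<close>, so the rows can be inserted from the top.
\<close>
lemma triangular_imp_triangulable:
  assumes "triangular c (\<lambda>i j. coeff_matrix L (\<sigma> i) (\<tau> j))" "m \<le> c + 1"
  shows "triangulable (L ` \<sigma> ` {1..m})"
proof -
  have zero: "i \<in> {1..c + 1} \<Longrightarrow> j \<in> {0..c} \<Longrightarrow> i + j < c + 1 \<Longrightarrow> lcoeff (L (\<sigma> i)) (\<tau> j) = 0"
    and nonzero: "i \<in> {1..c + 1} \<Longrightarrow> lcoeff (L (\<sigma> i)) (\<tau> (c + 1 - i)) \<noteq> 0" for i j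
    using assms(1) unfolding triangular_def coeff_matrix_def by blast+
  show ?thesis
    using assms(2)
  proof (induction m)
    case 0
    show ?case by (simp add: triangulable.empty)
  next
    case (Suc m)
    have "L ` \<sigma> ` {1..Suc m} = insert (L (\<sigma> (Suc m))) (L ` \<sigma> ` {1..m})"
      by (auto simp: atLeastAtMostSuc_conv)
    moreover have "lcoeff (L (\<sigma> (Suc m))) (\<tau> (c - m)) \<noteq> 0"
      using nonzero[of "Suc m"] Suc.prems by simp
    moreover have "lcoeff (L (\<sigma> i)) (\<tau> (c - m)) = 0" if "i \<in> {1..m}" for i
      by (rule zero) (use Suc.prems that in auto)
    moreover have "triangulable (L ` \<sigma> ` {1..m})" using Suc by simp
    ultimately show ?case using triangulable.insert[of "L (\<sigma> (Suc m))" "\<tau> (c - m)" "L ` \<sigma> ` {1..m}"] by simp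
  qed
qed

lemma triangulable_enumeration:
  assumes "triangulable Z"
  shows "\<exists>z v. bij_betw z {1..card Z} Z \<and> (\<forall>i\<in>{1..card Z}. lcoeff (z i) (v i) \<noteq> 0) \<and>
           (\<forall>i\<in>{1..card Z}. \<forall>j\<in>{1..card Z}. i < j \<longrightarrow> lcoeff (z i) (v j) = 0)"
  using assms
proof (induction rule: triangulable.induct)
  case empty
  show ?case by (auto simp: bij_betw_def)
next
  case (insert x y Z)
  let ?m = "card Z"
  from insert obtain z v where zv: "bij_betw z {1..?m} Z" "\<forall>i\<in>{1..?m}. lcoeff (z i) (v i) \<noteq> 0"
    "\<forall>i\<in>{1..?m}. \<forall>j\<in>{1..?m}. i < j \<longrightarrow> lcoeff (z i) (v j) = 0" by blast
  have x: "x \<notin> Z" using insert by auto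
  have card: "card (insert x Z) = Suc ?m" using x triangulable_finite[OF insert(3)] by simp
  let ?z = "z(Suc ?m := x)" and ?v = "v(Suc ?m := y)"
  have "bij_betw ?z {1..?m} Z"
    using zv(1) by (rule bij_betw_cong[THEN iffD1, rotated]) auto
  then have "bij_betw ?z (insert (Suc ?m) {1..?m}) (insert x Z)"
    using x notIn_Un_bij_betw[of "Suc ?m" "{1..?m}" ?z Z] by simp
  then have "bij_betw ?z {1..Suc ?m} (insert x Z)" by (simp add: atLeastAtMostSuc_conv)
  moreover have "\<forall>i\<in>{1..Suc ?m}. lcoeff (?z i) (?v i) \<noteq> 0"
    using zv(2) insert(1) by (auto simp: atLeastAtMostSuc_conv)
  moreover have "\<forall>i\<in>{1..Suc ?m}. \<forall>j\<in>{1..Suc ?m}. i < j \<longrightarrow> lcoeff (?z i) (?v j) = 0"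
  proof (intro ballI impI)
    fix i j assume ij: "i \<in> {1..Suc ?m}" "j \<in> {1..Suc ?m}" "i < j"
    then have i: "i \<in> {1..?m}" by auto
    then have "z i \<in> Z" using zv(1) by (auto simp: bij_betw_def)
    then show "lcoeff (?z i) (?v j) = 0" using zv(3) insert(2) i ij by (cases "j = Suc ?m") auto
  qed
  ultimately show ?case unfolding card by blast
qed

text \<open>
  Listing the forms in the order of their insertion gives the rows from the top; the variables that
  belong to them are the columns \<open>c, c - 1, \<dots>, 0\<close>. Distinct forms have distinct variables, so both
  lists extend to permutations.
\<close>
lemma triangulable_iff_triangular:
  assumes "inj_on L {1..c + 1}" "\<And>i. i \<in> {1..c + 1} \<Longrightarrow> linear_form n (L i)" "c \<le> n"
  shows "triangulable (L ` {1..c + 1}) \<longleftrightarrow>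
    (\<exists>\<sigma> \<tau>. \<sigma> permutes {1..c + 1} \<and> \<tau> permutes {0..n} \<and> triangular c (\<lambda>i j. coeff_matrix L (\<sigma> i) (\<tau> j)))"
    (is "?T \<longleftrightarrow> ?P")
proof
  assume ?P
  then obtain \<sigma> \<tau> where "\<sigma> permutes {1..c + 1}" "triangular c (\<lambda>i j. coeff_matrix L (\<sigma> i) (\<tau> j))" by blast
  then show ?T using triangular_imp_triangulable[of c L \<sigma> \<tau> "c + 1"] permutes_image[of \<sigma> "{1..c + 1}"] by simp
next
  assume ?T
  let ?l = "c + 1"
  have lin: "L ` {1..?l} \<subseteq> lin {0..n}" using assms(2) linear_form_lin by blast
  have card: "card (L ` {1..?l}) = ?l" using card_image[OF assms(1)] by simp
  obtain z v where zv: "bij_betw z {1..?l} (L ` {1..?l})" "\<And>i. i \<in> {1..?l} \<Longrightarrow> lcoeff (z i) (v i) \<noteq> 0"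
    "\<And>i j. i \<in> {1..?l} \<Longrightarrow> j \<in> {1..?l} \<Longrightarrow> i < j \<Longrightarrow> lcoeff (z i) (v j) = 0"
    using triangulable_enumeration[OF \<open>?T\<close>] unfolding card by blast
  let ?s = "\<lambda>i. inv_into {1..?l} L (z i)" and ?t = "\<lambda>j. v (?l - j)"
  have zin: "z i \<in> L ` {1..?l}" if "i \<in> {1..?l}" for i using zv(1) that by (auto simp: bij_betw_def)
  have Ls: "L (?s i) = z i" "?s i \<in> {1..?l}" if "i \<in> {1..?l}" for i
    using f_inv_into_f[OF zin[OF that]] inv_into_into[OF zin[OF that]] by auto
  have "inj_on ?s {1..?l}"
  proof (rule inj_onI)
    fix i j assume ij: "i \<in> {1..?l}" "j \<in> {1..?l}" "?s i = ?s j"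
    then have "z i = z j" using Ls(1) by metis
    then show "i = j" using zv(1) ij by (auto simp: bij_betw_def inj_on_def)
  qed
  then obtain \<sigma> where \<sigma>: "\<sigma> permutes {1..?l}" "\<And>i. i \<in> {1..?l} \<Longrightarrow> \<sigma> i = ?s i"
    using extend_to_permutation[of "{1..?l}" "{1..?l}" ?s] Ls(2) by blast
  have vin: "v i \<in> {0..n}" if "i \<in> {1..?l}" for i
    using lin_coeff_index[of "z i" "{0..n}" "v i"] zin[OF that] lin zv(2)[OF that] by blast
  have vinj: "i = j" if "i \<in> {1..?l}" "j \<in> {1..?l}" "v i = v j" for i j
    using zv(2)[OF that(1)] zv(2)[OF that(2)] zv(3)[of i j] zv(3)[of j i] that by (metis linorder_cases)
  have idx: "?l - j \<in> {1..?l}" if "j \<in> {0..c}" for j using that by auto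
  have "inj_on ?t {0..c}"
  proof (rule inj_onI)
    fix i j assume ij: "i \<in> {0..c}" "j \<in> {0..c}" "?t i = ?t j"
    then have "?l - i = ?l - j" using vinj idx by blast
    then show "i = j" using ij by auto
  qed
  moreover have "?t ` {0..c} \<subseteq> {0..n}" using vin idx by blast
  ultimately obtain \<tau> where \<tau>: "\<tau> permutes {0..n}" "\<And>j. j \<in> {0..c} \<Longrightarrow> \<tau> j = ?t j"
    using extend_to_permutation[of "{0..n}" "{0..c}" ?t] assms(3) by auto
  have "triangular c (\<lambda>i j. coeff_matrix L (\<sigma> i) (\<tau> j))"
    unfolding triangular_def coeff_matrix_def
  proof (intro ballI conjI impI)
    fix i j assume i: "i \<in> {1..c + 1}" and j: "j \<in> {0..c}" and "i + j < c + 1"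
    then have "i < ?l - j" by simp
    then show "lcoeff (L (\<sigma> i)) (\<tau> j) = 0"
      using zv(3)[OF i idx[OF j]] \<sigma>(2)[OF i] \<tau>(2)[OF j] Ls(1)[OF i] by simp
  next
    fix i assume i: "i \<in> {1..c + 1}"
    then have "c + 1 - i \<in> {0..c}" "?l - (c + 1 - i) = i" by auto
    then show "lcoeff (L (\<sigma> i)) (\<tau> (c + 1 - i)) \<noteq> 0"
      using zv(2)[OF i] \<sigma>(2)[OF i] \<tau>(2) Ls(1)[OF i] by simp
  qed
  then show ?P using \<sigma>(1) \<tau>(1) by blast
qed

theorem theorem1p2:
  fixes n c l :: nat and L :: "nat \<Rightarrow> 'k::field mpoly"
  assumes "infinite (UNIV :: 'k set)"
    and "1 \<le> c" and "c \<le> n" and "c \<le> l"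
    and "general_linear_forms n l L"
  shows "(l = c \<longrightarrow> gvd_ideal {0..n} (star_ideal n l c L)) \<and>
    (l = c + 1 \<longrightarrow>
       (gvd_ideal {0..n} (star_ideal n l c L) \<longleftrightarrow>
        (\<exists>\<sigma> \<tau>. \<sigma> permutes {1..l} \<and> \<tau> permutes {0..n} \<and>
               triangular c (\<lambda>i j. coeff_matrix L (\<sigma> i) (\<tau> j))))) \<and>
    (c + 1 < l \<and> l \<le> n + 1 \<longrightarrow>
       (gvd_ideal {0..n} (star_ideal n l c L) \<longleftrightarrow>
        gvd_ideal {0..n} (star_ideal n l (l - 1) L))) \<and>
    (l > n + 1 \<longrightarrow> \<not> gvd_ideal {0..n} (star_ideal n l c L))"
proof -
  let ?V = "{0..n}" and ?Z = "L ` {1..l}"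
  have inj: "inj_on L {1..l}" and forms: "\<And>i. i \<in> {1..l} \<Longrightarrow> linear_form n (L i)"
    and gen: "\<And>S. S \<subseteq> ?Z \<Longrightarrow> card S \<le> min l (n + 1) \<Longrightarrow> poly_vs.independent S"
    using assms(5) by (auto simp: general_linear_forms_def)
  have Z: "?Z \<subseteq> lin ?V" "finite ?Z" "card ?Z = l"
    using linear_form_lin[OF forms] card_image[OF inj] by auto
  have star: "star_ideal n l e L = star ?V ?Z e" if "e \<le> l" for e
    by (rule star_ideal_eq[OF inj forms that])
  have iff: "gvd_ideal ?V (star ?V ?Z e) \<longleftrightarrow> triangulable ?Z" if "1 \<le> e" "e < l" "l \<le> n + 1" for e
    using triangulable_imp_gvd[of ?Z ?V e] gvd_imp_triangulable[of ?V "star ?V ?Z e" ?Z e] gen[of ?Z] Z that by auto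
  have 1: "gvd_ideal ?V (star_ideal n l c L)" if "l = c"
    using gvd_idl_lin[of ?V ?Z] star_full[OF Z(2,1)] star[of c] Z that by simp
  have 2: "gvd_ideal ?V (star_ideal n l c L) \<longleftrightarrow>
      (\<exists>\<sigma> \<tau>. \<sigma> permutes {1..l} \<and> \<tau> permutes {0..n} \<and> triangular c (\<lambda>i j. coeff_matrix L (\<sigma> i) (\<tau> j)))" if "l = c + 1"
    using star[of c] iff[of c] triangulable_iff_triangular[of L c n] inj forms assms(2,3) that by simp
  have 3: "gvd_ideal ?V (star_ideal n l c L) \<longleftrightarrow> gvd_ideal ?V (star_ideal n l (l - 1) L)"
    if "c + 1 < l" "l \<le> n + 1"
    using star[of c] star[of "l - 1"] iff[of c] iff[of "l - 1"] assms(2) that by simp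
  have 4: "\<not> gvd_ideal ?V (star_ideal n l c L)" if "l > n + 1"
    using gvd_too_many_forms[OF Z(2,1) _ assms(2,3)] gen star[of c] Z(3) assms(4) that by simp
  show ?thesis using 1 2 3 4 by blast
qed

end
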